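(* Let $\mathbb{F}$ be an algebraically closed field of characteristic $p>0$, $\mathsf{R}=\mathbb{F}[x]$, and $0\neq h\in\mathsf{R}$. Let $\mathsf{V}$ be an irreducible $\mathsf{A}_h$-module. Then either (i) for some $\lambda,\theta\in\mathbb{F}$ with $h(\lambda)=0$, $\mathsf{V}\cong\mathsf{V}_{\lambda,\theta}=\mathbb{F}v_{\lambda,\theta}$, where $x.v_{\lambda,\theta}=\lambda v_{\lambda,\theta}$ and $y.v_{\lambda,\theta}=\theta v_{\lambda,\theta}$; or (ii) for some $\lambda,\beta\in\mathbb{F}$ with $h(\lambda)\neq 0$, $\mathsf{V}\cong\mathsf{L}(\mathfrak{m},z_\beta)=\bigoplus_{n=0}^{p-1}\mathbb{F}v_n$, where $\mathfrak{m}=\mathsf{R}(x-\lambda)$ and the action of $\mathsf{A}_h$ is given by $$y.v_n=\begin{cases}v_{n+1}&\text{if }0\leq n<p-1,\\ \frac{\delta^p(x)}{h(x)}\Big|_{x=\lambda}v_1+\beta v_0&\text{if }n=p-1;\end{cases}\qquad x.v_n=\sum_{j=0}^n(-1)^j\binom{n}{j}\delta^j(x)|_{x=\lambda}\,v_{n-j}.$$ Hence, if $\mathsf{P}$ is a primitive ideal of $\mathsf{A}_h$, then $\mathsf{P}$ is equal to one of the following: (i) $\mathrm{Ann}_{\mathsf{A}_h}(\mathsf{L}(\mathfrak{m},\bar g))$ for some $\mathfrak{m}=\mathsf{R}(x-\lambda)$, where $h(\lambda)=0$, and some $g=y-\theta$, where $\theta\in\mathbb{F}$; or (ii) $\mathrm{Ann}_{\mathsf{A}_h}(\mathsf{L}(\mathfrak{m},z_\beta))$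 for some $\mathfrak{m}=\mathsf{R}(x-\lambda)$, where $h(\lambda)\neq 0$, and some $z_\beta=y^p-y\frac{\delta^p(x)}{h(x)}-\beta$ in the center of $\mathsf{A}_h$, where $\beta\in\mathbb{F}$.
   Context: $\mathsf{A}_h$ is the unital associative $\mathbb{F}$-algebra with generators $x,y$ and defining relation $yx=xy+h$; throughout $h\neq 0$. It is a free left and right module over $\mathsf{R}=\mathbb{F}[x]$ with basis $\{y^n\mid n\geq 0\}$. $\delta:\mathsf{R}\to\mathsf{R}$ is the derivation $\delta(r)=r'h$. Modules are left modules. A primitive ideal is the annihilator of an irreducible module. In characteristic $p$, $\frac{\delta^p(x)}{h(x)}$ is a polynomial in $x^p$, and $y^p-y\frac{\delta^p(x)}{h(x)}$ is central in $\mathsf{A}_h$. For a maximal ideal $\mathfrak{m}$ of $\mathsf{R}$, $\mathsf{U}(\mathfrak{m}):=\mathsf{A}_h\otimes_{\mathsf{R}}\mathsf{R}/\mathfrak{m}$. For $\beta\in\mathbb{F}$ let $z_\beta=y^p-y\frac{\delta^p(x)}{h(x)}-\beta$ and $\mathsf{L}(\mathfrak{m},z_\beta):=\mathsf{U}(\mathfrak{m})/z_\beta\mathsf{U}(\mathfrak{m})$; here $v_n=y^n.\overline u_{\mathfrak{m}}$, with $\overline u_{\mathfrak{m}}$ the image of $1\otimes(1+\mathfrak{m})$. For $\mathfrak{m}=\mathsf{R}(x-\lambda)$ with $h(\lambda)=0$ and $g=y-\theta$, $\bar g$ denotes the image of $g$ in $(\mathsf{R}/\mathfrak{m})[y]$,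 and $\mathsf{L}(\mathfrak{m},\bar g):=\mathsf{U}(\mathfrak{m})/g\,\mathsf{U}(\mathfrak{m})$ (where $g\,\mathsf{U}(\mathfrak{m})$ is an $\mathsf{A}_h$-submodule because $h(\lambda)=0$). *)

theory Defs
  imports
    "HOL-Algebra.Algebra"
    "HOL-Algebra.Algebraic_Closure_Type"
    "HOL-Algebra.Free_Abelian_Groups"
begin

section \<open>Left modules over a not necessarily commutative ring\<close>

text \<open>
  The library locale \<open>module\<close> requires a commutative ring of scalars. The record
  \<open>module\<close> and the locale \<open>submodule\<close> do not, and are reused here. The fields
  \<open>mult\<close> and \<open>one\<close> of the record play no role for modules.
\<close>

locale left_module = R?: ring R + M?: abelian_group M
  for R :: "('r, 'k) ring_scheme" (structure) and M :: "('r, 'v, 'm) module_scheme" (structure) +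
  assumes smult_closed: "\<lbrakk>a \<in> carrier R; v \<in> carrier M\<rbrakk> \<Longrightarrow> a \<odot>\<^bsub>M\<^esub> v \<in> carrier M"
    and smult_l_distr: "\<lbrakk>a \<in> carrier R; b \<in> carrier R; v \<in> carrier M\<rbrakk>
          \<Longrightarrow> (a \<oplus>\<^bsub>R\<^esub> b) \<odot>\<^bsub>M\<^esub> v = a \<odot>\<^bsub>M\<^esub> v \<oplus>\<^bsub>M\<^esub> b \<odot>\<^bsub>M\<^esub> v"
    and smult_r_distr: "\<lbrakk>a \<in> carrier R; v \<in> carrier M; w \<in> carrier M\<rbrakk>
          \<Longrightarrow> a \<odot>\<^bsub>M\<^esub> (v \<oplus>\<^bsub>M\<^esub> w) = a \<odot>\<^bsub>M\<^esub> v \<oplus>\<^bsub>M\<^esub> a \<odot>\<^bsub>M\<^esub> w"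
    and smult_assoc: "\<lbrakk>a \<in> carrier R; b \<in> carrier R; v \<in> carrier M\<rbrakk>
          \<Longrightarrow> (a \<otimes>\<^bsub>R\<^esub> b) \<odot>\<^bsub>M\<^esub> v = a \<odot>\<^bsub>M\<^esub> (b \<odot>\<^bsub>M\<^esub> v)"
    and smult_one: "v \<in> carrier M \<Longrightarrow> \<one>\<^bsub>R\<^esub> \<odot>\<^bsub>M\<^esub> v = v"

definition irreducible_module ::
    "('r, 'k) ring_scheme \<Rightarrow> ('r, 'v, 'm) module_scheme \<Rightarrow> bool" where
  "irreducible_module R M \<longleftrightarrow>
     left_module R M \<and> carrier M \<noteq> {\<zero>\<^bsub>M\<^esub>} \<and>
     (\<forall>N. submodule N R M \<longrightarrow> N = {\<zero>\<^bsub>M\<^esub>} \<or> N = carrier M)"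

definition module_isomorphic ::
    "('r, 'k) ring_scheme \<Rightarrow> ('r, 'v, 'm) module_scheme \<Rightarrow> ('r, 'w, 'n) module_scheme \<Rightarrow> bool" where
  "module_isomorphic R M N \<longleftrightarrow>
     (\<exists>f \<in> iso (add_monoid M) (add_monoid N).
        \<forall>a \<in> carrier R. \<forall>v \<in> carrier M. f (a \<odot>\<^bsub>M\<^esub> v) = a \<odot>\<^bsub>N\<^esub> f v)"

definition annihilator ::
    "('r, 'k) ring_scheme \<Rightarrow> ('r, 'v, 'm) module_scheme \<Rightarrow> 'r set" where
  "annihilator R M = {a \<in> carrier R. \<forall>v \<in> carrier M. a \<odot>\<^bsub>M\<^esub> v = \<zero>\<^bsub>M\<^esub>}"

text \<open>
  HOL cannot quantify over types inside a definition, so the type that carries the irreducible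
  module is a parameter. An irreducible module is a quotient of the ring by a left ideal, so
  every primitive ideal already arises with \<open>'v = 'r set\<close>.
\<close>

definition primitive_ideal :: "'v itself \<Rightarrow> ('r, 'k) ring_scheme \<Rightarrow> 'r set \<Rightarrow> bool" where
  "primitive_ideal (_ :: 'v itself) R P \<longleftrightarrow>
     (\<exists>M :: ('r, 'v) module. irreducible_module R M \<and> P = annihilator R M)"

definition ring_center :: "('r, 'k) ring_scheme \<Rightarrow> 'r set" where
  "ring_center R = {z \<in> carrier R. \<forall>a \<in> carrier R. z \<otimes>\<^bsub>R\<^esub> a = a \<otimes>\<^bsub>R\<^esub> z}"

text \<open>In the next definition, \<open>N\<close> is meant to be a submodule of \<open>M\<close>.\<close>

definition quotient_module :: "('r, 'v, 'm) module_scheme \<Rightarrow> 'v set \<Rightarrow> ('r, 'v set) module" where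
  "quotient_module M N =
     \<lparr>carrier = a_rcosets\<^bsub>M\<^esub> N, monoid.mult = undefined, one = undefined,
      ring.zero = N, add = set_add M,
      module.smult = (\<lambda>a C. N <+>\<^bsub>M\<^esub> ((\<lambda>v. a \<odot>\<^bsub>M\<^esub> v) ` C))\<rparr>"

definition quotient_ring_module :: "('r, 'k) ring_scheme \<Rightarrow> 'r set \<Rightarrow> ('r, 'r set) module" where
  "quotient_ring_module R I =
     \<lparr>carrier = carrier (R Quot I), monoid.mult = monoid.mult (R Quot I), one = monoid.one (R Quot I),
      ring.zero = ring.zero (R Quot I), add = ring.add (R Quot I),
      module.smult = (\<lambda>r C. (I +>\<^bsub>R\<^esub> r) \<otimes>\<^bsub>R Quot I\<^esub> C)\<rparr>"


section \<open>Tensor products\<close>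

text \<open>
  For a ring homomorphism \<open>\<phi>\<close> from \<open>R\<close> to \<open>A\<close>, the ring \<open>A\<close> is a right \<open>R\<close>-module via \<open>\<phi>\<close>. The
  tensor product of \<open>A\<close> with a left \<open>R\<close>-module \<open>N\<close> is the free abelian group on
  \<open>carrier A \<times> carrier N\<close> modulo biadditivity and \<open>R\<close>-balancedness.
\<close>

definition tensor_relations ::
    "('a, 'k) ring_scheme \<Rightarrow> ('r, 'l) ring_scheme \<Rightarrow> ('r \<Rightarrow> 'a) \<Rightarrow> ('r, 'n, 'm) module_scheme
      \<Rightarrow> ('a \<times> 'n \<Rightarrow>\<^sub>0 int) set" where
  "tensor_relations A R \<phi> N =
     {frag_of (a \<oplus>\<^bsub>A\<^esub> b, n) - (frag_of (a, n) + frag_of (b, n)) | a b n.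
        a \<in> carrier A \<and> b \<in> carrier A \<and> n \<in> carrier N} \<union>
     {frag_of (a, n \<oplus>\<^bsub>N\<^esub> n') - (frag_of (a, n) + frag_of (a, n')) | a n n'.
        a \<in> carrier A \<and> n \<in> carrier N \<and> n' \<in> carrier N} \<union>
     {frag_of (a \<otimes>\<^bsub>A\<^esub> \<phi> r, n) - frag_of (a, r \<odot>\<^bsub>N\<^esub> n) | a r n.
        a \<in> carrier A \<and> r \<in> carrier R \<and> n \<in> carrier N}"

definition tensor_kernel ::
    "('a, 'k) ring_scheme \<Rightarrow> ('r, 'l) ring_scheme \<Rightarrow> ('r \<Rightarrow> 'a) \<Rightarrow> ('r, 'n, 'm) module_scheme
      \<Rightarrow> ('a \<times> 'n \<Rightarrow>\<^sub>0 int) set" where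
  "tensor_kernel A R \<phi> N =
     generate (free_Abelian_group (carrier A \<times> carrier N)) (tensor_relations A R \<phi> N)"

definition tensor_module ::
    "('a, 'k) ring_scheme \<Rightarrow> ('r, 'l) ring_scheme \<Rightarrow> ('r \<Rightarrow> 'a) \<Rightarrow> ('r, 'n, 'm) module_scheme
      \<Rightarrow> ('a, ('a \<times> 'n \<Rightarrow>\<^sub>0 int) set) module" where
  "tensor_module A R \<phi> N =
     (let G = free_Abelian_group (carrier A \<times> carrier N); K = tensor_kernel A R \<phi> N in
      \<lparr>carrier = carrier (G Mod K), monoid.mult = undefined, one = undefined,
       ring.zero = monoid.one (G Mod K), add = monoid.mult (G Mod K),
       module.smult = (\<lambda>a C. K <#>\<^bsub>G\<^esub> (frag_extend (\<lambda>(b, n). frag_of (a \<otimes>\<^bsub>A\<^esub> b, n)) ` C))\<rparr>)"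

definition pure_tensor ::
    "('a, 'k) ring_scheme \<Rightarrow> ('r, 'l) ring_scheme \<Rightarrow> ('r \<Rightarrow> 'a) \<Rightarrow> ('r, 'n, 'm) module_scheme
      \<Rightarrow> 'a \<Rightarrow> 'n \<Rightarrow> ('a \<times> 'n \<Rightarrow>\<^sub>0 int) set" where
  "pure_tensor A R \<phi> N a n =
     tensor_kernel A R \<phi> N #>\<^bsub>free_Abelian_group (carrier A \<times> carrier N)\<^esub> frag_of (a, n)"


section \<open>The free algebra on two generators\<close>

datatype gen = Gx | Gy
datatype word = Word (letters: "gen list")

instantiation word :: monoid_add
begin
definition zero_word :: word where "0 = Word []"
definition plus_word :: "word \<Rightarrow> word \<Rightarrow> word" where "u + v = Word (letters u @ letters v)"
instance by standard (auto simp: zero_word_def plus_word_def)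
end

text \<open>
  Words under concatenation are the free monoid on the two generators, so the convolution product
  on finitely supported functions gives the free algebra.
\<close>

type_synonym 'a free_alg = "word \<Rightarrow>\<^sub>0 'a"

abbreviation free_ring :: "'a::field free_alg ring" where
  "free_ring \<equiv> ring_of_type_algebra"

definition fx :: "'a::field free_alg" where "fx = Poly_Mapping.single (Word [Gx]) 1"
definition fy :: "'a::field free_alg" where "fy = Poly_Mapping.single (Word [Gy]) 1"

definition free_const :: "'a::field \<Rightarrow> 'a free_alg" where
  "free_const c = Poly_Mapping.single 0 c"

definition free_poly :: "'a::field poly \<Rightarrow> 'a free_alg" where
  "free_poly r = (\<Sum>i\<le>degree r. free_const (coeff r i) * fx ^ i)"

definition free_eval :: "'a::field \<Rightarrow> 'a \<Rightarrow> 'a free_alg \<Rightarrow> 'a" where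
  "free_eval \<mu> \<theta> f =
     (\<Sum>w\<in>Poly_Mapping.keys f. Poly_Mapping.lookup f w *
        prod_list (map (case_gen \<mu> \<theta>) (letters w)))"


section \<open>The algebra with generators \<open>x\<close>, \<open>y\<close> and relation \<open>y x = x y + h\<close>\<close>

type_synonym 'a ore = "'a free_alg set"

definition A_ideal :: "'a::field poly \<Rightarrow> 'a free_alg set" where
  "A_ideal h = Idl\<^bsub>free_ring\<^esub> {fy * fx - (fx * fy + free_poly h)}"

definition A_alg :: "'a::field poly \<Rightarrow> 'a ore ring" where
  "A_alg h = free_ring Quot A_ideal h"

definition A_class :: "'a::field poly \<Rightarrow> 'a free_alg \<Rightarrow> 'a ore" where
  "A_class h f = A_ideal h +>\<^bsub>free_ring\<^esub> f"

definition A_x :: "'a::field poly \<Rightarrow> 'a ore" where "A_x h = A_class h fx"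
definition A_y :: "'a::field poly \<Rightarrow> 'a ore" where "A_y h = A_class h fy"
definition A_const :: "'a::field poly \<Rightarrow> 'a \<Rightarrow> 'a ore" where "A_const h c = A_class h (free_const c)"
definition A_poly :: "'a::field poly \<Rightarrow> 'a poly \<Rightarrow> 'a ore" where "A_poly h r = A_class h (free_poly r)"

text \<open>\<open>v 0, \<dots>, v (n - 1)\<close> is a basis of \<open>M\<close> over the field, which acts through \<open>A_const\<close>.\<close>

definition field_basis ::
    "'a::field poly \<Rightarrow> ('a ore, 'v, 'm) module_scheme \<Rightarrow> nat \<Rightarrow> (nat \<Rightarrow> 'v) \<Rightarrow> bool" where
  "field_basis h M n v \<longleftrightarrow>
     (\<forall>i<n. v i \<in> carrier M) \<and>
     bij_betw (\<lambda>c. \<Oplus>\<^bsub>M\<^esub>i\<in>{..<n}. A_const h (c i) \<odot>\<^bsub>M\<^esub> v i)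
       ({..<n} \<rightarrow>\<^sub>E (UNIV :: 'a set)) (carrier M)"

definition \<delta> :: "'a::field poly \<Rightarrow> 'a poly \<Rightarrow> 'a poly" where
  "\<delta> h r = pderiv r * h"

abbreviation xpoly :: "'a::field poly" where "xpoly \<equiv> [:0, 1:]"

text \<open>The division is exact for \<open>p > 0\<close>, because every value of \<open>\<delta> h\<close> is a multiple of \<open>h\<close>.\<close>

definition \<delta>quot :: "'a::field poly \<Rightarrow> nat \<Rightarrow> 'a poly" where
  "\<delta>quot h p = (\<delta> h ^^ p) xpoly div h"

definition z_elem :: "'a::field poly \<Rightarrow> nat \<Rightarrow> 'a \<Rightarrow> 'a ore" where
  "z_elem h p \<beta> =
     (A_y h [^]\<^bsub>A_alg h\<^esub> p \<ominus>\<^bsub>A_alg h\<^esub> A_y h \<otimes>\<^bsub>A_alg h\<^esub> A_poly h (\<delta>quot h p))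
       \<ominus>\<^bsub>A_alg h\<^esub> A_const h \<beta>"

definition g_elem :: "'a::field poly \<Rightarrow> 'a \<Rightarrow> 'a ore" where
  "g_elem h \<theta> = A_y h \<ominus>\<^bsub>A_alg h\<^esub> A_const h \<theta>"


section \<open>The modules\<close>

abbreviation poly_ring_R :: "'a::field poly ring" where
  "poly_ring_R \<equiv> ring_of_type_algebra"

definition max_ideal :: "'a::field \<Rightarrow> 'a poly set" where
  "max_ideal \<mu> = PIdl\<^bsub>poly_ring_R\<^esub> [:- \<mu>, 1:]"

type_synonym 'a U_carrier = "('a ore \<times> 'a poly set \<Rightarrow>\<^sub>0 int) set"

definition U_module :: "'a::field poly \<Rightarrow> 'a poly set \<Rightarrow> ('a ore, 'a U_carrier) module" where
  "U_module h \<mm> =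
     tensor_module (A_alg h) poly_ring_R (A_poly h) (quotient_ring_module poly_ring_R \<mm>)"

definition u_gen :: "'a::field poly \<Rightarrow> 'a poly set \<Rightarrow> 'a U_carrier" where
  "u_gen h \<mm> =
     pure_tensor (A_alg h) poly_ring_R (A_poly h) (quotient_ring_module poly_ring_R \<mm>)
       \<one>\<^bsub>A_alg h\<^esub> (\<mm> +>\<^bsub>poly_ring_R\<^esub> 1)"

definition mult_image :: "'a::field poly \<Rightarrow> 'a poly set \<Rightarrow> 'a ore \<Rightarrow> 'a U_carrier set" where
  "mult_image h \<mm> a = (\<lambda>u. a \<odot>\<^bsub>U_module h \<mm>\<^esub> u) ` carrier (U_module h \<mm>)"

text \<open>
  \<open>L_module h \<mm> a\<close> is \<open>U(\<mm>) / a U(\<mm>)\<close>, used with \<open>a = z_elem h p \<beta>\<close>, and with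
  \<open>a = g_elem h \<theta>\<close> when \<open>\<mm> = max_ideal \<mu>\<close> for a root \<open>\<mu>\<close> of \<open>h\<close>.
\<close>

definition L_module ::
    "'a::field poly \<Rightarrow> 'a poly set \<Rightarrow> 'a ore \<Rightarrow> ('a ore, 'a U_carrier set) module" where
  "L_module h \<mm> a = quotient_module (U_module h \<mm>) (mult_image h \<mm> a)"

definition L_vec :: "'a::field poly \<Rightarrow> 'a poly set \<Rightarrow> 'a ore \<Rightarrow> nat \<Rightarrow> 'a U_carrier set" where
  "L_vec h \<mm> a n =
     (A_y h [^]\<^bsub>A_alg h\<^esub> n) \<odot>\<^bsub>L_module h \<mm> a\<^esub>
       (mult_image h \<mm> a +>\<^bsub>U_module h \<mm>\<^esub> u_gen h \<mm>)"

text \<open>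
  The one-dimensional module on which \<open>x\<close> and \<open>y\<close> act as \<open>\<mu>\<close> and \<open>\<theta>\<close>, with basis vector \<open>1\<close>. If
  \<open>poly h \<mu> = 0\<close>, then \<open>free_eval \<mu> \<theta>\<close> is constant on each class, so the image is a singleton.
\<close>

definition V_module :: "'a::field \<Rightarrow> 'a \<Rightarrow> ('a ore, 'a) module" where
  "V_module \<mu> \<theta> =
     \<lparr>carrier = UNIV, monoid.mult = undefined, one = undefined, ring.zero = 0, add = (+),
      module.smult = (\<lambda>a c. the_elem (free_eval \<mu> \<theta> ` a) * c)\<rparr>"

end

theory Submission
  imports Defs
begin

text \<open>
  An irreducible module is the free algebra modulo a maximal left ideal \<open>J\<close> containing the defining
  relation, so that the algebra takes place among congruences modulo \<open>J\<close>. Suppose \<open>x\<close> has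
  no eigenvector. Take a nontrivial relation \<open>\<Sum>i<d. r\<^sub>i(x) y\<^sup>i \<in> J\<close> with \<open>d\<close> minimal: then, up to powers
  of its leading coefficient \<open>c\<close>, the module is free over \<open>F[x]\<close> of finite rank, yet
  every \<open>x - a\<close> acts surjectively, since \<open>(x - a)\<^sup>p\<close> is central; this is contradictory
  when \<open>c(a) \<noteq> 0\<close>. So \<open>x\<close> has an eigenvector \<open>v\<close>, with eigenvalue \<open>\<mu>\<close>.

  If \<open>h(\<mu>) = 0\<close>, then \<open>x\<close> acts as \<open>\<mu>\<close>, and \<open>y\<close> has an eigenvector, too. Otherwise
  \<open>(x - \<mu>) y\<^sup>n v = - n h(\<mu>) y\<^sup>n\<^sup>-\<^sup>1 v\<close> modulo lower powers of \<open>y\<close>, which shows that \<open>v, \<dots>, y\<^sup>p\<^sup>-\<^sup>1 v\<close> are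
  independent and that the central element \<open>z\<close> acts as a scalar. The generator of \<open>L\<close> and \<open>v\<close>
  then have the same annihilator, hence generate isomorphic modules.
\<close>

section \<open>Iterated operators\<close>

text \<open>Two obstacles shape the proof. First, \<open>V\<close> is not known to be
  finite-dimensional and the field may be countable, so that neither an eigenvalue of
  \<open>x\<close> nor a scalar action of a central element comes for free. The device is the same
  each time: irreducibility gives an operator \<open>e\<close> a left inverse \<open>g\<close> on
  the chosen generator, \<open>g\<close> is brought into a normal form in powers of
  \<open>y\<close>, and \<open>g e - 1\<close> becomes a nontrivial relation. The relation has
  coefficients in \<open>F[x]\<close> for \<open>e = y\<close>, coefficients in \<open>F[z]\<close>
  for \<open>e = z\<close>, and is a single polynomial in \<open>y\<close> when \<open>x\<close>
  acts as a scalar. Second, the normal form alone bounds \<open>U\<close> and \<open>L\<close> from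
  above but does not exclude that they collapse. The lower bound is read off from the given
  \<open>V\<close>: the universal property of the tensor product sends the generator of
  \<open>U\<close> to the eigenvector \<open>v\<close>, so whatever kills the former kills the
  latter. Conversely, dividing an annihilator of \<open>v\<close> by \<open>z\<close> (or by
  \<open>y - \<theta>\<close>) leaves a remainder that must vanish, because the relevant powers of
  \<open>y\<close> are independent on \<open>v\<close>.\<close>

lemma funpow_additive:
  fixes E :: "'b::ab_group_add \<Rightarrow> 'b"
  assumes "\<And>a b. E (a + b) = E a + E b"
  shows "(E ^^ n) (a + b) = (E ^^ n) a + (E ^^ n) b"
  by (induction n) (simp_all add: assms)

text \<open>Covers both the Leibniz rule and the expansion of \<open>r y\<^sup>n\<close> in a ring.\<close>

lemma funpow_binomial:
  fixes T :: "nat \<Rightarrow> nat \<Rightarrow> 'b::ring_1"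
  assumes add: "\<And>a b. E (a + b) = E a + E b"
    and step: "\<And>i j. E (T i j) = T (Suc i) j + T i (Suc j)"
  shows "(E ^^ n) (T 0 0) = (\<Sum>j\<le>n. of_nat (n choose j) * T (n - j) j)"
  using step
\<comment> \<open>\<open>T\<close> must vary: one application of \<open>E\<close> splits
  \<open>T\<close> into two families with a shifted index, and the induction hypothesis is used for
  each of them.\<close>
proof (induction n arbitrary: T)
  case 0
  then show ?case by simp
next
  case (Suc n)
  have "(E ^^ Suc n) (T 0 0) = (E ^^ n) (T (Suc 0) 0) + (E ^^ n) (T 0 (Suc 0))"
    by (simp add: funpow_Suc_right Suc.prems funpow_additive[of E, OF add] del: funpow.simps)
  also have "(E ^^ n) (T (Suc 0) 0) = (\<Sum>j\<le>n. of_nat (n choose j) * T (Suc (n - j)) j)"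
    using Suc.IH[of "\<lambda>i j. T (Suc i) j"] Suc.prems by simp
  also have "(E ^^ n) (T 0 (Suc 0)) = (\<Sum>j\<le>n. of_nat (n choose j) * T (n - j) (Suc j))"
    using Suc.IH[of "\<lambda>i j. T i (Suc j)"] Suc.prems by simp
  also have "(\<Sum>j\<le>n. of_nat (n choose j) * T (Suc (n - j)) j)
      = (\<Sum>j\<le>Suc n. of_nat (n choose j) * T (Suc n - j) j)"
    by (auto intro!: sum.cong simp: Suc_diff_le binomial_eq_0)
  also have "\<dots> = T (Suc n) 0 + (\<Sum>j\<le>n. of_nat (n choose Suc j) * T (n - j) (Suc j))"
    by (subst sum.atMost_Suc_shift) (simp add: binomial_eq_0)
  also have "\<dots> + (\<Sum>j\<le>n. of_nat (n choose j) * T (n - j) (Suc j))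
     = (\<Sum>j\<le>Suc n. of_nat (Suc n choose j) * T (Suc n - j) j)"
    by (subst sum.atMost_Suc_shift[of _ n]) (simp add: sum.distrib algebra_simps)
  finally show ?case .
qed

lemma char_dvd_choose:
  assumes "CHAR('a::field) = p" "0 < j" "j < p"
  shows "(of_nat (p choose j) :: 'a) = 0"
proof -
  have "Factorial_Ring.prime p" using prime_CHAR_semidom[where 'a='a] assms by simp
  then show ?thesis
    using assms dvd_choose_prime[of j p] by (simp add: of_nat_eq_0_iff_char_dvd)
qed

text \<open>Supplies the sign of the last term in the expansion of \<open>x y^p\<close>. For
  \<open>p = 2\<close> the exponent is even, but there -1 equals 1.\<close>

lemma char_minus_one_power:
  assumes "CHAR('a::field) = p" "p > 0"
  shows "(-1) ^ p = (-1 :: 'a)"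
proof (cases "p = 2")
  case True
  then have "(of_nat 2 :: 'a) = 0" using assms of_nat_CHAR by metis
  then have "(1::'a) + 1 = 0" by simp
  then have "(1::'a) = -1" by (simp only: eq_neg_iff_add_eq_0)
  then show ?thesis using True by simp
next
  case False
  have "Factorial_Ring.prime p" using prime_CHAR_semidom[where 'a='a] assms by simp
  then have "odd p" using False by (metis prime_odd_nat prime_ge_2_nat le_neq_implies_less)
  then show ?thesis by simp
qed


section \<open>The derivation \<open>\<delta>\<close>\<close>

lemma \<delta>_add: "\<delta> h (r + s) = \<delta> h r + \<delta> h s"
  by (simp add: \<delta>_def pderiv_add algebra_simps)

lemma \<delta>_mult: "\<delta> h (r * s) = \<delta> h r * s + r * \<delta> h s"
  by (simp add: \<delta>_def pderiv_mult algebra_simps)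

lemma \<delta>_const: "\<delta> h [:c:] = 0"
  by (simp add: \<delta>_def pderiv_pCons)

lemma \<delta>_xpoly: "\<delta> h xpoly = h"
  by (simp add: \<delta>_def pderiv_pCons)

lemma \<delta>_zero: "\<delta> h 0 = 0"
  by (simp add: \<delta>_def)

lemma \<delta>_funpow_zero: "(\<delta> h ^^ n) 0 = 0"
  by (induction n) (simp_all add: \<delta>_zero)

lemma \<delta>_funpow_const: "n > 0 \<Longrightarrow> (\<delta> h ^^ n) [:c:] = 0"
  by (cases n) (simp_all add: funpow_Suc_right \<delta>_const \<delta>_funpow_zero del: funpow.simps)

lemma \<delta>_power: "\<delta> h (c ^ Suc n) = of_nat (Suc n) * c ^ n * \<delta> h c"
  by (induction n) (simp_all add: \<delta>_mult algebra_simps)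

lemma \<delta>_funpow_dvd: "n > 0 \<Longrightarrow> h dvd (\<delta> h ^^ n) r"
  by (cases n) (simp_all add: \<delta>_def)

text \<open>The middle binomial coefficients in the Leibniz rule vanish in characteristic
  \<open>p\<close>, so the \<open>p\<close>-th iterate of a derivation is a derivation
  again.\<close>

lemma \<delta>_funpow_char_mult:
  fixes h :: "'a::field poly"
  assumes p: "CHAR('a) = p" "p > 0"
  shows "(\<delta> h ^^ p) (r * s) = (\<delta> h ^^ p) r * s + r * (\<delta> h ^^ p) s"
proof -
  let ?T = "\<lambda>i j. (\<delta> h ^^ i) r * (\<delta> h ^^ j) s"
  have "(\<delta> h ^^ p) (?T 0 0) = (\<Sum>j\<le>p. of_nat (p choose j) * ?T (p - j) j)"
    by (rule funpow_binomial) (simp_all add: \<delta>_add \<delta>_mult)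
  also have "\<dots> = (\<Sum>j\<in>{0,p}. of_nat (p choose j) * ?T (p - j) j)"
  proof (rule sum.mono_neutral_right)
    show "\<forall>j\<in>{..p} - {0, p}. of_nat (p choose j) * ?T (p - j) j = 0"
    proof
      fix j assume "j \<in> {..p} - {0, p}"
      then have "(of_nat (p choose j) :: 'a) = 0" using char_dvd_choose[OF p(1), of j] by auto
      then have "(of_nat (p choose j) :: 'a poly) = 0" by (simp add: of_nat_poly)
      then show "of_nat (p choose j) * ?T (p - j) j = 0" by simp
    qed
  qed auto
  also have "\<dots> = (\<delta> h ^^ p) r * s + r * (\<delta> h ^^ p) s" using p by simp
  finally show ?thesis by simp
qed

lemma \<delta>_funpow_char_xpoly: "p > 0 \<Longrightarrow> (\<delta> h ^^ p) xpoly = \<delta>quot h p * h"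
  unfolding \<delta>quot_def using \<delta>_funpow_dvd[of p h xpoly] by simp

text \<open>A derivation of \<open>F[x]\<close> that kills the constants is determined by its value
  at \<open>x\<close>, and the two sides agree there.\<close>

lemma \<delta>_funpow_char:
  fixes h :: "'a::field poly"
  assumes p: "CHAR('a) = p" "p > 0"
  shows "(\<delta> h ^^ p) r = \<delta>quot h p * \<delta> h r"
proof (induction r)
  case 0
  show ?case by (simp add: \<delta>_zero \<delta>_funpow_zero)
next
  case (pCons a r)
  have eq: "pCons a r = [:a:] + xpoly * r" by simp
  have "(\<delta> h ^^ p) (pCons a r) = (\<delta> h ^^ p) xpoly * r + xpoly * (\<delta> h ^^ p) r"
    unfolding eq funpow_additive[of "\<delta> h", OF \<delta>_add] \<delta>_funpow_char_mult[OF p]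
    using p by (simp only: \<delta>_funpow_const) simp
  also have "\<dots> = \<delta>quot h p * \<delta> h (pCons a r)"
    unfolding eq \<delta>_add \<delta>_mult \<delta>_const \<delta>_xpoly \<delta>_funpow_char_xpoly[OF p(2)] pCons.IH
    by (simp add: algebra_simps)
  finally show ?case .
qed

text \<open>With \<open>q\<close> for the quotient, the \<open>(p+1)\<close>-st iterate at
  \<open>x\<close> is both \<open>\<delta>^p(h) = q \<delta>(h)\<close> and
  \<open>\<delta>(q h)\<close>. The difference of the two values is
  \<open>\<delta>(q) h = q' h^2\<close>, which is therefore zero.\<close>

lemma pderiv_\<delta>quot:
  fixes h :: "'a::field poly"
  assumes p: "CHAR('a) = p" "p > 0" and "h \<noteq> 0"
  shows "pderiv (\<delta>quot h p) = 0"
proof -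
  let ?q = "\<delta>quot h p"
  have "?q * \<delta> h h = (\<delta> h ^^ p) (\<delta> h xpoly)"
    by (simp add: \<delta>_funpow_char[OF p] \<delta>_xpoly)
  also have "\<dots> = \<delta> h ((\<delta> h ^^ p) xpoly)"
    by (simp add: funpow_swap1)
  also have "\<dots> = \<delta> h ?q * h + ?q * \<delta> h h"
    by (simp add: \<delta>_funpow_char[OF p] \<delta>_xpoly \<delta>_mult)
  finally show ?thesis using \<open>h \<noteq> 0\<close> by (simp add: \<delta>_def)
qed


section \<open>The free algebra\<close>

lemma free_const_add: "free_const (a + b) = free_const a + free_const b"
  by (simp add: free_const_def single_add)

lemma free_const_mult: "free_const (a * b) = free_const a * free_const b"
  by (simp add: free_const_def mult_single)

lemma free_const_0 [simp]: "free_const 0 = 0"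
  by (simp add: free_const_def)

lemma free_const_1 [simp]: "free_const 1 = 1"
  by (simp add: free_const_def)

lemma free_const_minus: "free_const (- a) = - free_const a"
  by (simp add: free_const_def single_uminus)

lemma free_const_diff: "free_const (a - b) = free_const a - free_const b"
  by (simp add: free_const_def single_diff)

lemma free_const_power: "free_const (a ^ n) = free_const a ^ n"
  by (induction n) (simp_all add: free_const_mult)

lemma free_const_of_nat: "free_const (of_nat n) = of_nat n"
  by (induction n) (simp_all add: free_const_add)

lemma poly_mapping_single_induct [case_names single add]:
  fixes f :: "'b \<Rightarrow>\<^sub>0 'c::comm_monoid_add"
  assumes single: "\<And>w c. P (Poly_Mapping.single w c)" and add: "\<And>f g. P f \<Longrightarrow> P g \<Longrightarrow> P (f + g)"
  shows "P f"
proof (induction f rule: update_induct)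
  case const
  show ?case using single[of _ 0] by simp
next
  case (update f a b)
  have "Poly_Mapping.update a b f = f + Poly_Mapping.single a b"
    using update.hyps
    by (intro poly_mapping_eqI)
      (auto simp: lookup_update lookup_add lookup_single in_keys_iff when_def)
  then show ?case using add update single by simp
qed

text \<open>The closure steps multiply on the left only, which is what congruences modulo a left
  ideal allow.\<close>

lemma free_alg_induct [case_names one add const x y]:
  fixes f :: "'a::field free_alg"
  assumes one: "P 1" and add: "\<And>f g. P f \<Longrightarrow> P g \<Longrightarrow> P (f + g)"
    and const: "\<And>c f. P f \<Longrightarrow> P (free_const c * f)"
    and x: "\<And>f. P f \<Longrightarrow> P (fx * f)" and y: "\<And>f. P f \<Longrightarrow> P (fy * f)"
  shows "P f"
proof -
  have monom: "P (Poly_Mapping.single (Word ls) 1)" for ls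
  proof (induction ls)
    case Nil
    show ?case using one by (simp add: zero_word_def[symmetric])
  next
    case (Cons l ls)
    have "(if l = Gx then fx else fy) * Poly_Mapping.single (Word ls) (1::'a)
        = Poly_Mapping.single (Word (l # ls)) 1"
      by (cases l) (simp_all add: fx_def fy_def mult_single plus_word_def)
    then show ?case using x[OF Cons] y[OF Cons] by (metis (full_types))
  qed
  have single: "P (Poly_Mapping.single w c)" for w c
  proof -
    have "Poly_Mapping.single w c = free_const c * Poly_Mapping.single (Word (letters w)) 1"
      by (simp add: free_const_def mult_single)
    then show ?thesis using const[OF monom[of "letters w"], of c] by simp
  qed
  show ?thesis by (induction f rule: poly_mapping_single_induct) (simp_all add: single add)
qed

lemma free_const_commute: "free_const c * f = f * free_const c"
proof (induction f rule: free_alg_induct)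
  case (const d f)
  have "free_const c * (free_const d * f) = free_const d * (free_const c * f)"
    unfolding mult.assoc[symmetric] free_const_mult[symmetric] by (simp only: mult.commute)
  then show ?case by (simp only: const mult.assoc)
next
  case (x f)
  have "free_const c * fx = fx * free_const c" by (simp add: free_const_def fx_def mult_single)
  then show ?case by (metis x mult.assoc)
next
  case (y f)
  have "free_const c * fy = fy * free_const c" by (simp add: free_const_def fy_def mult_single)
  then show ?case by (metis y mult.assoc)
qed (simp_all add: algebra_simps)

text \<open>The argument is arbitrary because polynomials are evaluated at \<open>x\<close>, at
  \<open>y\<close>, at \<open>y - \<theta>\<close>, at \<open>z\<close> and at 0.\<close>

definition ev :: "'a::field free_alg \<Rightarrow> 'a poly \<Rightarrow> 'a free_alg" where
  "ev e r = (\<Sum>i\<le>degree r. free_const (coeff r i) * e ^ i)"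

lemma free_poly_eq_ev: "free_poly r = ev fx r"
  by (simp add: free_poly_def ev_def)

lemma ev_altdef: "degree r \<le> n \<Longrightarrow> ev e r = (\<Sum>i\<le>n. free_const (coeff r i) * e ^ i)"
  unfolding ev_def by (rule sum.mono_neutral_left) (auto simp: coeff_eq_0)

lemma ev_0 [simp]: "ev e 0 = 0"
  by (simp add: ev_def)

lemma ev_add: "ev e (r + s) = ev e r + ev e s"
  using ev_altdef[of r "max (degree r) (degree s)" e] ev_altdef[of s "max (degree r) (degree s)" e]
    ev_altdef[OF degree_add_le_max[of r s], of e]
  by (simp add: sum.distrib[symmetric] free_const_add algebra_simps)

lemma ev_smult: "ev e (smult c r) = free_const c * ev e r"
  using ev_altdef[OF degree_smult_le[of c r], of e]
  by (simp add: ev_def sum_distrib_left free_const_mult mult.assoc)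

lemma ev_pCons: "ev e (pCons a r) = free_const a + e * ev e r"
proof -
  have "ev e (pCons a r) = (\<Sum>i\<le>Suc (degree r). free_const (coeff (pCons a r) i) * e ^ i)"
    by (rule ev_altdef) (simp add: degree_pCons_le)
  also have "\<dots> = free_const a + (\<Sum>i\<le>degree r. free_const (coeff r i) * e ^ Suc i)"
    by (subst sum.atMost_Suc_shift) (simp add: binomial_eq_0)
  also have "(\<Sum>i\<le>degree r. free_const (coeff r i) * e ^ Suc i) = e * ev e r"
    unfolding ev_def sum_distrib_left
    by (rule sum.cong) (simp_all add: mult.assoc[symmetric] free_const_commute[of _ e])
  finally show ?thesis .
qed

lemma ev_const [simp]: "ev e [:c:] = free_const c"
  by (simp add: ev_pCons)

lemma ev_1 [simp]: "ev e 1 = 1"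
  by (simp add: one_pCons)

lemma ev_xpoly [simp]: "ev e xpoly = e"
  by (simp add: ev_pCons)

lemma ev_linear: "ev e [:- c, 1:] = e - free_const c"
  by (simp add: ev_pCons free_const_minus)

lemma ev_mult: "ev e (r * s) = ev e r * ev e s"
  by (induction r) (simp_all add: ev_add ev_smult ev_pCons algebra_simps)

lemma ev_minus: "ev e (- r) = - ev e r"
  using ev_smult[of e "-1" r] by (simp add: free_const_minus)

lemma ev_diff: "ev e (r - s) = ev e r - ev e s"
  using ev_add[of e r "- s"] by (simp add: ev_minus)

lemma ev_commute: "ev e r * ev e s = ev e s * ev e r"
  by (metis ev_mult mult.commute)


section \<open>Left ideals containing the defining relation\<close>

lemma carrier_free_ring: "carrier (ring_of_type_algebra :: 'b::ring_1 ring) = UNIV"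
  by (simp add: ring_of_type_algebra_def)

lemma ring_of_ring_1: "ring (ring_of_type_algebra :: 'b::ring_1 ring)"
proof -
  have "\<exists>y. x + y = 0" for x :: 'b
    using add.right_inverse by blast
  then show ?thesis
    unfolding ring_of_type_algebra_def using add.right_inverse
    by unfold_locales (auto simp: algebra_simps Units_def)
qed

lemma ideal_A_ideal: "ideal (A_ideal h) free_ring"
  unfolding A_ideal_def
  by (rule ring.genideal_ideal[OF ring_of_ring_1]) (simp add: carrier_free_ring)

lemma A_ideal_add: "f \<in> A_ideal h \<Longrightarrow> g \<in> A_ideal h \<Longrightarrow> f + g \<in> A_ideal h"
  using additive_subgroup.a_closed[OF ideal.axioms(1)[OF ideal_A_ideal], of f h g]
  by (simp add: ring_of_type_algebra_def)

lemma A_ideal_mult_left: "f \<in> A_ideal h \<Longrightarrow> g * f \<in> A_ideal h"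
  using ideal.I_l_closed[OF ideal_A_ideal, of f h g] by (simp add: ring_of_type_algebra_def)

lemma A_ideal_mult_right: "f \<in> A_ideal h \<Longrightarrow> f * g \<in> A_ideal h"
  using ideal.I_r_closed[OF ideal_A_ideal, of f h g] by (simp add: ring_of_type_algebra_def)

lemma A_ideal_relation: "fy * fx - (fx * fy + free_poly h) \<in> A_ideal h"
  unfolding A_ideal_def
  by (rule ring.genideal_self'[OF ring_of_ring_1]) (simp add: carrier_free_ring)

text \<open>Such \<open>J\<close> correspond to the left ideals of the quotient algebra. The free
  algebra is a ring by its type class, so calculations there avoid cosets and carrier
  conditions.\<close>

locale ore_left_ideal =
  fixes h :: "'a::field poly" and J :: "'a free_alg set"
  assumes A_ideal_subset: "A_ideal h \<subseteq> J"
    and J_add: "f \<in> J \<Longrightarrow> g \<in> J \<Longrightarrow> f + g \<in> J"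
    and J_mult: "f \<in> J \<Longrightarrow> g * f \<in> J"
begin

definition eqv :: "'a free_alg \<Rightarrow> 'a free_alg \<Rightarrow> bool"  (infix \<open>\<doteq>\<close> 50)
  where "f \<doteq> g \<longleftrightarrow> f - g \<in> J"

lemma J_0: "0 \<in> J"
  using A_ideal_subset A_ideal_mult_left[OF A_ideal_relation, of 0 h] by auto

lemma J_minus: "f \<in> J \<Longrightarrow> - f \<in> J"
  using J_mult[of f "-1"] by simp

lemma J_diff: "f \<in> J \<Longrightarrow> g \<in> J \<Longrightarrow> f - g \<in> J"
  using J_add[of f "- g"] J_minus[of g] by simp

lemma eqv_0_iff: "f \<doteq> 0 \<longleftrightarrow> f \<in> J"
  by (simp add: eqv_def)

lemma eqv_refl [simp, intro]: "f \<doteq> f"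
  by (simp add: eqv_def J_0)

lemma eqv_sym: "f \<doteq> g \<Longrightarrow> g \<doteq> f"
  using J_minus unfolding eqv_def by fastforce

lemma eqv_trans [trans]: "f \<doteq> g \<Longrightarrow> g \<doteq> k \<Longrightarrow> f \<doteq> k"
  using J_add[of "f - g" "g - k"] by (simp add: eqv_def)

lemma eqv_add: "f \<doteq> g \<Longrightarrow> f' \<doteq> g' \<Longrightarrow> f + f' \<doteq> g + g'"
  using J_add[of "f - g" "f' - g'"] by (simp add: eqv_def algebra_simps)

lemma eqv_diff: "f \<doteq> g \<Longrightarrow> f' \<doteq> g' \<Longrightarrow> f - f' \<doteq> g - g'"
  using J_diff[of "f - g" "f' - g'"] by (simp add: eqv_def algebra_simps)

lemma eqv_mult: "f \<doteq> g \<Longrightarrow> k * f \<doteq> k * g"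
  using J_mult[of "f - g" k] by (simp add: eqv_def algebra_simps)

lemma eqv_sum: "(\<And>i. i \<in> A \<Longrightarrow> F i \<doteq> G i) \<Longrightarrow> sum F A \<doteq> sum G A"
  by (induction A rule: infinite_finite_induct) (auto intro: eqv_add)

lemma eqv_mem: "f \<doteq> g \<Longrightarrow> f \<in> J \<longleftrightarrow> g \<in> J"
  by (metis eqv_0_iff eqv_sym eqv_trans)

text \<open>A congruence modulo \<open>J\<close> may be multiplied on the left only. Those that come
  from the two-sided ideal survive multiplication on the right as well; this is how commutation
  rules enter a calculation.\<close>

lemma eqv_A_ideal: "f - g \<in> A_ideal h \<Longrightarrow> f * k \<doteq> g * k"
  using A_ideal_subset A_ideal_mult_right[of "f - g" h k] unfolding eqv_def
  by (auto simp: algebra_simps)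

lemma eqv_A_ideal': "f - g \<in> A_ideal h \<Longrightarrow> f \<doteq> g"
  using eqv_A_ideal[of f g 1] by simp

text \<open>If \<open>J\<close> annihilates a vector \<open>v\<close>, this is the annihilator of
  \<open>f v\<close>: the generator can be changed without leaving the locale.\<close>

lemma quotient_left_ideal: "ore_left_ideal h {g. g * f \<in> J}"
proof
  show "A_ideal h \<subseteq> {g. g * f \<in> J}"
    using A_ideal_subset A_ideal_mult_right by blast
qed (auto simp: distrib_right mult.assoc intro: J_add J_mult)

end

lemma ore_left_ideal_A_ideal: "ore_left_ideal h (A_ideal h)"
  by standard (auto intro: A_ideal_add A_ideal_mult_left)

section \<open>Commutation rules\<close>

text \<open>The commutator with \<open>y\<close> is a derivation that sends \<open>x\<close> to
  \<open>h\<close>, hence acts on polynomials in \<open>x\<close> as \<open>\<delta>\<close>. The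
  Horner step of the induction is its Leibniz rule.\<close>

lemma y_free_poly: "fy * free_poly r - (free_poly r * fy + free_poly (\<delta> h r)) \<in> A_ideal h"
proof -
  interpret ore_left_ideal h "A_ideal h" by (rule ore_left_ideal_A_ideal)
  show ?thesis
  proof (induction r)
    case 0
    show ?case by (simp add: free_poly_eq_ev \<delta>_zero J_0)
  next
    case (pCons a r)
    let ?P = free_poly
    have eq: "pCons a r = [:a:] + xpoly * r" by simp
    have 1: "?P (pCons a r) = free_const a + fx * ?P r"
      by (simp add: free_poly_eq_ev ev_pCons)
    have 2: "?P (\<delta> h (pCons a r)) = ?P h * ?P r + fx * ?P (\<delta> h r)"
      unfolding eq \<delta>_add \<delta>_const \<delta>_mult \<delta>_xpoly
      by (simp add: free_poly_eq_ev ev_add ev_mult ev_pCons)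
    have "fy * ?P (pCons a r) - (?P (pCons a r) * fy + ?P (\<delta> h (pCons a r)))
        = (fy * fx - (fx * fy + ?P h)) * ?P r
          + fx * (fy * ?P r - (?P r * fy + ?P (\<delta> h r)))"
      unfolding 1 2 by (simp add: algebra_simps free_const_commute[of a fy])
    moreover have "(fy * fx - (fx * fy + ?P h)) * ?P r \<in> A_ideal h"
      by (intro A_ideal_mult_right A_ideal_relation)
    moreover have "fx * (fy * ?P r - (?P r * fy + ?P (\<delta> h r))) \<in> A_ideal h"
      by (intro A_ideal_mult_left pCons.IH)
    ultimately show ?case by (simp add: A_ideal_add)
  qed
qed

text \<open>Right multiplication by \<open>y\<close> is left multiplication minus the commutator
  \<open>ad\<close>, and these operators commute. The resulting binomial expansion is exact in the
  free algebra; only afterwards is each iterated commutator replaced by the iterate of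
  \<open>\<delta>\<close>, modulo the relation.\<close>

lemma free_poly_y_power:
  "free_poly r * fy ^ n -
     (\<Sum>j\<le>n. fy ^ (n - j) * free_poly (smult ((- 1) ^ j * of_nat (n choose j)) ((\<delta> h ^^ j) r)))
   \<in> A_ideal h" (is "_ - ?R \<in> _")
proof -
  interpret ore_left_ideal h "A_ideal h" by (rule ore_left_ideal_A_ideal)
  define ad where "ad a = fy * a - a * fy" for a :: "'a free_alg"
  have ad: "eqv ((ad ^^ j) (free_poly r)) (free_poly ((\<delta> h ^^ j) r))" for j
  proof (induction j)
    case (Suc j)
    define a b where "a = (ad ^^ j) (free_poly r)" and "b = free_poly ((\<delta> h ^^ j) r)"
    have "a - b \<in> A_ideal h" using Suc by (simp add: a_def b_def eqv_def)
    moreover have "ad a - ad b = fy * (a - b) - (a - b) * fy"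
      by (simp add: ad_def algebra_simps)
    ultimately have "eqv (ad a) (ad b)"
      by (simp add: eqv_def A_ideal_mult_left A_ideal_mult_right J_diff)
    also have "eqv (ad b) (free_poly (\<delta> h ((\<delta> h ^^ j) r)))"
      using y_free_poly[of "(\<delta> h ^^ j) r" h] by (simp add: ad_def b_def eqv_def algebra_simps)
    finally show ?case by (simp add: a_def)
  qed simp
  \<comment> \<open>Left multiplication applied \<open>i\<close> times and \<open>- ad\<close>
    applied \<open>j\<close> times; right multiplication by \<open>y\<close> raises one index or the
    other.\<close>
  define T where "T i j = fy ^ i * ((- 1) ^ j * (ad ^^ j) (free_poly r))" for i j
  have comm: "(- 1) ^ j * f = f * (- 1) ^ j" for j and f :: "'a free_alg"
    by (cases "even j") simp_all
  have "((\<lambda>f. f * fy) ^^ n) g = g * fy ^ n" for g :: "'a free_alg"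
    by (induction n) (simp_all add: mult.assoc power_commutes)
  then have "free_poly r * fy ^ n = ((\<lambda>f. f * fy) ^^ n) (T 0 0)"
    by (simp add: T_def)
  also have "\<dots> = (\<Sum>j\<le>n. of_nat (n choose j) * T (n - j) j)"
  proof (rule funpow_binomial)
    fix i j
    let ?a = "(ad ^^ j) (free_poly r)"
    have "fy * ((- 1) ^ j * ?a) = (- 1) ^ j * (fy * ?a)"
      unfolding mult.assoc[symmetric] by (simp only: comm[symmetric])
    then have "T (Suc i) j = fy ^ i * ((- 1) ^ j * (fy * ?a))"
      by (simp add: T_def power_Suc2 mult.assoc del: power_Suc)
    moreover have "T i (Suc j) = fy ^ i * ((- 1) ^ j * (?a * fy)) - fy ^ i * ((- 1) ^ j * (fy * ?a))"
      by (simp add: T_def ad_def algebra_simps)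
    ultimately show "T i j * fy = T (Suc i) j + T i (Suc j)"
      by (simp add: T_def mult.assoc)
  qed (simp add: algebra_simps)
  also have "eqv \<dots> ?R"
  proof (rule eqv_sum)
    fix j
    have "of_nat (n choose j) * T (n - j) j
        = fy ^ (n - j) * (free_const ((- 1) ^ j * of_nat (n choose j)) * (ad ^^ j) (free_poly r))"
      by (simp add: T_def free_const_mult free_const_power free_const_minus free_const_of_nat
          mult_of_nat_commute mult.assoc)
    then show "eqv (of_nat (n choose j) * T (n - j) j)
        (fy ^ (n - j) * free_poly (smult ((- 1) ^ j * of_nat (n choose j)) ((\<delta> h ^^ j) r)))"
      by (simp only: free_poly_eq_ev ev_smult eqv_mult ad[unfolded free_poly_eq_ev])
  qed
  finally show ?thesis by (simp add: eqv_def)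
qed

definition z_free :: "'a::field poly \<Rightarrow> nat \<Rightarrow> 'a \<Rightarrow> 'a free_alg" where
  "z_free h p \<beta> = fy ^ p - fy * free_poly (\<delta>quot h p) - free_const \<beta>"

text \<open>The elements that commute with \<open>c\<close> modulo a two-sided ideal form a
  subalgebra, so the generators decide.\<close>

lemma A_ideal_central:
  assumes x: "c * fx - fx * c \<in> A_ideal h" and y: "c * fy - fy * c \<in> A_ideal h"
  shows "c * f - f * c \<in> A_ideal h"
proof -
  interpret ore_left_ideal h "A_ideal h" by (rule ore_left_ideal_A_ideal)
  have step: "c * (g * f) - g * f * c \<in> A_ideal h"
    if "c * g - g * c \<in> A_ideal h" "c * f - f * c \<in> A_ideal h" for f g
  proof -
    have "c * (g * f) - g * f * c = (c * g - g * c) * f + g * (c * f - f * c)"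
      by (simp add: algebra_simps)
    then show ?thesis using that by (simp add: A_ideal_mult_left A_ideal_mult_right J_add)
  qed
  show ?thesis
  proof (induction f rule: free_alg_induct)
    case (add f g)
    have "c * (f + g) - (f + g) * c = (c * f - f * c) + (c * g - g * c)"
      by (simp add: algebra_simps)
    then show ?case using add by (simp add: J_add)
  next
    case (const d f)
    then show ?case by (intro step) (simp_all add: free_const_commute J_0)
  qed (auto intro: step x y J_0)
qed

lemma free_poly_central:
  assumes "\<delta> h r = 0"
  shows "free_poly r * f - f * free_poly r \<in> A_ideal h"
proof (rule A_ideal_central)
  interpret ore_left_ideal h "A_ideal h" by (rule ore_left_ideal_A_ideal)
  show "free_poly r * fx - fx * free_poly r \<in> A_ideal h"
    using ev_commute[of fx r xpoly] by (simp add: free_poly_eq_ev J_0)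
  show "free_poly r * fy - fy * free_poly r \<in> A_ideal h"
    using J_minus[OF y_free_poly[of r h]] assms by (simp add: free_poly_eq_ev)
qed

text \<open>Only the extreme terms of the expansion of \<open>x y^p\<close> survive, so
  \<open>y^p\<close> fails to commute with \<open>x\<close> by \<open>q h\<close>, and the
  commutator of \<open>y q\<close> with \<open>x\<close> cancels this. Commuting with
  \<open>y\<close> amounts to \<open>\<delta>(q) = 0\<close>.\<close>

lemma z_free_central:
  fixes h :: "'a::field poly"
  assumes p: "CHAR('a) = p" "p > 0" and "h \<noteq> 0"
  shows "z_free h p \<beta> * f - f * z_free h p \<beta> \<in> A_ideal h"
proof (rule A_ideal_central)
  interpret ore_left_ideal h "A_ideal h" by (rule ore_left_ideal_A_ideal)
  let ?q = "\<delta>quot h p" and ?P = "free_poly :: 'a poly \<Rightarrow> _"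
  let ?S = "\<lambda>j. fy ^ (p - j) * ?P (smult ((- 1) ^ j * of_nat (p choose j)) ((\<delta> h ^^ j) xpoly))"
  have "(\<Sum>j\<le>p. ?S j) = (\<Sum>j\<in>{0,p}. ?S j)"
  proof (rule sum.mono_neutral_right)
    show "\<forall>j\<in>{..p} - {0, p}. ?S j = 0"
      using char_dvd_choose[OF p(1)] by (auto simp: free_poly_eq_ev)
  qed auto
  also have "\<dots> = fy ^ p * fx - ?P ?q * ?P h"
    using p by (simp add: free_poly_eq_ev char_minus_one_power \<delta>_funpow_char_xpoly ev_minus ev_mult)
  finally have 1: "fx * fy ^ p - (fy ^ p * fx - ?P ?q * ?P h) \<in> A_ideal h"
    using free_poly_y_power[of xpoly p h] by (simp add: free_poly_eq_ev)
  have "z_free h p \<beta> * fx - fx * z_free h p \<beta>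
      = - (fx * fy ^ p - (fy ^ p * fx - ?P ?q * ?P h)) - (fy * fx - (fx * fy + ?P h)) * ?P ?q"
    using ev_commute[of fx ?q xpoly] ev_commute[of fx ?q h]
    by (simp add: z_free_def algebra_simps free_poly_eq_ev free_const_commute[of \<beta>])
  then show "z_free h p \<beta> * fx - fx * z_free h p \<beta> \<in> A_ideal h"
    using 1 by (simp add: A_ideal_mult_right A_ideal_relation J_diff J_minus del: minus_diff_eq)
  have "z_free h p \<beta> * fy - fy * z_free h p \<beta> = - (fy * (?P ?q * fy - fy * ?P ?q))"
    by (simp add: z_free_def algebra_simps power_commutes free_const_commute[of \<beta>])
  moreover have "?P ?q * fy - fy * ?P ?q \<in> A_ideal h"
    by (rule free_poly_central) (simp add: \<delta>_def pderiv_\<delta>quot[OF assms])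
  ultimately show "z_free h p \<beta> * fy - fy * z_free h p \<beta> \<in> A_ideal h"
    by (simp add: A_ideal_mult_left J_minus del: minus_diff_eq)
qed

section \<open>Spans of powers of \<open>y\<close> over a subalgebra \<open>F[e]\<close>\<close>

context ore_left_ideal
begin

lemma eqv_y_free_poly: "fy * (free_poly r * f) \<doteq> free_poly r * (fy * f) + free_poly (\<delta> h r) * f"
  using eqv_A_ideal[OF y_free_poly[of r h], of f] by (simp add: algebra_simps)

text \<open>Three choices of \<open>e\<close> occur: \<open>x\<close>, which does not commute with
  \<open>y\<close>; the central \<open>z\<close>; and 0, for which the coefficients are just
  scalars.\<close>

definition y_span :: "'a free_alg \<Rightarrow> nat \<Rightarrow> 'a free_alg set" where
  "y_span e d = {f. \<exists>r. f \<doteq> (\<Sum>i<d. ev e (r i) * fy ^ i)}"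

lemma y_spanI: "f \<doteq> (\<Sum>i<d. ev e (r i) * fy ^ i) \<Longrightarrow> f \<in> y_span e d"
  by (auto simp: y_span_def)

lemma y_span_add: "f \<in> y_span e d \<Longrightarrow> g \<in> y_span e d \<Longrightarrow> f + g \<in> y_span e d"
proof -
  assume "f \<in> y_span e d" "g \<in> y_span e d"
  then obtain r s where "f \<doteq> (\<Sum>i<d. ev e (r i) * fy ^ i)" "g \<doteq> (\<Sum>i<d. ev e (s i) * fy ^ i)"
    by (auto simp: y_span_def)
  then have "f + g \<doteq> (\<Sum>i<d. ev e (r i + s i) * fy ^ i)"
    using eqv_add by (simp add: ev_add distrib_right sum.distrib)
  then show ?thesis by (rule y_spanI)
qed

lemma y_span_ev: "f \<in> y_span e d \<Longrightarrow> ev e t * f \<in> y_span e d"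
proof -
  assume "f \<in> y_span e d"
  then obtain r where "f \<doteq> (\<Sum>i<d. ev e (r i) * fy ^ i)"
    by (auto simp: y_span_def)
  then have "ev e t * f \<doteq> (\<Sum>i<d. ev e (t * r i) * fy ^ i)"
    using eqv_mult by (simp add: ev_mult mult.assoc sum_distrib_left[symmetric])
  then show ?thesis by (rule y_spanI)
qed

lemma y_span_eqv [trans]: "f \<doteq> g \<Longrightarrow> g \<in> y_span e d \<Longrightarrow> f \<in> y_span e d"
  by (auto simp: y_span_def intro: eqv_trans)

lemma y_span_power: "i < d \<Longrightarrow> fy ^ i \<in> y_span e d"
  by (rule y_spanI[where r = "\<lambda>j. if j = i then 1 else 0"])
    (simp add: if_distrib[where f = "ev e"] if_distrib[where f = "\<lambda>a. a * _"] cong: if_cong)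

lemma y_span_0: "0 \<in> y_span e d"
  by (rule y_spanI[where r = "\<lambda>j. 0"]) (simp)

lemma y_span_sum: "(\<And>i. i \<in> A \<Longrightarrow> F i \<in> y_span e d) \<Longrightarrow> sum F A \<in> y_span e d"
  by (induction A rule: infinite_finite_induct) (auto intro: y_span_add y_span_0)

lemma y_span_mono: "f \<in> y_span e d \<Longrightarrow> d \<le> d' \<Longrightarrow> f \<in> y_span e d'"
proof -
  assume "f \<in> y_span e d" and le: "d \<le> d'"
  then obtain r where "f \<doteq> (\<Sum>i<d. ev e (r i) * fy ^ i)"
    by (auto simp: y_span_def)
  then show ?thesis
    by (rule y_span_eqv) (use le in \<open>auto intro!: y_span_sum y_span_ev y_span_power\<close>)
qed

lemma y_span_y:
  assumes "f \<in> y_span fx d"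
  shows "fy * f \<in> y_span fx (Suc d)"
proof -
  from assms obtain r where r: "f \<doteq> (\<Sum>i<d. free_poly (r i) * fy ^ i)"
    by (auto simp: y_span_def free_poly_eq_ev)
  have "fy * f \<doteq> (\<Sum>i<d. fy * (free_poly (r i) * fy ^ i))"
    using eqv_mult[OF r, of fy] by (simp add: sum_distrib_left)
  then show ?thesis
  proof (rule y_span_eqv, intro y_span_sum)
    fix i assume "i \<in> {..<d}"
    have "fy * (free_poly (r i) * fy ^ i) \<doteq> free_poly (r i) * fy ^ Suc i + free_poly (\<delta> h (r i)) * fy ^ i"
      using eqv_y_free_poly by simp
    then show "fy * (free_poly (r i) * fy ^ i) \<in> y_span fx (Suc d)"
      by (rule y_span_eqv)
        (use \<open>i \<in> _\<close> in \<open>auto intro!: y_span_add y_span_ev[where e = fx, folded free_poly_eq_ev] y_span_power simp del: power_Suc\<close>)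
  qed
qed

text \<open>The existence half of the normal form. \<open>x_eigenvector\<close> applies it with the
  two-sided ideal in the role of \<open>J\<close>, so that the result can be multiplied by
  \<open>y\<close> on the right.\<close>

lemma y_span_all: "\<exists>d. f \<in> y_span fx d"
proof (induction f rule: free_alg_induct)
  case one
  show ?case using y_span_power[of 0 1 fx] by auto
next
  case (add f g)
  then obtain a b where "f \<in> y_span fx a" "g \<in> y_span fx b" by blast
  then have "f + g \<in> y_span fx (max a b)" by (auto intro!: y_span_add elim: y_span_mono)
  then show ?case by blast
next
  case (const c f)
  then obtain d where "f \<in> y_span fx d" by blast
  then show ?case using y_span_ev[of f fx d "[:c:]"] by (auto simp: free_poly_eq_ev)
next
  case (x f)
  then obtain d where "f \<in> y_span fx d" by blast
  then show ?case using y_span_ev[of f fx d xpoly] by (auto simp: free_poly_eq_ev)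
next
  case (y f)
  then show ?case using y_span_y by blast
qed

end

section \<open>Maximal left ideals\<close>

text \<open>Maximality in the form in which it is used: from every nonzero vector \<open>f v\<close>
  some \<open>g\<close> leads back to the generator \<open>v\<close>.\<close>

locale ore_maximal_left_ideal = ore_left_ideal h J for h :: "'a::alg_closed_field poly" and J +
  assumes one_notin: "1 \<notin> J"
    and left_inverse: "f \<notin> J \<Longrightarrow> \<exists>g. g * f - 1 \<in> J"
begin

lemma quotient_maximal:
  assumes "f \<notin> J"
  shows "ore_maximal_left_ideal h {g. g * f \<in> J}"
proof -
  interpret Q: ore_left_ideal h "{g. g * f \<in> J}" by (rule quotient_left_ideal)
  show ?thesis
  proof
    show "1 \<notin> {g. g * f \<in> J}" using assms by simp
  next
    fix k assume "k \<notin> {g. g * f \<in> J}"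
    then obtain g where "g * (k * f) - 1 \<in> J" using left_inverse by blast
    then have "f * (g * (k * f) - 1) \<in> J" by (rule J_mult)
    then show "\<exists>g. g * k - 1 \<in> {g. g * f \<in> J}"
      by (intro exI[of _ "f * g"]) (simp add: algebra_simps)
  qed
qed

text \<open>The kernel of a central element is a submodule, hence everything as soon as it contains
  a nonzero vector. Here \<open>k\<close> carries \<open>f\<close> back to 1, and \<open>c\<close>
  moves across \<open>g * k\<close>.\<close>

lemma central_annihilates:
  assumes central: "\<And>g. c * g - g * c \<in> A_ideal h" and "c * f \<in> J" "f \<notin> J"
  shows "c * g \<in> J"
proof -
  obtain k where k: "k * f - 1 \<in> J" using left_inverse assms(3) by blast
  have "c * (g * k) * f - g * k * c * f \<in> J"
    using eqv_A_ideal[OF central[of "g * k"], of f] by (simp add: eqv_def mult.assoc)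
  moreover have "g * k * c * f \<in> J" using J_mult[OF assms(2), of "g * k"] by (simp add: mult.assoc)
  ultimately have "c * (g * k) * f \<in> J" using eqv_mem[unfolded eqv_def] by blast
  moreover have "(c * g) * (k * f - 1) \<in> J" using k by (rule J_mult)
  ultimately have "c * (g * k) * f - (c * g) * (k * f - 1) \<in> J" by (rule J_diff)
  then show ?thesis by (simp add: algebra_simps)
qed

text \<open>Split off a root, \<open>r = (X - \<mu>) s\<close>. Either \<open>s(e)\<close> lies
  outside \<open>J\<close> and is the eigenvector, or \<open>s\<close> replaces \<open>r\<close>.
  The descent cannot end in a nonzero constant, since 1 is not in \<open>J\<close>.\<close>

lemma ev_eigenvector:
  assumes "ev e r \<in> J" "r \<noteq> 0"
  shows "\<exists>\<mu> g. g \<notin> J \<and> (e - free_const \<mu>) * g \<in> J"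
  using assms
proof (induction "degree r" arbitrary: r rule: less_induct)
  case less
  show ?case
  proof (cases "degree r = 0")
    case True
    then obtain c where r: "r = [:c:]" using degree_0_id by metis
    then have "c \<noteq> 0" using less.prems by simp
    then have "1 = free_const (inverse c) * ev e r"
      by (simp add: r free_const_mult[symmetric])
    then show ?thesis using J_mult[OF less.prems(1), of "free_const (inverse c)"] one_notin by simp
  next
    case False
    then obtain \<mu> where "poly r \<mu> = 0" using alg_closed_imp_poly_has_root by blast
    then obtain s where s: "r = [:- \<mu>, 1:] * s" by (auto simp: poly_eq_0_iff_dvd dvd_def)
    then have "s \<noteq> 0" using less.prems by auto
    then have deg: "degree s < degree r" unfolding s by (subst degree_mult_eq) auto
    show ?thesis
    proof (cases "ev e s \<in> J")
      case True
      then show ?thesis using less.hyps deg \<open>s \<noteq> 0\<close> by blast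
    next
      case False
      have "(e - free_const \<mu>) * ev e s \<in> J"
        using less.prems(1) unfolding s by (simp only: ev_mult ev_linear mult.assoc)
      then show ?thesis using False by blast
    qed
  qed
qed

end

section \<open>An eigenvector of \<open>x\<close>\<close>

lemma (in ore_maximal_left_ideal) x_eigenvector:
  assumes p: "CHAR('a) = p" "p > 0"
  shows "\<exists>\<mu> f. f \<notin> J \<and> (fx - free_const \<mu>) * f \<in> J"
proof (rule ccontr)
  assume none: "\<not> ?thesis"
  let ?P = "free_poly :: 'a poly \<Rightarrow> 'a free_alg"
  interpret I: ore_left_ideal h "A_ideal h" by (rule ore_left_ideal_A_ideal)
  note span_P = y_span_ev[where e = fx, folded free_poly_eq_ev]
  \<comment> \<open>Without eigenvectors of \<open>x\<close> the module is torsion-free over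
    \<open>F[x]\<close>: a nonzero polynomial that kills a nonzero vector yields an eigenvector in
    the module generated by it.\<close>
  have faithful: "f \<in> J" if "?P r * f \<in> J" "r \<noteq> 0" for r f
  proof (rule ccontr)
    assume "f \<notin> J"
    then interpret Q: ore_maximal_left_ideal h "{g. g * f \<in> J}" by (rule quotient_maximal)
    have "\<exists>\<mu> g. g \<notin> {g. g * f \<in> J} \<and> (fx - free_const \<mu>) * g \<in> {g. g * f \<in> J}"
      by (rule Q.ev_eigenvector[of fx r]) (use that in \<open>simp_all add: free_poly_eq_ev\<close>)
    then show False using none by (auto simp: mult.assoc)
  qed
  define rel where "rel d \<longleftrightarrow> (\<exists>r. (\<exists>i<d. r i \<noteq> 0) \<and> (\<Sum>i<d. ?P (r i) * fy ^ i) \<in> J)" for d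
  have "\<exists>d. rel d"
  proof (cases "fy \<in> J")
    case True
    then have "rel 2"
      unfolding rel_def
      by (intro exI[of _ "\<lambda>i. if i = 1 then 1 else 0"])
        (auto simp: numeral_2_eq_2 free_poly_eq_ev)
    then show ?thesis ..
  next
    case False
    then obtain g where g: "g * fy - 1 \<in> J" using left_inverse by blast
    obtain d s where s: "g - (\<Sum>i<d. ?P (s i) * fy ^ i) \<in> A_ideal h"
      using I.y_span_all[of g] by (auto simp: I.y_span_def I.eqv_def free_poly_eq_ev)
    \<comment> \<open>\<open>g * fy - 1\<close> read as a relation: the coefficients of
      \<open>g\<close> move up one place, and the entry -1 at index 0 makes it nontrivial.\<close>
    define r where "r i = (case i of 0 \<Rightarrow> -1 | Suc j \<Rightarrow> s j)" for i
    have "(\<Sum>i<Suc d. ?P (r i) * fy ^ i) = (\<Sum>i<d. ?P (s i) * fy ^ i) * fy - 1"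
      by (subst sum.lessThan_Suc_shift)
        (simp add: r_def free_poly_eq_ev ev_minus sum_distrib_right mult.assoc power_commutes)
    moreover have "\<dots> \<doteq> g * fy - 1"
      by (intro eqv_diff eqv_sym[OF eqv_A_ideal[OF s]] eqv_refl)
    ultimately have "(\<Sum>i<Suc d. ?P (r i) * fy ^ i) \<in> J" using g eqv_mem by simp
    then have "rel (Suc d)" unfolding rel_def by (intro exI[of _ r]) (auto simp: r_def)
    then show ?thesis ..
  qed
  define d where "d = (LEAST d. rel d)"
  have "rel d" using \<open>\<exists>d. rel d\<close> unfolding d_def by (rule LeastI_ex)
  have minimal: "\<not> rel e" if "e < d" for e using that not_less_Least unfolding d_def by blast
  obtain r where r: "\<exists>i<d. r i \<noteq> 0" "(\<Sum>i<d. ?P (r i) * fy ^ i) \<in> J"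
    using \<open>rel d\<close> by (auto simp: rel_def)
  obtain m where m: "d = Suc m" using r(1) by (cases d) auto
  define c where "c = r m"
  have "c \<noteq> 0"
  proof
    assume "c = 0"
    then have "\<exists>i<m. r i \<noteq> 0" using r(1) \<open>c = 0\<close> unfolding m c_def using less_Suc_eq by metis
    moreover have "(\<Sum>i<m. ?P (r i) * fy ^ i) \<in> J"
      using r(2) \<open>c = 0\<close> by (simp add: m c_def free_poly_eq_ev)
    ultimately have "rel m" by (auto simp: rel_def)
    then show False using minimal m by simp
  qed
  have "m \<noteq> 0"
  proof
    assume "m = 0"
    then have "?P c * 1 \<in> J" using r(2) by (simp add: m c_def)
    then show False using faithful \<open>c \<noteq> 0\<close> one_notin by blast
  qed
  \<comment> \<open>By minimality the powers of \<open>y\<close> below \<open>m\<close> are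
    independent over \<open>F[x]\<close>. It remains to see that they span up to powers of the
    leading coefficient \<open>c\<close>.\<close>
  have indep: "s i = 0" if "(\<Sum>i<m. ?P (s i) * fy ^ i) \<in> J" "i < m" for s i
    using minimal[of m] that m by (auto simp: rel_def)
  have "?P c * fy ^ m - (\<Sum>i<m. ?P (- r i) * fy ^ i) = (\<Sum>i<d. ?P (r i) * fy ^ i)"
    by (simp add: m c_def free_poly_eq_ev ev_minus sum_negf)
  then have top: "?P c * fy ^ m \<in> y_span fx m"
    using r(2) y_spanI[of "?P c * fy ^ m" fx "\<lambda>i. - r i" m] by (simp add: eqv_def free_poly_eq_ev)
  have reduce: "?P c * f \<in> y_span fx m" if f: "f \<in> y_span fx (Suc m)" for f
  proof -
    obtain s where s: "f \<doteq> (\<Sum>i<Suc m. ?P (s i) * fy ^ i)"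
      using f unfolding y_span_def free_poly_eq_ev by blast
    have "?P c * f \<doteq> ?P c * (\<Sum>i<Suc m. ?P (s i) * fy ^ i)"
      using s by (rule eqv_mult)
    also have "\<dots> = (\<Sum>i<Suc m. ?P (s i) * (?P c * fy ^ i))"
      unfolding sum_distrib_left mult.assoc[symmetric]
      by (simp only: free_poly_eq_ev ev_commute[of fx c])
    finally have A: "?P c * f \<doteq> (\<Sum>i<Suc m. ?P (s i) * (?P c * fy ^ i))" .
    have B: "?P (s i) * (?P c * fy ^ i) \<in> y_span fx m" if "i < Suc m" for i
    proof (cases "i = m")
      case True
      then show ?thesis using top span_P by simp
    next
      case False
      then show ?thesis using that by (intro span_P y_span_power) simp
    qed
    show ?thesis by (rule y_span_eqv[OF A], rule y_span_sum, rule B) simp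
  qed
  have denominators: "\<exists>N. ?P (c ^ N) * f \<in> y_span fx m" for f
  proof (induction f rule: free_alg_induct)
    case one
    show ?case using y_span_power[of 0 m fx] \<open>m \<noteq> 0\<close>
      by (intro exI[of _ 0]) (simp add: free_poly_eq_ev)
  next
    case (add f g)
    then obtain a b where "?P (c ^ a) * f \<in> y_span fx m" "?P (c ^ b) * g \<in> y_span fx m" by blast
    then have "?P (c ^ b) * (?P (c ^ a) * f) + ?P (c ^ a) * (?P (c ^ b) * g) \<in> y_span fx m"
      by (meson y_span_add span_P)
    moreover have "?P (c ^ b) * (?P (c ^ a) * f) + ?P (c ^ a) * (?P (c ^ b) * g) = ?P (c ^ (a + b)) * (f + g)"
      by (simp add: free_poly_eq_ev power_add ev_mult distrib_left mult.assoc[symmetric]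
          ev_commute[of fx "c ^ b" "c ^ a"])
    ultimately show ?case by auto
  next
    case (const a f)
    then obtain N where "?P (c ^ N) * f \<in> y_span fx m" by blast
    then have "?P [:a:] * (?P (c ^ N) * f) \<in> y_span fx m" by (rule span_P)
    then have "?P (c ^ N) * (free_const a * f) \<in> y_span fx m"
      by (simp add: free_poly_eq_ev mult.assoc[symmetric] free_const_commute[of a "ev fx (c ^ N)"])
    then show ?case ..
  next
    case (x f)
    then obtain N where "?P (c ^ N) * f \<in> y_span fx m" by blast
    then have "?P xpoly * (?P (c ^ N) * f) \<in> y_span fx m" by (rule span_P)
    then have "?P (c ^ N) * (fx * f) \<in> y_span fx m"
      using ev_commute[of fx "c ^ N" xpoly] by (simp add: free_poly_eq_ev mult.assoc[symmetric])
    then show ?case ..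
  next
    case (y f)
    then obtain N where N: "?P (c ^ N) * f \<in> y_span fx m" by blast
    let ?w = "?P (c ^ N) * f"
    have w: "?P (c ^ Suc N) * f = ?P c * ?w"
      by (simp add: free_poly_eq_ev ev_mult mult.assoc)
    \<comment> \<open>Why the exponent grows by one: the derivative of \<open>c^(N+1)\<close> still
      contains \<open>c^N\<close>, so that the commutator term is a multiple of \<open>?w\<close>,
      and the additional factor \<open>c\<close> rewrites the power \<open>y^m\<close> that appears
      in \<open>fy * ?w\<close>.\<close>
    have dw: "?P (\<delta> h (c ^ Suc N)) * f = ?P (of_nat (Suc N) * \<delta> h c) * ?w"
    proof -
      have "\<delta> h (c ^ Suc N) = (of_nat (Suc N) * \<delta> h c) * c ^ N"
        unfolding \<delta>_power by (simp only: mult.assoc mult.commute mult.left_commute)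
      then show ?thesis by (simp only: free_poly_eq_ev ev_mult mult.assoc)
    qed
    have "fy * (?P (c ^ Suc N) * f) \<doteq> ?P (c ^ Suc N) * (fy * f) + ?P (\<delta> h (c ^ Suc N)) * f"
      by (rule eqv_y_free_poly)
    then have "?P (c ^ Suc N) * (fy * f) \<doteq> fy * (?P c * ?w) - ?P (of_nat (Suc N) * \<delta> h c) * ?w"
      unfolding w dw using J_minus by (fastforce simp: eqv_def algebra_simps)
    also have "\<dots> \<doteq> ?P c * (fy * ?w) + ?P (\<delta> h c) * ?w - ?P (of_nat (Suc N) * \<delta> h c) * ?w"
      by (intro eqv_diff eqv_y_free_poly eqv_refl)
    also have "\<dots> = ?P c * (fy * ?w) + ?P (\<delta> h c) * ?w + ?P (- (of_nat (Suc N) * \<delta> h c)) * ?w"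
      by (simp only: free_poly_eq_ev ev_minus mult_minus_left diff_conv_add_uminus)
    finally have "?P (c ^ Suc N) * (fy * f) \<in> y_span fx m"
      using N by (meson y_span_eqv y_span_add span_P reduce y_span_y)
    then show ?case ..
  qed
  \<comment> \<open>A root of \<open>c X + 1\<close> is not a root of \<open>c\<close>.\<close>
  have "degree (c * xpoly + 1) > 0"
  proof -
    have "degree (c * xpoly) = Suc (degree c)"
      using \<open>c \<noteq> 0\<close> by (subst degree_mult_eq) auto
    then show ?thesis by (subst degree_add_eq_left) auto
  qed
  then obtain a where "poly (c * xpoly + 1) a = 0" using alg_closed_imp_poly_has_root by blast
  then have a: "poly c a \<noteq> 0" by auto
  let ?x = "fx - free_const a"
  have x_P: "?x = ?P [:- a, 1:]" by (simp add: free_poly_eq_ev ev_linear)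
  \<comment> \<open>Maximality provides left inverses, whereas surjectivity of \<open>x - a\<close>
    asks for a right one. The power \<open>(x - a)^p\<close> has derivative zero and is central, so
    its left inverse is also a right inverse, and all but one factor can be moved into
    \<open>u\<close>.\<close>
  have "?P ([:- a, 1:] ^ p) * 1 \<notin> J"
    using faithful[of "[:- a, 1:] ^ p" 1] one_notin by auto
  then obtain g where g: "g * ?P ([:- a, 1:] ^ p) - 1 \<in> J" using left_inverse by auto
  have "(of_nat p :: 'a) = 0" using p of_nat_CHAR by metis
  then have "\<delta> h ([:- a, 1:] ^ p) = 0" 
    by (cases p) (use p in \<open>simp_all add: \<delta>_def pderiv_power_Suc del: of_nat_Suc power_Suc\<close>)
  then have "?P ([:- a, 1:] ^ p) * g \<doteq> g * ?P ([:- a, 1:] ^ p)"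
    by (rule eqv_A_ideal'[OF free_poly_central])
  also have "\<dots> \<doteq> 1" using g by (simp add: eqv_def)
  finally have "?P ([:- a, 1:] ^ p) * g \<doteq> 1" .
  moreover have "[:- a, 1:] ^ p = [:- a, 1:] * [:- a, 1:] ^ (p - 1)"
    using p(2) by (metis power_eq_if neq0_conv)
  then have "?P ([:- a, 1:] ^ p) * g = ?x * (?P ([:- a, 1:] ^ (p - 1)) * g)"
    by (simp only: x_P free_poly_eq_ev ev_mult mult.assoc)
  ultimately obtain u where u: "?x * u \<doteq> 1" by auto
  obtain N where "?P (c ^ N) * u \<in> y_span fx m" using denominators by blast
  then obtain s where s: "?P (c ^ N) * u \<doteq> (\<Sum>i<m. ?P (s i) * fy ^ i)"
    by (auto simp: y_span_def free_poly_eq_ev)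
  \<comment> \<open>Multiplying the normal form of \<open>c^N u\<close> by \<open>x - a\<close> must
    give \<open>c^N\<close>; the \<open>t i\<close> are the coefficients of the difference.
    Independence at index 0 makes \<open>c^N\<close> divisible by \<open>X - a\<close>, against the
    choice of \<open>a\<close>.\<close>
  define t where "t i = [:- a, 1:] * s i - (if i = 0 then c ^ N else 0)" for i
  have "(\<Sum>i<m. ?P (t i) * fy ^ i) = ?x * (\<Sum>i<m. ?P (s i) * fy ^ i) - (\<Sum>i<m. ?P (if i = 0 then c ^ N else 0) * fy ^ i)"
    unfolding t_def x_P free_poly_eq_ev ev_diff ev_mult
    by (simp only: left_diff_distrib sum_subtractf sum_distrib_left mult.assoc)
  also have "(\<Sum>i<m. ?P (if i = 0 then c ^ N else 0) * fy ^ i) = ?P (c ^ N)"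
    using \<open>m \<noteq> 0\<close> by (simp add: free_poly_eq_ev if_distrib[where f = "ev fx"] if_distrib[where f = "\<lambda>a. a * _"] cong: if_cong)
  also have "?x * (\<Sum>i<m. ?P (s i) * fy ^ i) - ?P (c ^ N) \<doteq> ?x * (?P (c ^ N) * u) - ?P (c ^ N) * (?x * u)"
    using eqv_mult[OF eqv_sym[OF s], of ?x] eqv_mult[OF eqv_sym[OF u], of "?P (c ^ N)"]
    by (intro eqv_diff) simp_all
  also have "\<dots> = 0"
    by (simp add: x_P free_poly_eq_ev mult.assoc[symmetric] ev_commute[of fx "c ^ N"])
  finally have "t 0 = 0" using indep[of t 0] \<open>m \<noteq> 0\<close> by (simp add: eqv_0_iff)
  then have "[:- a, 1:] * s 0 = c ^ N" by (simp add: t_def)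
  then have "poly ([:- a, 1:] * s 0) a = poly c a ^ N" by (metis poly_power)
  then show False using a by simp
qed

section \<open>Consequences of an eigenvector of \<open>x\<close>, mainly at roots of
  \<open>h\<close>\<close>

context ore_left_ideal
begin

lemma free_poly_eqv_const:
  assumes "fx - free_const \<mu> \<in> J"
  shows "free_poly r \<doteq> free_const (poly r \<mu>)"
proof -
  have "poly (r - [:poly r \<mu>:]) \<mu> = 0" by simp
  then obtain s where s: "r - [:poly r \<mu>:] = [:- \<mu>, 1:] * s" unfolding poly_eq_0_iff_dvd dvd_def by blast
  have "free_poly r - free_const (poly r \<mu>) = ev fx (r - [:poly r \<mu>:])"
    by (simp only: free_poly_eq_ev ev_diff ev_const)
  also have "\<dots> = ev fx s * (fx - free_const \<mu>)"
    unfolding s by (simp only: ev_mult ev_linear[symmetric] ev_commute[of fx _ s])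
  also have "\<dots> \<in> J" using assms by (rule J_mult)
  finally show ?thesis by (simp add: eqv_def)
qed

text \<open>Since \<open>h y = y h - h' h\<close>, the vectors killed by \<open>h\<close> form a
  submodule. At a root of \<open>h\<close> it contains the generator.\<close>

lemma h_annihilates:
  assumes "fx - free_const \<mu> \<in> J" "poly h \<mu> = 0"
  shows "free_poly h * f \<in> J"
proof (induction f rule: free_alg_induct)
  case one
  show ?case using free_poly_eqv_const[OF assms(1), of h] assms(2) by (simp add: eqv_0_iff)
next
  case (y f)
  have "free_poly h * (fy * f) = fy * (free_poly h * f) - free_poly (\<delta> h h) * f
      - (fy * (free_poly h * f) - (free_poly h * (fy * f) + free_poly (\<delta> h h) * f))"
    by (simp add: algebra_simps)
  moreover have "free_poly (\<delta> h h) * f = free_poly (pderiv h) * (free_poly h * f)"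
    by (simp add: \<delta>_def free_poly_eq_ev ev_mult mult.assoc)
  moreover have "free_poly (pderiv h) * (free_poly h * f) \<in> J" "fy * (free_poly h * f) \<in> J"
    using y by (simp_all add: J_mult)
  ultimately show ?case
    using eqv_y_free_poly[of h f] unfolding eqv_def by (metis J_diff)
next
  case (const c f)
  then show ?case using J_mult[of "free_poly h * f" "free_const c"]
    by (metis free_const_commute mult.assoc)
next
  case (x f)
  have "free_poly h * fx = fx * free_poly h" using ev_commute[of fx h xpoly] by (simp add: free_poly_eq_ev)
  then show ?case using J_mult[OF x, of fx] by (metis mult.assoc)
qed (simp add: distrib_left J_add)

text \<open>As \<open>h\<close> acts as zero, \<open>x\<close> and \<open>y\<close> commute on the
  module, and the eigenvalue spreads from the generator to every vector.\<close>

lemma x_scalar: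
  assumes "fx - free_const \<mu> \<in> J" "poly h \<mu> = 0"
  shows "(fx - free_const \<mu>) * f \<in> J"
proof -
  have swap: "free_const \<mu> * (g * f) = g * (free_const \<mu> * f)" for f g :: "'a free_alg"
    using free_const_commute[of \<mu> g] by (simp add: mult.assoc[symmetric])
  show ?thesis
  proof (induction f rule: free_alg_induct)
    case (const c f)
    then show ?case using J_mult[of "(fx - free_const \<mu>) * f" "free_const c"]
      by (metis free_const_commute mult.assoc)
  next
    case (x f)
    have "(fx - free_const \<mu>) * (fx * f) = fx * ((fx - free_const \<mu>) * f)"
      by (simp only: left_diff_distrib right_diff_distrib mult.assoc swap)
    then show ?case using J_mult[OF x] by simp
  next
    case (y f)
    have "(fx - free_const \<mu>) * (fy * f) = fy * ((fx - free_const \<mu>) * f) - free_poly h * f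
        - (fy * (fx * f) - (fx * (fy * f) + free_poly h * f))"
      by (simp add: left_diff_distrib right_diff_distrib mult.assoc swap)
    moreover have "fy * (fx * f) - (fx * (fy * f) + free_poly h * f) \<in> J"
      using eqv_y_free_poly[of xpoly f] by (simp add: eqv_def \<delta>_xpoly free_poly_eq_ev)
    ultimately show ?case
      using h_annihilates[OF assms, of f] J_mult[OF y] by (simp only: J_diff)
  qed (use assms in \<open>simp_all add: distrib_left J_add\<close>)
qed

text \<open>This turns the left inverse of \<open>y\<close> into a right inverse in
  \<open>y_eigenvector\<close>.\<close>

lemma y_commutes:
  assumes "fx - free_const \<mu> \<in> J" "poly h \<mu> = 0"
  shows "fy * f \<doteq> f * fy"
proof (induction f rule: free_alg_induct)
  case (add f g)
  then show ?case using eqv_add by (simp add: distrib_left distrib_right)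
next
  case (const c f)
  have "fy * (free_const c * f) = free_const c * (fy * f)"
    by (metis free_const_commute mult.assoc)
  then show ?case using eqv_mult[OF const, of "free_const c"] by (simp only: mult.assoc)
next
  case (x f)
  have "fy * (fx * f) \<doteq> fx * (fy * f) + free_poly h * f"
    using eqv_y_free_poly[of xpoly f] by (simp add: \<delta>_xpoly free_poly_eq_ev)
  also have "\<dots> \<doteq> fx * (f * fy) + 0"
    using h_annihilates[OF assms] by (intro eqv_add eqv_mult x) (simp add: eqv_0_iff)
  finally show ?case by (simp add: mult.assoc)
next
  case (y f)
  then show ?case using eqv_mult[OF y, of fy] by (simp add: mult.assoc)
qed simp

text \<open>Powers of \<open>y - \<theta>\<close> rather than of \<open>y\<close>, so that the
  constant coefficient is the remainder modulo \<open>g\<close>. For \<open>\<theta> = 0\<close> it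
  gives polynomials in \<open>y\<close>.\<close>

lemma ev_g_normal_form:
  assumes "fx - free_const \<mu> \<in> J" "poly h \<mu> = 0"
  shows "\<exists>s. f \<doteq> ev (fy - free_const \<theta>) s"
proof (induction f rule: free_alg_induct)
  case one
  show ?case by (intro exI[of _ 1]) simp
next
  case (add f g)
  then show ?case using eqv_add by (metis ev_add)
next
  case (const c f)
  then show ?case using eqv_mult by (metis ev_smult)
next
  case (x f)
  have "fx * f \<doteq> free_const \<mu> * f"
    using x_scalar[OF assms, of f] by (simp add: eqv_def algebra_simps)
  then show ?case using x eqv_mult eqv_trans by (metis ev_smult)
next
  case (y f)
  then obtain s where "f \<doteq> ev (fy - free_const \<theta>) s" by blast
  then have "fy * f \<doteq> fy * ev (fy - free_const \<theta>) s" by (rule eqv_mult)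
  also have "\<dots> = ev (fy - free_const \<theta>) ([:\<theta>, 1:] * s)"
    unfolding ev_mult by (simp add: ev_pCons algebra_simps)
  finally show ?case by blast
qed

end

section \<open>Powers of \<open>y\<close> modulo a left ideal\<close>

definition x_coeff :: "'a::field poly \<Rightarrow> 'a \<Rightarrow> nat \<Rightarrow> nat \<Rightarrow> 'a" where
  "x_coeff h \<mu> n j = (- 1) ^ j * of_nat (n choose j) * poly ((\<delta> h ^^ j) xpoly) \<mu>"

context ore_left_ideal
begin

lemma x_y_power:
  assumes "fx - free_const \<mu> \<in> J"
  shows "fx * fy ^ n \<doteq> (\<Sum>j\<le>n. free_const (x_coeff h \<mu> n j) * fy ^ (n - j))"
proof -
  have "fx * fy ^ n \<doteq>
      (\<Sum>j\<le>n. fy ^ (n - j) * free_poly (smult ((- 1) ^ j * of_nat (n choose j)) ((\<delta> h ^^ j) xpoly)))"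
    using eqv_A_ideal'[OF free_poly_y_power[of xpoly n h]] by (simp add: free_poly_eq_ev)
  also have "\<dots> \<doteq> (\<Sum>j\<le>n. fy ^ (n - j) * free_const (x_coeff h \<mu> n j))"
    using free_poly_eqv_const[OF assms]
    by (intro eqv_sum eqv_mult) (metis poly_smult x_coeff_def)
  finally show ?thesis by (simp only: free_const_commute)
qed

text \<open>In the expansion of \<open>x y^(n+1)\<close>, the term \<open>j = 0\<close> cancels
  against \<open>\<mu>\<close>, and \<open>j = 1\<close> contributes
  \<open>-(n+1) h(\<mu>) y^n\<close>. The coefficients are constants, hence \<open>e\<close> may be
  anything.\<close>

lemma x_minus_const_y_power:
  assumes "fx - free_const \<mu> \<in> J"
  shows "(fx - free_const \<mu>) * fy ^ n \<in> y_span e n"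
    and "(fx - free_const \<mu>) * fy ^ Suc n - free_const (- of_nat (Suc n) * poly h \<mu>) * fy ^ n \<in> y_span e n"
proof -
  let ?F = "\<lambda>n j. free_const (x_coeff h \<mu> n j) * fy ^ (n - j)"
  have F: "?F n j \<in> y_span e m" if "n - j < m" for n j m
    using y_span_ev[OF y_span_power[OF that], of e "[:x_coeff h \<mu> n j:]"] by simp
  have 0: "?F n 0 = free_const \<mu> * fy ^ n" for n by (simp add: x_coeff_def)
  have split: "(\<Sum>j\<le>n. ?F n j) = ?F n 0 + (\<Sum>j\<in>{1..n}. ?F n j)" for n
    by (simp add: sum.atLeast_Suc_atMost[of 0 n, symmetric] atMost_atLeast0 flip: One_nat_def)
      (simp add: sum.atLeast_Suc_atMost)
  have 1: "(fx - free_const \<mu>) * fy ^ n \<doteq> (\<Sum>j\<in>{1..n}. ?F n j)" for n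
    using eqv_diff[OF x_y_power[OF assms, of n] eqv_refl[of "free_const \<mu> * fy ^ n"]]
    unfolding split 0 by (simp add: left_diff_distrib)
  show "(fx - free_const \<mu>) * fy ^ n \<in> y_span e n"
    by (rule y_span_eqv[OF 1], rule y_span_sum, rule F) auto
  have "?F (Suc n) 1 = free_const (- of_nat (Suc n) * poly h \<mu>) * fy ^ n"
    by (simp add: x_coeff_def \<delta>_xpoly[simplified])
  moreover have "(\<Sum>j\<in>{1..Suc n}. ?F (Suc n) j) = ?F (Suc n) 1 + (\<Sum>j\<in>{2..Suc n}. ?F (Suc n) j)"
    by (simp add: sum.atLeast_Suc_atMost numeral_2_eq_2)
  ultimately have 2: "(fx - free_const \<mu>) * fy ^ Suc n \<doteq>
      free_const (- of_nat (Suc n) * poly h \<mu>) * fy ^ n + (\<Sum>j\<in>{2..Suc n}. ?F (Suc n) j)"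
    using 1[of "Suc n"] by simp
  have "(fx - free_const \<mu>) * fy ^ Suc n - free_const (- of_nat (Suc n) * poly h \<mu>) * fy ^ n
      \<doteq> (\<Sum>j\<in>{2..Suc n}. ?F (Suc n) j)"
    using eqv_diff[OF 2 eqv_refl[of "free_const (- of_nat (Suc n) * poly h \<mu>) * fy ^ n"]] by simp
  then show "(fx - free_const \<mu>) * fy ^ Suc n - free_const (- of_nat (Suc n) * poly h \<mu>) * fy ^ n \<in> y_span e n"
    by (rule y_span_eqv, intro y_span_sum F) auto
qed

lemma ev_central:
  assumes "\<And>f. e * f - f * e \<in> A_ideal h"
  shows "ev e r * f - f * ev e r \<in> A_ideal h"
proof (induction r)
  case 0
  show ?case using ore_left_ideal.J_0[OF ore_left_ideal_A_ideal] by simp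
next
  case (pCons a r)
  have "ev e (pCons a r) * f - f * ev e (pCons a r)
      = e * (ev e r * f - f * ev e r) + (e * f - f * e) * ev e r"
    by (simp add: ev_pCons algebra_simps free_const_commute[of a f])
  then show ?case using pCons.IH assms
    by (simp add: A_ideal_add A_ideal_mult_left A_ideal_mult_right)
qed

text \<open>Central coefficients let \<open>g\<close> pass, so its effect on the powers of
  \<open>y\<close> decides.\<close>

lemma y_span_central:
  assumes central: "\<And>f. e * f - f * e \<in> A_ideal h"
    and f: "f \<in> y_span e d" and step: "\<And>i. i < d \<Longrightarrow> g * fy ^ i \<in> y_span e m"
  shows "g * f \<in> y_span e m"
proof -
  obtain r where r: "f \<doteq> (\<Sum>i<d. ev e (r i) * fy ^ i)" using f by (auto simp: y_span_def)
  have "g * f \<doteq> (\<Sum>i<d. g * (ev e (r i) * fy ^ i))"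
    using eqv_mult[OF r, of g] by (simp add: sum_distrib_left)
  also have "\<dots> \<doteq> (\<Sum>i<d. ev e (r i) * (g * fy ^ i))"
    using eqv_sym[OF eqv_A_ideal[OF ev_central[OF central]]]
    by (intro eqv_sum) (simp add: mult.assoc[symmetric])
  finally show ?thesis
    by (rule y_span_eqv) (intro y_span_sum y_span_ev step, simp)
qed

text \<open>Each application of \<open>x - \<mu>\<close> lowers the degree in \<open>y\<close> by
  one and multiplies the leading coefficient by \<open>- d h(\<mu>)\<close>, which is nonzero for
  \<open>0 < d < p\<close>. After all \<open>y\<close> have gone, a nonzero multiple of
  \<open>t(e)\<close> is left.\<close>

lemma lower_degree:
  assumes p: "CHAR('a) = p"
    and x: "fx - free_const \<mu> \<in> J" and \<mu>: "poly h \<mu> \<noteq> 0"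
    and central: "\<And>f. e * f - f * e \<in> A_ideal h"
  shows "\<lbrakk>d < p; ev e t * fy ^ d + g \<in> J; g \<in> y_span e d\<rbrakk> \<Longrightarrow> \<exists>k. k \<noteq> 0 \<and> ev e (smult k t) \<in> J"
proof (induction d arbitrary: t g)
  case 0
  then have "g \<in> J" by (simp add: y_span_def eqv_0_iff)
  then have "ev e t * fy ^ 0 + g - g \<in> J" by (rule J_diff[OF 0(2)])
  then have "ev e t \<in> J" by simp
  then show ?case by (intro exI[of _ 1]) simp
next
  case (Suc d)
  let ?x = "fx - free_const \<mu>" and ?k = "- of_nat (Suc d) * poly h \<mu>"
  have "?x * g \<in> y_span e d"
    by (rule y_span_central[OF central Suc.prems(3)])
      (auto intro: y_span_mono[OF x_minus_const_y_power(1)[OF x]])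
  moreover have "ev e t * (?x * fy ^ Suc d - free_const ?k * fy ^ d) \<in> y_span e d"
    by (rule y_span_ev[OF x_minus_const_y_power(2)[OF x]])
  ultimately have g': "ev e t * (?x * fy ^ Suc d - free_const ?k * fy ^ d) + ?x * g \<in> y_span e d"
    (is "?g' \<in> _") by (simp only: y_span_add)
  have "ev e (smult ?k t) * fy ^ d + ?g' = ev e t * ?x * fy ^ Suc d + ?x * g"
    by (simp only: ev_smult free_const_commute[of ?k "ev e t"]) (simp only: algebra_simps)
  also have "\<dots> \<doteq> ?x * ev e t * fy ^ Suc d + ?x * g"
    by (intro eqv_add eqv_A_ideal ev_central central eqv_refl)
  also have "\<dots> = ?x * (ev e t * fy ^ Suc d + g)" by (simp only: algebra_simps)
  finally have "ev e (smult ?k t) * fy ^ d + ?g' \<in> J"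
    using Suc.prems(2) J_mult eqv_mem by blast
  then obtain k where k: "k \<noteq> 0" "ev e (smult k (smult ?k t)) \<in> J"
    using Suc.IH[of "smult ?k t" ?g'] Suc.prems(1) g' by auto
  have "(of_nat (Suc d) :: 'a) \<noteq> 0"
    using Suc.prems(1) p by (simp only: of_nat_eq_0_iff_char_dvd) (auto dest: dvd_imp_le)
  then have "k * ?k \<noteq> 0" using k(1) \<mu> by (simp del: of_nat_Suc)
  then show ?case using k(2) by (intro exI[of _ "k * ?k"]) simp
qed

lemma y_relation:
  assumes p: "CHAR('a) = p"
    and x: "fx - free_const \<mu> \<in> J" and \<mu>: "poly h \<mu> \<noteq> 0"
    and central: "\<And>f. e * f - f * e \<in> A_ideal h"
  shows "\<lbrakk>n \<le> p; (\<Sum>i<n. ev e (t i) * fy ^ i) \<in> J; \<exists>i<n. t i \<noteq> 0\<rbrakk>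
    \<Longrightarrow> \<exists>i<n. \<exists>k. k \<noteq> 0 \<and> t i \<noteq> 0 \<and> ev e (smult k (t i)) \<in> J"
proof (induction n)
  case (Suc n)
  show ?case
  proof (cases "t n = 0")
    case True
    then show ?thesis using Suc by (auto simp: less_Suc_eq)
  next
    case False
    have "(\<Sum>i<n. ev e (t i) * fy ^ i) \<in> y_span e n" by (rule y_spanI) (rule eqv_refl)
    then show ?thesis
      using lower_degree[OF p x \<mu> central, of n "t n" "\<Sum>i<n. ev e (t i) * fy ^ i"] Suc.prems False
      by (auto simp: add.commute)
  qed
qed simp

lemma y_power_independent:
  assumes p: "CHAR('a) = p" and x: "fx - free_const \<mu> \<in> J" and \<mu>: "poly h \<mu> \<noteq> 0"
    and "1 \<notin> J" and rel: "(\<Sum>i<p. free_const (c i) * fy ^ i) \<in> J" and "i < p"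
  shows "c i = 0"
proof (rule ccontr)
  assume "c i \<noteq> 0"
  \<comment> \<open>Scalars are treated as polynomials evaluated at the central element 0.\<close>
  moreover have "(0::'a free_alg) * f - f * 0 \<in> A_ideal h" for f
    using ore_left_ideal.J_0[OF ore_left_ideal_A_ideal] by simp
  ultimately obtain i k where k: "k \<noteq> 0" "c i \<noteq> 0" "ev 0 (smult k [:c i:]) \<in> J"
    using y_relation[OF p x \<mu>, of 0 p "\<lambda>i. [:c i:]"] rel \<open>i < p\<close> by auto
  then have "free_const (inverse (k * c i)) * free_const (k * c i) \<in> J" by (auto intro: J_mult)
  moreover have "free_const (inverse (k * c i)) * free_const (k * c i) = 1"
    unfolding free_const_mult[symmetric] using k(1,2) left_inverse[of "k * c i"] by simp
  ultimately show False using \<open>1 \<notin> J\<close> by simp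
qed

text \<open>The span contains 1 and is stable under \<open>x\<close> and \<open>y\<close>:
  \<open>z\<close> is central, so both need checking on the powers of \<open>y\<close> only. The
  critical one is \<open>y^p = z + \<beta> + y q(x)\<close>, where \<open>q(x)\<close> acts on the
  generator as \<open>q(\<mu>)\<close>.\<close>

lemma z_normal_form:
  fixes p \<beta> defines "z \<equiv> z_free h p \<beta>"
  assumes p: "CHAR('a) = p" "p > 0" "h \<noteq> 0" and x: "fx - free_const \<mu> \<in> J"
  shows "f \<in> y_span z p"
proof -
  \<comment> \<open>\<open>p > 1\<close> is what admits the power \<open>y^1\<close> on the
    right-hand side when \<open>y^p\<close> is rewritten.\<close>
  have "p \<noteq> 1" using p(1) CHAR_not_1'[where 'a='a] by simp
  then have "p > 1" using p(2) by simp
  have central: "z * g - g * z \<in> A_ideal h" for g unfolding z_def by (rule z_free_central[OF p])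
  show ?thesis
  proof (induction f rule: free_alg_induct)
    case one
    show ?case using y_span_power[of 0 p z] p by simp
  next
    case (add f g)
    then show ?case by (rule y_span_add)
  next
    case (const c f)
    then show ?case using y_span_ev[of f z p "[:c:]"] by simp
  next
    case (x f)
    show ?case
    proof (rule y_span_central[OF central x])
      fix i assume "i < p"
      have "free_const (x_coeff h \<mu> i j) * fy ^ (i - j) \<in> y_span z p" for j
        using y_span_ev[OF y_span_power[of "i - j" p z], of "[:x_coeff h \<mu> i j:]"] \<open>i < p\<close> by simp
      then show "fx * fy ^ i \<in> y_span z p"
        by (intro y_span_eqv[OF x_y_power[OF assms(5)]] y_span_sum)
    qed
  next
    case (y f)
    show ?case
    proof (rule y_span_central[OF central y])
      fix i assume "i < p"
      show "fy * fy ^ i \<in> y_span z p"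
      proof (cases "Suc i < p")
        case True
        then show ?thesis using y_span_power[of "Suc i" p z] by simp
      next
        case False
        then have i: "Suc i = p" using \<open>i < p\<close> by simp
        let ?q = "poly (\<delta>quot h p) \<mu>"
        have "fy * fy ^ i = z + free_const \<beta> + fy * free_poly (\<delta>quot h p)"
          by (simp add: z_def z_free_def i power_Suc[symmetric] del: power_Suc)
        also have "\<dots> \<doteq> z + free_const \<beta> + fy * free_const ?q"
          by (intro eqv_add eqv_mult free_poly_eqv_const x eqv_refl)
        also have "\<dots> = ev z [:\<beta>, 1:] * fy ^ 0 + ev z [:?q:] * fy ^ 1"
          by (simp add: ev_pCons free_const_commute)
        also have "\<dots> \<in> y_span z p"
          using \<open>p > 1\<close> by (intro y_span_add y_span_ev y_span_power) auto
        finally show ?thesis using y_span_eqv by blast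
      qed
    qed
  qed
qed

end

context ore_maximal_left_ideal
begin

text \<open>A relation over \<open>F[z]\<close> puts a nonzero polynomial in \<open>z\<close> into
  \<open>J\<close>, whence \<open>z\<close> has an eigenvector; centrality extends its eigenvalue to
  the whole module.\<close>

lemma z_annihilates:
  assumes p: "CHAR('a) = p" "p > 0" "h \<noteq> 0"
    and x: "fx - free_const \<mu> \<in> J" and \<mu>: "poly h \<mu> \<noteq> 0"
  shows "\<exists>\<beta>. \<forall>f. z_free h p \<beta> * f \<in> J"
proof -
  let ?z = "z_free h p 0"
  have central: "z_free h p \<beta> * f - f * z_free h p \<beta> \<in> A_ideal h" for f \<beta>
    by (rule z_free_central[OF p])
  have "\<exists>\<beta> f. f \<notin> J \<and> (?z - free_const \<beta>) * f \<in> J"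
  proof (cases "?z \<in> J")
    case True
    then show ?thesis using one_notin by (intro exI[of _ 0] exI[of _ 1]) simp
  next
    case False
    then obtain g where g: "g * ?z - 1 \<in> J" using left_inverse by blast
    obtain s where s: "g \<doteq> (\<Sum>i<p. ev ?z (s i) * fy ^ i)"
      using z_normal_form[OF p x, of g 0] by (auto simp: y_span_def)
    \<comment> \<open>The coefficients of \<open>z * g - 1\<close>. The polynomial
      \<open>t 0\<close> takes the value -1 at 0, which makes the relation nontrivial.\<close>
    define t where "t i = xpoly * s i - (if i = 0 then 1 else 0)" for i
    have "(\<Sum>i<p. ev ?z (t i) * fy ^ i) = ?z * (\<Sum>i<p. ev ?z (s i) * fy ^ i) - (\<Sum>i<p. ev ?z (if i = 0 then 1 else 0) * fy ^ i)"
      unfolding t_def ev_diff ev_mult ev_xpoly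
      by (simp only: left_diff_distrib sum_subtractf sum_distrib_left mult.assoc)
    also have "(\<Sum>i<p. ev ?z (if i = 0 then 1 else 0) * fy ^ i) = 1"
      using p by (simp add: if_distrib[where f = "ev _"] if_distrib[where f = "\<lambda>a. a * _"] cong: if_cong)
    also have "?z * (\<Sum>i<p. ev ?z (s i) * fy ^ i) - 1 \<doteq> ?z * g - 1"
      by (intro eqv_diff eqv_mult eqv_sym[OF s] eqv_refl)
    also have "\<dots> \<doteq> g * ?z - 1"
      by (intro eqv_diff eqv_A_ideal'[OF central] eqv_refl)
    finally have "(\<Sum>i<p. ev ?z (t i) * fy ^ i) \<in> J" using g eqv_mem by blast
    moreover have "t 0 \<noteq> 0"
    proof
      assume "t 0 = 0"
      then have "poly (xpoly * s 0 - 1) 0 = 0" by (simp add: t_def)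
      then show False by simp
    qed
    then have "\<exists>i<p. t i \<noteq> 0" using p(2) by blast
    ultimately obtain i k where "k \<noteq> 0" "t i \<noteq> 0" "ev ?z (smult k (t i)) \<in> J"
      using y_relation[OF p(1) x \<mu>, of ?z p t] central by blast
    then show ?thesis using ev_eigenvector[of ?z "smult k (t i)"] by auto
  qed
  then obtain \<beta> f where "f \<notin> J" "z_free h p \<beta> * f \<in> J" by (auto simp: z_free_def)
  then show ?thesis using central_annihilates[OF central] by blast
qed

text \<open>Here \<open>y g - 1\<close> is itself a polynomial in \<open>y\<close>, nonzero because
  of its value -1 at 0.\<close>

lemma y_eigenvector:
  assumes x: "fx - free_const \<mu> \<in> J" and \<mu>: "poly h \<mu> = 0"
  shows "\<exists>\<theta> f. f \<notin> J \<and> (fx - free_const \<mu>) * f \<in> J \<and> (fy - free_const \<theta>) * f \<in> J"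
proof -
  have "\<exists>\<theta> f. f \<notin> J \<and> (fy - free_const \<theta>) * f \<in> J"
  proof (cases "fy \<in> J")
    case True
    then show ?thesis using one_notin by (intro exI[of _ 0] exI[of _ 1]) simp
  next
    case False
    then obtain g where g: "g * fy - 1 \<in> J" using left_inverse by blast
    obtain s where s: "g \<doteq> ev fy s" using ev_g_normal_form[OF x \<mu>, of g 0] by auto
    have "ev fy (xpoly * s - 1) = fy * ev fy s - 1" unfolding ev_diff ev_mult by simp
    also have "\<dots> \<doteq> fy * g - 1" by (intro eqv_diff eqv_mult eqv_sym[OF s] eqv_refl)
    also have "\<dots> \<doteq> g * fy - 1" by (intro eqv_diff y_commutes[OF x \<mu>] eqv_refl)
    finally have "ev fy (xpoly * s - 1) \<in> J" using g eqv_mem by blast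
    moreover have "poly (xpoly * s - 1) 0 \<noteq> 0" by simp
    ultimately show ?thesis using ev_eigenvector by (metis poly_0)
  qed
  then show ?thesis using x_scalar[OF x \<mu>] by blast
qed

end

section \<open>Quotient modules and tensor products\<close>

text \<open>
  The module axioms are only required modulo \<open>N\<close>: this covers both quotients of modules and the
  tensor product, where the ring acts on a free abelian group by operators that are not additive
  in the scalar.
\<close>

locale module_modulo = R: ring R + abelian_subgroup N M
  for R :: "('r, 'k) ring_scheme" (structure) and M :: "('r, 'v, 'm) module_scheme" (structure) and N +
  assumes closed: "\<lbrakk>a \<in> carrier R; v \<in> carrier M\<rbrakk> \<Longrightarrow> a \<odot>\<^bsub>M\<^esub> v \<in> carrier M"
    and stable: "\<lbrakk>a \<in> carrier R; v \<in> N\<rbrakk> \<Longrightarrow> a \<odot>\<^bsub>M\<^esub> v \<in> N"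
    and add_right: "\<lbrakk>a \<in> carrier R; v \<in> carrier M; w \<in> carrier M\<rbrakk>
          \<Longrightarrow> a \<odot>\<^bsub>M\<^esub> (v \<oplus>\<^bsub>M\<^esub> w) = a \<odot>\<^bsub>M\<^esub> v \<oplus>\<^bsub>M\<^esub> a \<odot>\<^bsub>M\<^esub> w"
    and add_left: "\<lbrakk>a \<in> carrier R; b \<in> carrier R; v \<in> carrier M\<rbrakk>
          \<Longrightarrow> N +>\<^bsub>M\<^esub> ((a \<oplus>\<^bsub>R\<^esub> b) \<odot>\<^bsub>M\<^esub> v) = N +>\<^bsub>M\<^esub> (a \<odot>\<^bsub>M\<^esub> v \<oplus>\<^bsub>M\<^esub> b \<odot>\<^bsub>M\<^esub> v)"
    and assoc: "\<lbrakk>a \<in> carrier R; b \<in> carrier R; v \<in> carrier M\<rbrakk>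
          \<Longrightarrow> N +>\<^bsub>M\<^esub> ((a \<otimes>\<^bsub>R\<^esub> b) \<odot>\<^bsub>M\<^esub> v) = N +>\<^bsub>M\<^esub> (a \<odot>\<^bsub>M\<^esub> (b \<odot>\<^bsub>M\<^esub> v))"
    and one: "v \<in> carrier M \<Longrightarrow> N +>\<^bsub>M\<^esub> (\<one>\<^bsub>R\<^esub> \<odot>\<^bsub>M\<^esub> v) = N +>\<^bsub>M\<^esub> v"
begin

lemma quotient_carrier: "carrier (quotient_module M N) = (\<lambda>v. N +>\<^bsub>M\<^esub> v) ` carrier M"
  by (auto simp: quotient_module_def A_RCOSETS_def')

lemma quotient_add:
  "v \<in> carrier M \<Longrightarrow> w \<in> carrier M \<Longrightarrow>
    (N +>\<^bsub>M\<^esub> v) \<oplus>\<^bsub>quotient_module M N\<^esub> (N +>\<^bsub>M\<^esub> w) = N +>\<^bsub>M\<^esub> (v \<oplus>\<^bsub>M\<^esub> w)"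
  by (simp add: quotient_module_def a_rcos_sum)

lemma quotient_zero: "\<zero>\<^bsub>quotient_module M N\<^esub> = N"
  by (simp add: quotient_module_def)

text \<open>The image of a coset under \<open>a\<close> need not be a full coset, hence the summand
  \<open>N\<close> in the definition of the action. Stability of \<open>N\<close> absorbs the image
  of \<open>N\<close> under \<open>a\<close>.\<close>

lemma quotient_smult:
  assumes a: "a \<in> carrier R" and v: "v \<in> carrier M"
  shows "a \<odot>\<^bsub>quotient_module M N\<^esub> (N +>\<^bsub>M\<^esub> v) = N +>\<^bsub>M\<^esub> (a \<odot>\<^bsub>M\<^esub> v)"
proof -
  have sub: "n \<in> carrier M" if "n \<in> N" for n using that a_subset by blast
  have "N <+>\<^bsub>M\<^esub> ((\<lambda>v. a \<odot>\<^bsub>M\<^esub> v) ` (N +>\<^bsub>M\<^esub> v))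
      = {n \<oplus>\<^bsub>M\<^esub> a \<odot>\<^bsub>M\<^esub> (m \<oplus>\<^bsub>M\<^esub> v) | n m. n \<in> N \<and> m \<in> N}"
    by (auto simp: set_add_def' a_r_coset_def')
  also have "\<dots> = {n \<oplus>\<^bsub>M\<^esub> a \<odot>\<^bsub>M\<^esub> v | n. n \<in> N}"
  proof (intro equalityI subsetI)
    fix w assume "w \<in> {n \<oplus>\<^bsub>M\<^esub> a \<odot>\<^bsub>M\<^esub> (m \<oplus>\<^bsub>M\<^esub> v) | n m. n \<in> N \<and> m \<in> N}"
    then obtain n m where nm: "n \<in> N" "m \<in> N" and w: "w = n \<oplus>\<^bsub>M\<^esub> a \<odot>\<^bsub>M\<^esub> (m \<oplus>\<^bsub>M\<^esub> v)" by auto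
    have "w = (n \<oplus>\<^bsub>M\<^esub> a \<odot>\<^bsub>M\<^esub> m) \<oplus>\<^bsub>M\<^esub> a \<odot>\<^bsub>M\<^esub> v"
      using nm a v by (simp add: w add_right sub closed a_assoc)
    then show "w \<in> {n \<oplus>\<^bsub>M\<^esub> a \<odot>\<^bsub>M\<^esub> v | n. n \<in> N}" using nm a stable by blast
  next
    fix w assume "w \<in> {n \<oplus>\<^bsub>M\<^esub> a \<odot>\<^bsub>M\<^esub> v | n. n \<in> N}"
    then obtain n where n: "n \<in> N" "w = n \<oplus>\<^bsub>M\<^esub> a \<odot>\<^bsub>M\<^esub> v" by blast
    have "w = n \<oplus>\<^bsub>M\<^esub> a \<odot>\<^bsub>M\<^esub> (\<zero>\<^bsub>M\<^esub> \<oplus>\<^bsub>M\<^esub> v)" using n v by simp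
    then show "w \<in> {n \<oplus>\<^bsub>M\<^esub> a \<odot>\<^bsub>M\<^esub> (m \<oplus>\<^bsub>M\<^esub> v) | n m. n \<in> N \<and> m \<in> N}"
      using n(1) additive_subgroup.zero_closed[OF is_additive_subgroup]
      by (intro CollectI exI[of _ n] exI[of _ "\<zero>\<^bsub>M\<^esub>"] conjI)
  qed
  also have "\<dots> = N +>\<^bsub>M\<^esub> (a \<odot>\<^bsub>M\<^esub> v)" by (auto simp: a_r_coset_def')
  finally show ?thesis by (simp add: quotient_module_def)
qed

lemma abelian_group_quotient: "abelian_group (quotient_module M N)"
proof -
  have zero: "\<zero>\<^bsub>quotient_module M N\<^esub> = N +>\<^bsub>M\<^esub> \<zero>\<^bsub>M\<^esub>"
    using a_coset_add_zero[OF a_subset] by (simp add: quotient_zero)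
  show ?thesis
  proof (rule abelian_groupI)
    fix C assume "C \<in> carrier (quotient_module M N)"
    then obtain v where v: "v \<in> carrier M" "C = N +>\<^bsub>M\<^esub> v" by (auto simp: quotient_carrier)
    then show "\<exists>D\<in>carrier (quotient_module M N). D \<oplus>\<^bsub>quotient_module M N\<^esub> C = \<zero>\<^bsub>quotient_module M N\<^esub>"
      by (intro bexI[of _ "N +>\<^bsub>M\<^esub> (\<ominus>\<^bsub>M\<^esub> v)"])
        (auto simp: quotient_carrier quotient_add zero l_neg)
  qed (auto simp: quotient_carrier quotient_add zero a_ac)
qed

lemma left_module_quotient: "left_module R (quotient_module M N)"
proof -
  interpret Q: abelian_group "quotient_module M N" by (rule abelian_group_quotient)
  show ?thesis
    by unfold_locales
      (auto simp: quotient_carrier quotient_smult quotient_add closed add_left add_right assoc one)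
qed

lemma coset_eq_zero_iff: "v \<in> carrier M \<Longrightarrow> N +>\<^bsub>M\<^esub> v = \<zero>\<^bsub>quotient_module M N\<^esub> \<longleftrightarrow> v \<in> N"
  unfolding quotient_zero
  using a_coset_join1[OF _ _ a_subgroup] a_coset_join2[OF _ a_subgroup] by blast

end

lemma (in left_module) module_modulo_submodule:
  assumes "submodule N R M"
  shows "module_modulo R M N"
proof -
  have "additive_subgroup N M" using assms by (simp add: additive_subgroup.intro submodule.axioms(1))
  then interpret abelian_subgroup N M by (rule abelian_subgroupI3) (rule abelian_group_axioms)
  show ?thesis
    by unfold_locales
      (use submodule.smult_closed[OF assms] smult_closed in
        \<open>auto simp: smult_r_distr smult_l_distr smult_assoc smult_one\<close>)
qed

section \<open>Tensor products as quotients of free abelian groups\<close>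

locale tensor_data = A: ring A for A :: "('a, 'k) ring_scheme" (structure) +
  fixes R :: "('r, 'l) ring_scheme" and \<phi> :: "'r \<Rightarrow> 'a" and N :: "('r, 'n, 'm) module_scheme"
  assumes \<phi>: "\<And>r. r \<in> carrier R \<Longrightarrow> \<phi> r \<in> carrier A"
    and N_add: "\<And>n n'. \<lbrakk>n \<in> carrier N; n' \<in> carrier N\<rbrakk> \<Longrightarrow> n \<oplus>\<^bsub>N\<^esub> n' \<in> carrier N"
    and N_smult: "\<And>r n. \<lbrakk>r \<in> carrier R; n \<in> carrier N\<rbrakk> \<Longrightarrow> r \<odot>\<^bsub>N\<^esub> n \<in> carrier N"
begin

abbreviation (input) "G \<equiv> free_Abelian_group (carrier A \<times> carrier N)"
abbreviation (input) "K \<equiv> tensor_kernel A R \<phi> N"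

definition tensor_op :: "'a \<Rightarrow> ('a \<times> 'n \<Rightarrow>\<^sub>0 int) \<Rightarrow> ('a \<times> 'n \<Rightarrow>\<^sub>0 int)" where
  "tensor_op a = frag_extend (\<lambda>(b, n). frag_of (a \<otimes>\<^bsub>A\<^esub> b, n))"

definition tensor_premodule :: "('a, 'a \<times> 'n \<Rightarrow>\<^sub>0 int) module" where
  "tensor_premodule = \<lparr>carrier = carrier G, monoid.mult = undefined, one = undefined,
     ring.zero = monoid.one G, add = monoid.mult G, module.smult = tensor_op\<rparr>"

lemma tensor_module_eq: "tensor_module A R \<phi> N = quotient_module tensor_premodule K"
  unfolding tensor_module_def quotient_module_def tensor_premodule_def Let_def
  by (auto simp: FactGroup_def A_RCOSETS_def RCOSETS_def r_coset_def set_add_def set_mult_def tensor_op_def fun_eq_iff)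

lemma pure_tensor_eq: "pure_tensor A R \<phi> N a n = K +>\<^bsub>tensor_premodule\<^esub> frag_of (a, n)"
  by (simp add: pure_tensor_def tensor_premodule_def a_r_coset_def r_coset_def)

lemma carrier_premodule: "u \<in> carrier tensor_premodule \<longleftrightarrow> Poly_Mapping.keys u \<subseteq> carrier A \<times> carrier N"
  by (simp add: tensor_premodule_def)

lemma premodule_add: "u \<oplus>\<^bsub>tensor_premodule\<^esub> v = u + v"
  by (simp add: tensor_premodule_def)

lemma premodule_zero: "\<zero>\<^bsub>tensor_premodule\<^esub> = 0"
  by (simp add: tensor_premodule_def)

lemma premodule_smult: "a \<odot>\<^bsub>tensor_premodule\<^esub> u = tensor_op a u"
  by (simp add: tensor_premodule_def)

lemma abelian_group_premodule: "abelian_group tensor_premodule"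
proof (rule abelian_groupI)
  fix u assume "u \<in> carrier tensor_premodule"
  then show "\<exists>v\<in>carrier tensor_premodule. v \<oplus>\<^bsub>tensor_premodule\<^esub> u = \<zero>\<^bsub>tensor_premodule\<^esub>"
    by (intro bexI[of _ "- u"]) (simp_all add: carrier_premodule premodule_add premodule_zero)
next
  fix u v assume "u \<in> carrier tensor_premodule" "v \<in> carrier tensor_premodule"
  then show "u \<oplus>\<^bsub>tensor_premodule\<^esub> v \<in> carrier tensor_premodule"
    using keys_add[of u v] by (auto simp: carrier_premodule premodule_add)
qed (simp_all add: carrier_premodule premodule_add premodule_zero algebra_simps)

lemma tensor_op_of [simp]: "tensor_op a (frag_of (b, n)) = frag_of (a \<otimes>\<^bsub>A\<^esub> b, n)"
  by (simp add: tensor_op_def)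

lemma tensor_op_add: "tensor_op a (u + v) = tensor_op a u + tensor_op a v"
  by (simp add: tensor_op_def frag_extend_add)

lemma tensor_op_diff: "tensor_op a (u - v) = tensor_op a u - tensor_op a v"
  by (simp add: tensor_op_def frag_extend_diff)

lemma tensor_op_minus: "tensor_op a (- u) = - tensor_op a u"
  by (simp add: tensor_op_def frag_extend_minus)

lemma tensor_op_0 [simp]: "tensor_op a 0 = 0"
  by (simp add: tensor_op_def)

lemma tensor_op_carrier:
  assumes "a \<in> carrier A" "u \<in> carrier G"
  shows "tensor_op a u \<in> carrier G"
proof -
  have "Poly_Mapping.keys u \<subseteq> carrier A \<times> carrier N" using assms(2) by simp
  then have "Poly_Mapping.keys (tensor_op a u) \<subseteq> carrier A \<times> carrier N"
  proof (induction u rule: frag_induction)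
    case (diff u v)
    then show ?case
      unfolding tensor_op_diff using keys_diff[of "tensor_op a u" "tensor_op a v"] by blast
  next
    case (one b)
    then show ?case using assms(1) by (cases b) simp
  qed simp
  then show ?thesis by simp
qed

lemma tensor_relations_carrier: "tensor_relations A R \<phi> N \<subseteq> carrier G"
proof -
  have diff: "u - v \<in> carrier G" if "u \<in> carrier G" "v \<in> carrier G" for u v
    using that keys_diff[of u v] by auto
  have add: "u + v \<in> carrier G" if "u \<in> carrier G" "v \<in> carrier G" for u v
    using that keys_add[of u v] by auto
  have of: "frag_of (a, n) \<in> carrier G" if "a \<in> carrier A" "n \<in> carrier N" for a n
    using that by simp
  show ?thesis
    unfolding tensor_relations_def
    by (auto simp del: carrier_free_Abelian_group_iff intro!: diff add of N_add N_smult \<phi>)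
qed

lemma subgroup_K: "subgroup K G"
  unfolding tensor_kernel_def
  by (rule group.generate_is_subgroup[OF group_free_Abelian_group tensor_relations_carrier])

lemma K_carrier: "u \<in> K \<Longrightarrow> u \<in> carrier G"
  using subgroup.subset[OF subgroup_K] by blast

lemma K_add: "u \<in> K \<Longrightarrow> v \<in> K \<Longrightarrow> u + v \<in> K"
  using subgroup.m_closed[OF subgroup_K, of u v] by simp

lemma K_minus: "u \<in> K \<Longrightarrow> - u \<in> K"
  using subgroup.m_inv_closed[OF subgroup_K, of u] K_carrier[of u] by simp

lemma K_diff: "u \<in> K \<Longrightarrow> v \<in> K \<Longrightarrow> u - v \<in> K"
  using K_add[of u "- v"] K_minus[of v] by simp

lemma K_0: "0 \<in> K"
  using subgroup.one_closed[OF subgroup_K] by simp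

lemma K_relation: "u \<in> tensor_relations A R \<phi> N \<Longrightarrow> u \<in> K"
  unfolding tensor_kernel_def by (rule generate.incl)

text \<open>The closure steps carry membership in \<open>G\<close>, which a homomorphism on
  \<open>G\<close> needs in order to split sums and inverses.\<close>

lemma K_induct [consumes 1, case_names add_left add_right balanced zero minus add]:
  assumes "u \<in> K"
    and "\<And>a b n. \<lbrakk>a \<in> carrier A; b \<in> carrier A; n \<in> carrier N\<rbrakk> \<Longrightarrow>
        P (frag_of (a \<oplus>\<^bsub>A\<^esub> b, n) - (frag_of (a, n) + frag_of (b, n)))"
    and "\<And>a n n'. \<lbrakk>a \<in> carrier A; n \<in> carrier N; n' \<in> carrier N\<rbrakk> \<Longrightarrow>
        P (frag_of (a, n \<oplus>\<^bsub>N\<^esub> n') - (frag_of (a, n) + frag_of (a, n')))"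
    and "\<And>a r n. \<lbrakk>a \<in> carrier A; r \<in> carrier R; n \<in> carrier N\<rbrakk> \<Longrightarrow>
        P (frag_of (a \<otimes>\<^bsub>A\<^esub> \<phi> r, n) - frag_of (a, r \<odot>\<^bsub>N\<^esub> n))"
    and "P 0" and "\<And>u. u \<in> carrier G \<Longrightarrow> P u \<Longrightarrow> P (- u)"
    and "\<And>u v. \<lbrakk>u \<in> carrier G; v \<in> carrier G; P u; P v\<rbrakk> \<Longrightarrow> P (u + v)"
  shows "P u"
proof -
  have rel: "P u" if "u \<in> tensor_relations A R \<phi> N" for u
    using that unfolding tensor_relations_def by (auto intro: assms(2-4))
  have "u \<in> generate G (tensor_relations A R \<phi> N)"
    using assms(1) by (simp add: tensor_kernel_def)
  then show ?thesis
  proof (induction rule: generate.induct)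
    case (inv u)
    then have "u \<in> carrier G" using tensor_relations_carrier by blast
    then show ?case using assms(6)[OF _ rel[OF inv]] by simp
  next
    case (eng u v)
    then have "u \<in> carrier G" "v \<in> carrier G"
      using K_carrier by (simp_all add: tensor_kernel_def)
    then show ?case using assms(7) eng by simp
  qed (use assms(5) rel in auto)
qed

lemma tensor_op_K:
  assumes a: "a \<in> carrier A" and u: "u \<in> K"
  shows "tensor_op a u \<in> K"
  using u
proof (induction u rule: K_induct)
  case (add_left b c n)
  have "frag_of (a \<otimes>\<^bsub>A\<^esub> b \<oplus>\<^bsub>A\<^esub> a \<otimes>\<^bsub>A\<^esub> c, n) - (frag_of (a \<otimes>\<^bsub>A\<^esub> b, n) + frag_of (a \<otimes>\<^bsub>A\<^esub> c, n))
      \<in> tensor_relations A R \<phi> N"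
    unfolding tensor_relations_def using a add_left by blast
  then show ?case
    using a add_left by (simp add: tensor_op_diff tensor_op_add A.r_distr K_relation)
next
  case (add_right b n n')
  have "frag_of (a \<otimes>\<^bsub>A\<^esub> b, n \<oplus>\<^bsub>N\<^esub> n') - (frag_of (a \<otimes>\<^bsub>A\<^esub> b, n) + frag_of (a \<otimes>\<^bsub>A\<^esub> b, n'))
      \<in> tensor_relations A R \<phi> N"
    unfolding tensor_relations_def using a add_right by blast
  then show ?case
    by (simp add: tensor_op_diff tensor_op_add K_relation)
next
  case (balanced b r n)
  have "frag_of ((a \<otimes>\<^bsub>A\<^esub> b) \<otimes>\<^bsub>A\<^esub> \<phi> r, n) - frag_of (a \<otimes>\<^bsub>A\<^esub> b, r \<odot>\<^bsub>N\<^esub> n) \<in> tensor_relations A R \<phi> N"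
    unfolding tensor_relations_def using a balanced by blast
  then show ?case
    using a balanced \<phi> by (simp add: tensor_op_diff A.m_assoc K_relation)
next
  case zero
  show ?case by (simp add: K_0)
next
  case (minus u)
  then show ?case by (simp add: tensor_op_minus K_minus)
next
  case (add u v)
  then show ?case by (simp add: tensor_op_add K_add)
qed

lemma abelian_subgroup_K: "abelian_subgroup K tensor_premodule"
proof (rule abelian_subgroupI3[OF additive_subgroupI abelian_group_premodule])
  interpret P: abelian_group tensor_premodule by (rule abelian_group_premodule)
  show "subgroup K (add_monoid tensor_premodule)"
  proof (rule P.add.subgroupI)
    show "K \<subseteq> carrier tensor_premodule" using K_carrier by (auto simp: tensor_premodule_def)
    show "K \<noteq> {}" using K_0 by blast
  next
    fix u assume u: "u \<in> K"
    have "\<ominus>\<^bsub>tensor_premodule\<^esub> u = - u"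
      using K_carrier[OF u] by (intro P.minus_equality) (simp_all add: carrier_premodule premodule_add premodule_zero)
    then show "\<ominus>\<^bsub>tensor_premodule\<^esub> u \<in> K" using K_minus[OF u] by simp
  next
    fix u v assume "u \<in> K" "v \<in> K"
    then show "u \<oplus>\<^bsub>tensor_premodule\<^esub> v \<in> K" by (simp add: premodule_add K_add)
  qed
qed

lemma coset_eqI:
  assumes "u - v \<in> K" "u \<in> carrier G" "v \<in> carrier G"
  shows "K +>\<^bsub>tensor_premodule\<^esub> u = K +>\<^bsub>tensor_premodule\<^esub> v"
proof -
  interpret abelian_subgroup K tensor_premodule by (rule abelian_subgroup_K)
  have "u \<in> K +>\<^bsub>tensor_premodule\<^esub> v"
    unfolding a_r_coset_def' premodule_add using assms(1) by (auto intro!: bexI[of _ "u - v"])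
  then show ?thesis
    using a_repr_independence[OF _ _ a_subgroup, of u v] assms(3) by (simp add: tensor_premodule_def)
qed

lemma module_modulo_tensor: "module_modulo A tensor_premodule K"
proof -
  interpret abelian_subgroup K tensor_premodule by (rule abelian_subgroup_K)
  have G: "carrier tensor_premodule = carrier G" by (simp add: tensor_premodule_def)
  have add: "u + v \<in> carrier G" if "u \<in> carrier G" "v \<in> carrier G" for u v
    using that keys_add[of u v] by auto
  have 1: "tensor_op (a \<oplus>\<^bsub>A\<^esub> b) u - (tensor_op a u + tensor_op b u) \<in> K"
    if ab: "a \<in> carrier A" "b \<in> carrier A" and u: "u \<in> carrier G" for a b u
  proof -
    have "Poly_Mapping.keys u \<subseteq> carrier A \<times> carrier N" using u by simp
    then show ?thesis
    proof (induction u rule: frag_induction)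
      case zero
      show ?case by (simp add: K_0)
    next
      case (diff u v)
      from K_diff[OF diff] show ?case by (simp add: tensor_op_diff algebra_simps)
    next
      case (one c)
      then obtain c1 n where c: "c = (c1, n)" "c1 \<in> carrier A" "n \<in> carrier N" by auto
      have "frag_of (a \<otimes>\<^bsub>A\<^esub> c1 \<oplus>\<^bsub>A\<^esub> b \<otimes>\<^bsub>A\<^esub> c1, n)
          - (frag_of (a \<otimes>\<^bsub>A\<^esub> c1, n) + frag_of (b \<otimes>\<^bsub>A\<^esub> c1, n)) \<in> tensor_relations A R \<phi> N"
        unfolding tensor_relations_def using ab c by blast
      then show ?case using ab c by (simp add: A.l_distr K_relation)
    qed
  qed
  have 2: "tensor_op (a \<otimes>\<^bsub>A\<^esub> b) u = tensor_op a (tensor_op b u)"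
    if ab: "a \<in> carrier A" "b \<in> carrier A" and u: "u \<in> carrier G" for a b u
  proof -
    have "Poly_Mapping.keys u \<subseteq> carrier A \<times> carrier N" using u by simp
    then show ?thesis
      by (induction u rule: frag_induction)
        (use ab in \<open>auto simp: tensor_op_diff A.m_assoc\<close>)
  qed
  have 3: "tensor_op \<one>\<^bsub>A\<^esub> u = u" if u: "u \<in> carrier G" for u
  proof -
    have "Poly_Mapping.keys u \<subseteq> carrier A \<times> carrier N" using u by simp
    then show ?thesis
      by (induction u rule: frag_induction) (auto simp: tensor_op_diff)
  qed
  show ?thesis
  proof (intro module_modulo.intro module_modulo_axioms.intro A.ring_axioms abelian_subgroup_K,
      unfold G premodule_smult premodule_add)
    fix a b u v assume a: "a \<in> carrier A" and u: "u \<in> carrier G"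
    show "tensor_op a u \<in> carrier G" using a u by (rule tensor_op_carrier)
    show "tensor_op a (u + v) = tensor_op a u + tensor_op a v" by (rule tensor_op_add)
    assume b: "b \<in> carrier A"
    show "K +>\<^bsub>tensor_premodule\<^esub> tensor_op (a \<oplus>\<^bsub>A\<^esub> b) u
        = K +>\<^bsub>tensor_premodule\<^esub> (tensor_op a u + tensor_op b u)"
      by (intro coset_eqI 1 add tensor_op_carrier A.add.m_closed a b u)
    show "K +>\<^bsub>tensor_premodule\<^esub> tensor_op (a \<otimes>\<^bsub>A\<^esub> b) u
        = K +>\<^bsub>tensor_premodule\<^esub> tensor_op a (tensor_op b u)"
      unfolding 2[OF a b u] by (rule refl)
  next
    fix a u assume "a \<in> carrier A" "u \<in> K"
    then show "tensor_op a u \<in> K" by (rule tensor_op_K)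
  next
    fix u assume u: "u \<in> carrier G"
    show "K +>\<^bsub>tensor_premodule\<^esub> tensor_op \<one>\<^bsub>A\<^esub> u = K +>\<^bsub>tensor_premodule\<^esub> u"
      unfolding 3[OF u] by (rule refl)
  qed
qed

text \<open>A biadditive balanced map extends to the free abelian group and kills all relations. The
  lemma serves to show that tensors do not vanish.\<close>

lemma pure_tensor_vanishes:
  fixes V :: "('v, 'e) ring_scheme"
  assumes V: "abelian_group V"
    and closed: "\<And>a n. \<lbrakk>a \<in> carrier A; n \<in> carrier N\<rbrakk> \<Longrightarrow> f a n \<in> carrier V"
    and add_left: "\<And>a b n. \<lbrakk>a \<in> carrier A; b \<in> carrier A; n \<in> carrier N\<rbrakk> \<Longrightarrow>
        f (a \<oplus>\<^bsub>A\<^esub> b) n = f a n \<oplus>\<^bsub>V\<^esub> f b n"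
    and add_right: "\<And>a n n'. \<lbrakk>a \<in> carrier A; n \<in> carrier N; n' \<in> carrier N\<rbrakk> \<Longrightarrow>
        f a (n \<oplus>\<^bsub>N\<^esub> n') = f a n \<oplus>\<^bsub>V\<^esub> f a n'"
    and balanced: "\<And>a r n. \<lbrakk>a \<in> carrier A; r \<in> carrier R; n \<in> carrier N\<rbrakk> \<Longrightarrow>
        f (a \<otimes>\<^bsub>A\<^esub> \<phi> r) n = f a (r \<odot>\<^bsub>N\<^esub> n)"
    and "frag_of (a, n) \<in> K" "a \<in> carrier A" "n \<in> carrier N"
  shows "f a n = \<zero>\<^bsub>V\<^esub>"
proof -
  interpret V: abelian_group V by (rule V)
  have "(\<lambda>(a, n). f a n) ` (carrier A \<times> carrier N) \<subseteq> carrier (add_monoid V)"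
    using closed by auto
  then obtain k where k: "k \<in> hom G (add_monoid V)"
    and k_of: "\<And>x. x \<in> carrier A \<times> carrier N \<Longrightarrow> k (frag_of x) = (\<lambda>(a, n). f a n) x"
    using comm_group.free_Abelian_group_universal[OF V.a_comm_group] by metis
  interpret k: group_hom G "add_monoid V" k
    using k by (simp add: group_hom_def group_hom_axioms_def V.a_group)
  have k_add: "k (u + v) = k u \<oplus>\<^bsub>V\<^esub> k v" if "u \<in> carrier G" "v \<in> carrier G" for u v
    using k.hom_mult[OF that] by simp
  have k_minus: "k (- u) = \<ominus>\<^bsub>V\<^esub> k u" if "u \<in> carrier G" for u
    using k.hom_inv[OF that] that by (simp add: a_inv_def)
  have k_closed: "k u \<in> carrier V" if "u \<in> carrier G" for u
    using k.hom_closed[OF that] by simp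
  have minus: "- u \<in> carrier G" and add: "u + v \<in> carrier G"
    if "u \<in> carrier G" "v \<in> carrier G" for u v
    using that keys_add[of u v] by auto
  have k_diff: "k (u - v) = k u \<ominus>\<^bsub>V\<^esub> k v" if "u \<in> carrier G" "v \<in> carrier G" for u v
    using k_add[OF that(1) minus[OF that(2,2)]] k_minus[OF that(2)] by (simp add: a_minus_def)
  have of: "frag_of (a, n) \<in> carrier G" and k_of': "k (frag_of (a, n)) = f a n"
    if "a \<in> carrier A" "n \<in> carrier N" for a n
    using that k_of by auto
  have "k u = \<zero>\<^bsub>V\<^esub>" if "u \<in> K" for u
    using that
  proof (induction u rule: K_induct)
    case (add_left a b n)
    then show ?case
      by (simp add: k_diff k_add add of k_of' assms(3) closed V.r_neg a_minus_def
          del: carrier_free_Abelian_group_iff)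
  next
    case (add_right a n n')
    then show ?case
      by (simp add: k_diff k_add add of k_of' assms(4) closed V.r_neg a_minus_def N_add
          del: carrier_free_Abelian_group_iff)
  next
    case (balanced a r n)
    then show ?case
      by (simp add: k_diff of k_of' assms(5)[symmetric] closed V.r_neg a_minus_def N_smult \<phi>
          del: carrier_free_Abelian_group_iff)
  next
    case zero
    show ?case using k.hom_one by simp
  qed (simp_all add: k_minus k_add del: carrier_free_Abelian_group_iff)
  from this[OF assms(6)] show ?thesis using k_of' assms(7,8) by simp
qed

end

section \<open>Modules over the algebra\<close>

lemma ring_A_alg: "ring (A_alg h)"
  unfolding A_alg_def by (rule ideal.quotient_is_ring[OF ideal_A_ideal])

lemma A_class_hom: "ring_hom_ring free_ring (A_alg h) (A_class h)"
proof -
  have "A_class h = (+>\<^bsub>free_ring\<^esub>) (A_ideal h)" by (simp add: A_class_def fun_eq_iff)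
  then show ?thesis unfolding A_alg_def using ideal.rcos_ring_hom_ring[OF ideal_A_ideal] by simp
qed

lemma A_class_carrier [simp]: "A_class h f \<in> carrier (A_alg h)"
  using ring_hom_closed[OF ring_hom_ring.homh[OF A_class_hom], of f h] by (simp add: carrier_free_ring)

lemma A_alg_cases:
  assumes "a \<in> carrier (A_alg h)"
  obtains f where "a = A_class h f"
  using assms by (auto simp: A_alg_def FactRing_def A_RCOSETS_def' A_class_def)

lemma A_class_add: "A_class h (f + g) = A_class h f \<oplus>\<^bsub>A_alg h\<^esub> A_class h g"
  using ring_hom_add[OF ring_hom_ring.homh[OF A_class_hom], of f g h]
  by (simp add: carrier_free_ring) (simp add: ring_of_type_algebra_def)

lemma A_class_mult: "A_class h (f * g) = A_class h f \<otimes>\<^bsub>A_alg h\<^esub> A_class h g"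
  using ring_hom_mult[OF ring_hom_ring.homh[OF A_class_hom], of f g h]
  by (simp add: carrier_free_ring) (simp add: ring_of_type_algebra_def)

lemma A_class_1: "A_class h 1 = \<one>\<^bsub>A_alg h\<^esub>"
  using ring_hom_one[OF ring_hom_ring.homh[OF A_class_hom], of h]
  by (simp add: ring_of_type_algebra_def)

lemma A_class_0: "A_class h 0 = \<zero>\<^bsub>A_alg h\<^esub>"
  using ring_hom_zero[OF ring_hom_ring.homh[OF A_class_hom[of h]] ring_of_ring_1 ring_A_alg]
  by (simp add: ring_of_type_algebra_def)

lemma A_class_minus: "A_class h (- f) = \<ominus>\<^bsub>A_alg h\<^esub> A_class h f"
proof -
  interpret ring "A_alg h" by (rule ring_A_alg)
  have "A_class h (- f) \<oplus>\<^bsub>A_alg h\<^esub> A_class h f = \<zero>\<^bsub>A_alg h\<^esub>"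
    by (simp add: A_class_add[symmetric] A_class_0)
  then show ?thesis using minus_equality[of "A_class h (- f)" "A_class h f"] by simp
qed

lemma A_class_diff: "A_class h (f - g) = A_class h f \<ominus>\<^bsub>A_alg h\<^esub> A_class h g"
  using A_class_add[of h f "- g"] by (simp add: A_class_minus a_minus_def)

lemma A_class_power: "A_class h (f ^ n) = A_class h f [^]\<^bsub>A_alg h\<^esub> n"
proof -
  interpret ring "A_alg h" by (rule ring_A_alg)
  show ?thesis by (induction n) (simp_all add: A_class_1 A_class_mult power_Suc2 del: power_Suc)
qed

lemma A_class_eq_0: "f \<in> A_ideal h \<Longrightarrow> A_class h f = \<zero>\<^bsub>A_alg h\<^esub>"
proof -
  assume "f \<in> A_ideal h"
  interpret ring "free_ring :: 'a free_alg ring" by (rule ring_of_ring_1)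
  have "A_class h f = A_ideal h"
    unfolding A_class_def
    using a_coset_join2[OF _ additive_subgroup.a_subgroup[OF ideal.axioms(1)[OF ideal_A_ideal]]
        \<open>f \<in> A_ideal h\<close>]
    by (simp add: carrier_free_ring)
  then show ?thesis by (simp add: A_alg_def FactRing_def)
qed

lemma A_class_eqI: "f - g \<in> A_ideal h \<Longrightarrow> A_class h f = A_class h g"
proof -
  assume "f - g \<in> A_ideal h"
  interpret ring "A_alg h" by (rule ring_A_alg)
  have "A_class h f = A_class h (f - g) \<oplus>\<^bsub>A_alg h\<^esub> A_class h g"
    by (simp add: A_class_add[symmetric])
  then show ?thesis using A_class_eq_0[OF \<open>f - g \<in> A_ideal h\<close>] by simp
qed

lemma z_elem_eq: "z_elem h p \<beta> = A_class h (z_free h p \<beta>)"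
  by (simp add: z_elem_def z_free_def A_class_diff A_class_power A_class_mult A_y_def A_poly_def A_const_def)

lemma g_elem_eq: "g_elem h \<theta> = A_class h (fy - free_const \<theta>)"
  by (simp add: g_elem_def A_class_diff A_y_def A_const_def)

lemma z_elem_in_center:
  fixes h :: "'a::field poly"
  assumes "CHAR('a) = p" "p > 0" "h \<noteq> 0"
  shows "z_elem h p \<beta> \<in> ring_center (A_alg h)"
proof -
  have "A_class h (z_free h p \<beta>) \<otimes>\<^bsub>A_alg h\<^esub> A_class h f = A_class h f \<otimes>\<^bsub>A_alg h\<^esub> A_class h (z_free h p \<beta>)" for f
    unfolding A_class_mult[symmetric] by (rule A_class_eqI[OF z_free_central[OF assms]])
  then show ?thesis
    unfolding ring_center_def z_elem_eq by (auto elim!: A_alg_cases)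
qed

locale ore_module = M: left_module "A_alg h" M
  for h :: "'a::field poly" and M :: "('a ore, 'v, 'm) module_scheme" (structure)
begin

text \<open>The free algebra acts through its quotient, so that annihilators become left ideals in
  the sense of \<open>ore_left_ideal\<close>.\<close>

definition act :: "'a free_alg \<Rightarrow> 'v \<Rightarrow> 'v" where
  "act f v = A_class h f \<odot>\<^bsub>M\<^esub> v"

lemma act_closed [simp]: "v \<in> carrier M \<Longrightarrow> act f v \<in> carrier M"
  by (simp add: act_def M.smult_closed)

lemma act_add: "v \<in> carrier M \<Longrightarrow> act (f + g) v = act f v \<oplus>\<^bsub>M\<^esub> act g v"
  by (simp add: act_def A_class_add M.smult_l_distr)

lemma act_mult: "v \<in> carrier M \<Longrightarrow> act (f * g) v = act f (act g v)"
  by (simp add: act_def A_class_mult M.smult_assoc)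

lemma act_1 [simp]: "v \<in> carrier M \<Longrightarrow> act 1 v = v"
  by (simp add: act_def A_class_1 M.smult_one)

lemma act_0 [simp]: "v \<in> carrier M \<Longrightarrow> act 0 v = \<zero>\<^bsub>M\<^esub>"
  using act_add[of v 0 0] M.add.l_cancel_one'[of "act 0 v" "act 0 v"] by simp

lemma act_zero_right [simp]: "act f \<zero>\<^bsub>M\<^esub> = \<zero>\<^bsub>M\<^esub>"
  using act_mult[of "\<zero>\<^bsub>M\<^esub>" f 0] by simp

lemma act_minus: "v \<in> carrier M \<Longrightarrow> act (- f) v = \<ominus>\<^bsub>M\<^esub> act f v"
  using act_add[of v "- f" f] M.minus_equality[of "act (- f) v" "act f v"] by simp

lemma act_eq_iff: "v \<in> carrier M \<Longrightarrow> act f v = act g v \<longleftrightarrow> act (f - g) v = \<zero>\<^bsub>M\<^esub>"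
proof -
  assume v: "v \<in> carrier M"
  have "act (f - g) v = act f v \<ominus>\<^bsub>M\<^esub> act g v"
    using act_add[OF v, of f "- g"] by (simp add: act_minus[OF v] a_minus_def)
  then have "act f v = act g v \<Longrightarrow> act (f - g) v = \<zero>\<^bsub>M\<^esub>"
    using v by (simp add: a_minus_def M.M.r_neg)
  moreover have "act f v = act (f - g) v \<oplus>\<^bsub>M\<^esub> act g v" using act_add[OF v, of "f - g" g] by simp
  ultimately show ?thesis using v by fastforce
qed

definition ann :: "'v \<Rightarrow> 'a free_alg set" where
  "ann v = {f. act f v = \<zero>\<^bsub>M\<^esub>}"

lemma ore_left_ideal_ann:
  assumes v: "v \<in> carrier M"
  shows "ore_left_ideal h (ann v)"
proof
  show "A_ideal h \<subseteq> ann v"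
  proof
    fix f assume "f \<in> A_ideal h"
    then have "act f v = act 0 v" by (simp only: act_def A_class_eq_0 A_class_0)
    then show "f \<in> ann v" using v by (simp add: ann_def)
  qed
qed (use v in \<open>simp_all add: ann_def act_add act_mult\<close>)

lemma act_sum:
  assumes "v \<in> carrier M" "finite A"
  shows "act (\<Sum>i\<in>A. F i) v = (\<Oplus>\<^bsub>M\<^esub>i\<in>A. act (F i) v)"
  using assms(2)
proof (induction A rule: finite_induct)
  case (insert i A)
  then show ?case using assms(1) by (simp add: act_add M.finsum_insert)
qed (simp add: assms(1))

lemma submoduleI':
  assumes N: "N \<subseteq> carrier M" "N \<noteq> {}"
    and add: "\<And>v w. v \<in> N \<Longrightarrow> w \<in> N \<Longrightarrow> v \<oplus>\<^bsub>M\<^esub> w \<in> N" and act: "\<And>f v. v \<in> N \<Longrightarrow> act f v \<in> N"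
  shows "submodule N (A_alg h) M"
proof (intro submodule.intro submodule_axioms.intro)
  show "subgroup N (add_monoid M)"
  proof (rule M.add.subgroupI)
    fix v assume v: "v \<in> N"
    then have "\<ominus>\<^bsub>M\<^esub> v = act (- 1) v" using N act_minus[of v 1] by auto
    then show "\<ominus>\<^bsub>M\<^esub> v \<in> N" using act[OF v] by simp
  qed (use N add in auto)
qed (use act in \<open>auto simp: act_def elim!: A_alg_cases\<close>)

definition generator :: "'v \<Rightarrow> bool" where
  "generator v \<longleftrightarrow> v \<in> carrier M \<and> carrier M = range (\<lambda>f. act f v)"

lemma irreducible_generator:
  assumes irr: "irreducible_module (A_alg h) M" and v: "v \<in> carrier M" "v \<noteq> \<zero>\<^bsub>M\<^esub>"
  shows "generator v"
proof -
  have "submodule (range (\<lambda>f. act f v)) (A_alg h) M"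
    by (rule submoduleI') (use v in \<open>auto simp: act_add[symmetric] act_mult[symmetric]\<close>)
  moreover have "v \<in> range (\<lambda>f. act f v)" using v by (metis act_1 rangeI)
  ultimately show ?thesis using irr v unfolding irreducible_module_def generator_def by auto
qed

lemma ann_act: "v \<in> carrier M \<Longrightarrow> ann (act f v) = {g. g * f \<in> ann v}"
  by (simp add: ann_def act_mult)

end

text \<open>Every nonzero vector generates, in particular \<open>f v\<close>, so \<open>v\<close> is
  a multiple of it. These are the axioms of \<open>ore_maximal_left_ideal\<close>.\<close>

lemma (in ore_module) irreducible_ann:
  assumes irr: "irreducible_module (A_alg h) M" and v: "v \<in> carrier M" "v \<noteq> \<zero>\<^bsub>M\<^esub>"
  shows "1 \<notin> ann v" and "f \<notin> ann v \<Longrightarrow> \<exists>g. g * f - 1 \<in> ann v"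
proof -
  show "1 \<notin> ann v" using v by (simp add: ann_def)
  assume "f \<notin> ann v"
  then have "act f v \<noteq> \<zero>\<^bsub>M\<^esub>" by (simp add: ann_def)
  then have "generator (act f v)" using irreducible_generator[OF irr] v by simp
  then obtain g where "v = act g (act f v)" using v unfolding generator_def by blast
  then have "act (g * f) v = act 1 v" using v by (simp add: act_mult)
  then have "g * f - 1 \<in> ann v" unfolding act_eq_iff[OF v(1)] by (simp add: ann_def)
  then show "\<exists>g. g * f - 1 \<in> ann v" ..
qed

text \<open>Sending \<open>f m\<close> to \<open>f n\<close> is well defined and injective because
  the annihilators agree; the choice of \<open>f\<close> inside \<open>F\<close> is therefore
  immaterial.\<close>

lemma cyclic_modules_isomorphic:
  assumes M: "ore_module h M" and N: "ore_module h N"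
    and m: "ore_module.generator h M m" and n: "ore_module.generator h N n"
    and eq: "ore_module.ann h M m = ore_module.ann h N n"
  shows "module_isomorphic (A_alg h) M N"
proof -
  interpret M: ore_module h M by (rule M)
  interpret N: ore_module h N by (rule N)
  have mc: "m \<in> carrier M" and M_eq: "carrier M = range (\<lambda>f. M.act f m)"
    using m by (auto simp: M.generator_def)
  have nc: "n \<in> carrier N" and N_eq: "carrier N = range (\<lambda>f. N.act f n)"
    using n by (auto simp: N.generator_def)
  have iff: "M.act f m = M.act g m \<longleftrightarrow> N.act f n = N.act g n" for f g
    using eq by (auto simp: M.act_eq_iff[OF mc] N.act_eq_iff[OF nc] M.ann_def N.ann_def)
  define F where "F v = N.act (SOME f. M.act f m = v) n" for v
  have F: "F (M.act f m) = N.act f n" for f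
    using someI[of "\<lambda>g. M.act g m = M.act f m" f] by (simp add: F_def iff)
  have "F \<in> iso (add_monoid M) (add_monoid N)"
  proof (intro isoI homI)
    show "bij_betw F (carrier (add_monoid M)) (carrier (add_monoid N))"
      by (auto simp: bij_betw_def inj_on_def M_eq N_eq F iff image_iff)
  next
    fix v w assume "v \<in> carrier (add_monoid M)" "w \<in> carrier (add_monoid M)"
    then obtain f g where "v = M.act f m" "w = M.act g m" by (auto simp: M_eq)
    then show "F (v \<otimes>\<^bsub>add_monoid M\<^esub> w) = F v \<otimes>\<^bsub>add_monoid N\<^esub> F w"
      by (simp add: F M.act_add[OF mc, symmetric] N.act_add[OF nc, symmetric])
  qed (auto simp: M_eq N_eq F)
  moreover have "F (a \<odot>\<^bsub>M\<^esub> v) = a \<odot>\<^bsub>N\<^esub> F v" if "a \<in> carrier (A_alg h)" "v \<in> carrier M" for a v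
  proof -
    obtain f where "a = A_class h f" using \<open>a \<in> _\<close> by (rule A_alg_cases)
    moreover obtain g where "v = M.act g m" using \<open>v \<in> _\<close> by (auto simp: M_eq)
    ultimately have "a \<odot>\<^bsub>M\<^esub> v = M.act (f * g) m" "a \<odot>\<^bsub>N\<^esub> F v = N.act (f * g) n"
      by (simp_all add: M.act_mult[OF mc] N.act_mult[OF nc] F) (simp_all add: M.act_def N.act_def)
    then show ?thesis by (simp add: F)
  qed
  ultimately show ?thesis unfolding module_isomorphic_def by blast
qed

lemma annihilator_isomorphic:
  assumes M: "left_module R M" and N: "left_module R N" and iso: "module_isomorphic R M N"
  shows "annihilator R M = annihilator R N"
proof -
  interpret M: left_module R M by (rule M)
  interpret N: left_module R N by (rule N)
  obtain F where F: "F \<in> iso (add_monoid M) (add_monoid N)"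
    and lin: "\<And>a v. \<lbrakk>a \<in> carrier R; v \<in> carrier M\<rbrakk> \<Longrightarrow> F (a \<odot>\<^bsub>M\<^esub> v) = a \<odot>\<^bsub>N\<^esub> F v"
    using iso unfolding module_isomorphic_def by blast
  interpret F: group_hom "add_monoid M" "add_monoid N" F
    using F by (simp add: group_hom_def group_hom_axioms_def M.a_group N.a_group iso_def)
  have bij: "bij_betw F (carrier M) (carrier N)" using F by (simp add: iso_def)
  have F0: "F \<zero>\<^bsub>M\<^esub> = \<zero>\<^bsub>N\<^esub>" using F.hom_one by simp
  have zero: "F v = \<zero>\<^bsub>N\<^esub> \<longleftrightarrow> v = \<zero>\<^bsub>M\<^esub>" if "v \<in> carrier M" for v
    using inj_on_eq_iff[OF bij_betw_imp_inj_on[OF bij] that M.M.zero_closed] by (simp only: F0)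
  have surj: "carrier N = F ` carrier M" using bij by (simp add: bij_betw_def)
  show ?thesis
  proof (intro equalityI subsetI)
    fix a assume "a \<in> annihilator R M"
    then have a: "a \<in> carrier R" and "\<And>v. v \<in> carrier M \<Longrightarrow> a \<odot>\<^bsub>M\<^esub> v = \<zero>\<^bsub>M\<^esub>"
      by (auto simp: annihilator_def)
    then have "a \<odot>\<^bsub>N\<^esub> F v = \<zero>\<^bsub>N\<^esub>" if "v \<in> carrier M" for v
      using lin[OF a that] that by (simp add: F0)
    then show "a \<in> annihilator R N" using a by (auto simp: annihilator_def surj)
  next
    fix a assume "a \<in> annihilator R N"
    then have a: "a \<in> carrier R" and "\<And>v. v \<in> carrier M \<Longrightarrow> a \<odot>\<^bsub>N\<^esub> F v = \<zero>\<^bsub>N\<^esub>"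
      by (auto simp: annihilator_def surj)
    then have "a \<odot>\<^bsub>M\<^esub> v = \<zero>\<^bsub>M\<^esub>" if "v \<in> carrier M" for v
      using zero[OF M.smult_closed[OF a that]] lin[OF a that] that by simp
    then show "a \<in> annihilator R M" using a by (auto simp: annihilator_def)
  qed
qed

text \<open>\<open>normalizes\<close> makes \<open>e M\<close> a submodule. It is immediate for the
  central \<open>z\<close>; for \<open>y - \<theta>\<close> at a root of \<open>h\<close> it is
  \<open>g_normalizes\<close>.\<close>

locale ore_quotient = M: ore_module h M
  for h :: "'a::field poly" and M :: "('a ore, 'v, 'm) module_scheme" (structure) +
  fixes m and e :: "'a free_alg"
  assumes gen: "M.generator m"
    and normalizes: "\<exists>f'. a * (e * f) - e * f' \<in> M.ann m"
begin

definition "N = (\<lambda>u. A_class h e \<odot>\<^bsub>M\<^esub> u) ` carrier M"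

lemma m: "m \<in> carrier M" and carrier_eq: "carrier M = range (\<lambda>f. M.act f m)"
  using gen by (auto simp: M.generator_def)

lemma N_eq: "N = range (\<lambda>f. M.act (e * f) m)"
  by (simp add: N_def carrier_eq image_image M.act_mult[OF m] M.act_def[of e])

lemma submodule_N: "submodule N (A_alg h) M"
proof (rule M.submoduleI')
  fix v w assume "v \<in> N" "w \<in> N"
  then obtain f g where "v = M.act (e * f) m" "w = M.act (e * g) m" by (auto simp: N_eq)
  then have "v \<oplus>\<^bsub>M\<^esub> w = M.act (e * (f + g)) m" by (simp add: distrib_left M.act_add[OF m])
  then show "v \<oplus>\<^bsub>M\<^esub> w \<in> N" by (simp add: N_eq)
next
  fix a v assume "v \<in> N"
  then obtain f where v: "v = M.act (e * f) m" by (auto simp: N_eq)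
  obtain f' where "a * (e * f) - e * f' \<in> M.ann m" using normalizes by blast
  then have "M.act a v = M.act (e * f') m"
    unfolding v M.act_mult[OF m, symmetric] M.act_eq_iff[OF m] by (simp add: M.ann_def)
  then show "M.act a v \<in> N" by (simp add: N_eq)
qed (use m in \<open>auto simp: N_eq\<close>)

sublocale Q: module_modulo "A_alg h" M N
  by (rule M.M.module_modulo_submodule[OF submodule_N])

abbreviation "Q \<equiv> quotient_module M N"

sublocale Q: ore_module h Q
  by (rule ore_module.intro) (rule Q.left_module_quotient)

abbreviation "q \<equiv> N +>\<^bsub>M\<^esub> m"

lemma Q_act: "Q.act f q = N +>\<^bsub>M\<^esub> M.act f m"
  by (simp add: Q.act_def M.act_def Q.quotient_smult m)

lemma Q_generator: "Q.generator q"
proof -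
  have "carrier Q = range (\<lambda>f. N +>\<^bsub>M\<^esub> M.act f m)"
    unfolding Q.quotient_carrier carrier_eq by (simp add: image_image)
  moreover have "N +>\<^bsub>M\<^esub> m \<in> carrier Q"
    unfolding Q.quotient_carrier using m by blast
  ultimately show ?thesis unfolding Q.generator_def Q_act by simp
qed

lemma Q_ann: "f \<in> Q.ann q \<longleftrightarrow> (\<exists>g. f - e * g \<in> M.ann m)"
proof -
  have "f \<in> Q.ann q \<longleftrightarrow> M.act f m \<in> N"
    by (simp add: Q.ann_def Q_act Q.coset_eq_zero_iff m)
  also have "\<dots> \<longleftrightarrow> (\<exists>g. M.act f m = M.act (e * g) m)" by (auto simp: N_eq)
  finally show ?thesis by (simp add: M.act_eq_iff[OF m] M.ann_def)
qed

end

section \<open>One-dimensional modules\<close>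

definition eval_word :: "'a::field \<Rightarrow> 'a \<Rightarrow> word \<Rightarrow> 'a" where
  "eval_word \<mu> \<theta> w = prod_list (map (case_gen \<mu> \<theta>) (letters w))"

lemma eval_word_add: "eval_word \<mu> \<theta> (v + w) = eval_word \<mu> \<theta> v * eval_word \<mu> \<theta> w"
  by (simp add: eval_word_def plus_word_def)

lemma free_eval_altdef:
  assumes "finite A" "Poly_Mapping.keys f \<subseteq> A"
  shows "free_eval \<mu> \<theta> f = (\<Sum>w\<in>A. Poly_Mapping.lookup f w * eval_word \<mu> \<theta> w)"
  unfolding free_eval_def eval_word_def
  by (rule sum.mono_neutral_left) (use assms in \<open>auto simp: in_keys_iff\<close>)

lemma free_eval_add: "free_eval \<mu> \<theta> (f + g) = free_eval \<mu> \<theta> f + free_eval \<mu> \<theta> g"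
proof -
  let ?A = "Poly_Mapping.keys f \<union> Poly_Mapping.keys g"
  have "Poly_Mapping.keys (f + g) \<subseteq> ?A" by (rule keys_add)
  then show ?thesis
    by (simp add: free_eval_altdef[of ?A] lookup_add distrib_right sum.distrib)
qed

lemma free_eval_single: "free_eval \<mu> \<theta> (Poly_Mapping.single w c) = c * eval_word \<mu> \<theta> w"
  by (subst free_eval_altdef[of "{w}"]) auto

lemma free_eval_mult: "free_eval \<mu> \<theta> (f * g) = free_eval \<mu> \<theta> f * free_eval \<mu> \<theta> g"
proof (induction f rule: poly_mapping_single_induct)
  case (single w c)
  show ?case
    by (induction g rule: poly_mapping_single_induct)
      (simp_all add: mult_single free_eval_single eval_word_add distrib_left free_eval_add)
qed (simp add: distrib_right free_eval_add)

lemma free_eval_const: "free_eval \<mu> \<theta> (free_const c) = c"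
  by (simp add: free_const_def free_eval_single eval_word_def zero_word_def)

lemma free_eval_1: "free_eval \<mu> \<theta> 1 = 1"
  using free_eval_const[of \<mu> \<theta> 1] by simp

lemma free_eval_0: "free_eval \<mu> \<theta> 0 = 0"
  using free_eval_const[of \<mu> \<theta> 0] by simp

lemma free_eval_diff: "free_eval \<mu> \<theta> (f - g) = free_eval \<mu> \<theta> f - free_eval \<mu> \<theta> g"
  using free_eval_add[of \<mu> \<theta> "f - g" g] by simp

lemma free_eval_fx: "free_eval \<mu> \<theta> fx = \<mu>"
  by (simp add: fx_def free_eval_single eval_word_def)

lemma free_eval_fy: "free_eval \<mu> \<theta> fy = \<theta>"
  by (simp add: fy_def free_eval_single eval_word_def)

lemma free_eval_free_poly: "free_eval \<mu> \<theta> (free_poly r) = poly r \<mu>"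
  by (induction r)
    (simp_all add: free_poly_eq_ev ev_pCons free_eval_add free_eval_mult free_eval_const free_eval_fx free_eval_0)

text \<open>The defining relation evaluates to \<open>- h(\<mu>)\<close>, so at a root of
  \<open>h\<close> the kernel of the evaluation is an ideal that contains it.\<close>

lemma free_eval_A_ideal:
  assumes "poly h \<mu> = 0" "f \<in> A_ideal h"
  shows "free_eval \<mu> \<theta> f = 0"
proof -
  have "ring_hom_ring free_ring (ring_of_type_algebra :: 'a ring) (free_eval \<mu> \<theta>)"
    by (rule ring_hom_ringI2[OF ring_of_ring_1 ring_of_ring_1])
      (auto simp: ring_hom_def ring_of_type_algebra_def free_eval_add free_eval_mult free_eval_1)
  then have "ideal (a_kernel free_ring (ring_of_type_algebra :: 'a ring) (free_eval \<mu> \<theta>)) free_ring"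
    by (rule ring_hom_ring.kernel_is_ideal)
  moreover have "{fy * fx - (fx * fy + free_poly h)} \<subseteq> a_kernel free_ring (ring_of_type_algebra :: 'a ring) (free_eval \<mu> \<theta>)"
    using assms(1)
    by (simp add: a_kernel_def' ring_of_type_algebra_def free_eval_diff free_eval_add free_eval_mult
        free_eval_fx free_eval_fy free_eval_free_poly)
  ultimately have "A_ideal h \<subseteq> a_kernel free_ring (ring_of_type_algebra :: 'a ring) (free_eval \<mu> \<theta>)"
    unfolding A_ideal_def by (rule ring.genideal_minimal[OF ring_of_ring_1])
  then show ?thesis using assms(2) by (auto simp: a_kernel_def' ring_of_type_algebra_def)
qed

lemma V_module_smult:
  assumes "poly h \<mu> = 0"
  shows "A_class h f \<odot>\<^bsub>V_module \<mu> \<theta>\<^esub> c = free_eval \<mu> \<theta> f * c"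
proof -
  have "A_class h f = {i + f | i. i \<in> A_ideal h}"
    by (auto simp: A_class_def a_r_coset_def' ring_of_type_algebra_def)
  moreover have "0 \<in> A_ideal h" using ore_left_ideal.J_0[OF ore_left_ideal_A_ideal] by blast
  ultimately have "free_eval \<mu> \<theta> ` A_class h f = {free_eval \<mu> \<theta> f}"
    by (auto simp: free_eval_add free_eval_A_ideal[OF assms] image_iff intro!: exI[of _ f] exI[of _ 0])
  then show ?thesis by (simp add: V_module_def)
qed

lemma ore_module_V_module:
  assumes "poly h \<mu> = 0"
  shows "ore_module h (V_module \<mu> \<theta>)"
proof (intro ore_module.intro left_module.intro left_module_axioms.intro ring_A_alg)
  show "abelian_group (V_module \<mu> \<theta>)"
  proof (rule abelian_groupI)
    fix c assume "c \<in> carrier (V_module \<mu> \<theta>)"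
    show "\<exists>d\<in>carrier (V_module \<mu> \<theta>). d \<oplus>\<^bsub>V_module \<mu> \<theta>\<^esub> c = \<zero>\<^bsub>V_module \<mu> \<theta>\<^esub>"
      by (intro bexI[of _ "- c"]) (simp_all add: V_module_def)
  qed (simp_all add: V_module_def algebra_simps)
qed (auto elim!: A_alg_cases simp: V_module_smult[OF assms] A_class_add[symmetric] A_class_mult[symmetric]
      A_class_1[symmetric] free_eval_add free_eval_mult free_eval_1 V_module_smult[OF assms],
    auto simp: V_module_def algebra_simps)

lemma V_module_props:
  assumes "poly h \<mu> = 0"
  shows "ore_module.generator h (V_module \<mu> \<theta>) 1"
    and "ore_module.ann h (V_module \<mu> \<theta>) 1 = {f. free_eval \<mu> \<theta> f = 0}"
    and "field_basis h (V_module \<mu> \<theta>) 1 (\<lambda>_. 1)"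
    and "A_x h \<odot>\<^bsub>V_module \<mu> \<theta>\<^esub> 1 = A_const h \<mu> \<odot>\<^bsub>V_module \<mu> \<theta>\<^esub> 1"
    and "A_y h \<odot>\<^bsub>V_module \<mu> \<theta>\<^esub> 1 = A_const h \<theta> \<odot>\<^bsub>V_module \<mu> \<theta>\<^esub> 1"
proof -
  interpret V: ore_module h "V_module \<mu> \<theta>" by (rule ore_module_V_module[OF assms])
  have car: "carrier (V_module \<mu> \<theta>) = UNIV" by (simp add: V_module_def)
  have act: "V.act f c = free_eval \<mu> \<theta> f * c" for f c
    by (simp add: V.act_def V_module_smult[OF assms])
  have "c = free_eval \<mu> \<theta> (free_const c)" for c by (simp add: free_eval_const)
  then show "V.generator 1" unfolding V.generator_def car act by (auto simp: image_iff)
  show "V.ann 1 = {f. free_eval \<mu> \<theta> f = 0}" by (simp add: V.ann_def act) (simp add: V_module_def)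
  show "A_x h \<odot>\<^bsub>V_module \<mu> \<theta>\<^esub> 1 = A_const h \<mu> \<odot>\<^bsub>V_module \<mu> \<theta>\<^esub> 1"
    by (simp add: A_x_def A_const_def V_module_smult[OF assms] free_eval_fx free_eval_const)
  show "A_y h \<odot>\<^bsub>V_module \<mu> \<theta>\<^esub> 1 = A_const h \<theta> \<odot>\<^bsub>V_module \<mu> \<theta>\<^esub> 1"
    by (simp add: A_y_def A_const_def V_module_smult[OF assms] free_eval_fy free_eval_const)
  have sum: "(\<Oplus>\<^bsub>V_module \<mu> \<theta>\<^esub>i\<in>{..<1::nat}. A_const h (c i) \<odot>\<^bsub>V_module \<mu> \<theta>\<^esub> 1) = c 0" for c
    by (simp add: lessThan_Suc V.M.M.finsum_insert car A_const_def V_module_smult[OF assms] free_eval_const V.M.M.r_zero[unfolded car])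
  have "bij_betw (\<lambda>c. c (0::nat)) ({..<1} \<rightarrow>\<^sub>E (UNIV :: 'a set)) UNIV"
  proof (rule bij_betwI[where g = "\<lambda>a i. if i = 0 then a else undefined"])
    fix c assume "c \<in> {..<1::nat} \<rightarrow>\<^sub>E (UNIV :: 'a set)"
    then show "(\<lambda>i. if i = 0 then c 0 else undefined) = c"
      by (auto simp: PiE_def extensional_def)
  qed (auto simp: PiE_def extensional_def)
  then show "field_basis h (V_module \<mu> \<theta>) 1 (\<lambda>_. 1)"
    unfolding field_basis_def sum by (simp add: car)
qed

section \<open>The module \<open>U(\<mm>)\<close>\<close>

locale U_data =
  fixes h :: "'a::field poly" and \<mu> :: 'a
begin

abbreviation "\<mm> \<equiv> max_ideal \<mu>"
abbreviation "R\<mm> \<equiv> quotient_ring_module poly_ring_R \<mm>"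
abbreviation "coset r \<equiv> \<mm> +>\<^bsub>poly_ring_R\<^esub> r"

lemma ideal_\<mm>: "ideal \<mm> poly_ring_R"
  unfolding max_ideal_def
  by (rule cring.cgenideal_ideal[OF cring_from_type_algebra]) (simp add: carrier_free_ring)

lemma coset_eq: "coset r = {s * [:- \<mu>, 1:] + r | s. True}"
  by (auto simp: a_r_coset_def' max_ideal_def cgenideal_def ring_of_type_algebra_def)

lemma coset_eqI: "poly r \<mu> = poly s \<mu> \<Longrightarrow> coset r = coset s"
proof -
  assume "poly r \<mu> = poly s \<mu>"
  then have "poly (r - s) \<mu> = 0" by simp
  then obtain t where t: "r = t * [:- \<mu>, 1:] + s"
    by (auto simp only: poly_eq_0_iff_dvd dvd_def) (metis diff_eq_eq mult.commute)
  have "u * [:- \<mu>, 1:] + r = (u + t) * [:- \<mu>, 1:] + s"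
    "u * [:- \<mu>, 1:] + s = (u - t) * [:- \<mu>, 1:] + r" for u
    unfolding t by (simp_all only: algebra_simps)
  then show ?thesis unfolding coset_eq by blast
qed

lemma carrier_R\<mm>: "carrier R\<mm> = range coset"
  by (simp add: quotient_ring_module_def FactRing_def A_RCOSETS_def' carrier_free_ring) blast

lemma R\<mm>_add: "coset r \<oplus>\<^bsub>R\<mm>\<^esub> coset s = coset (r + s)"
proof -
  interpret ideal \<mm> poly_ring_R by (rule ideal_\<mm>)
  show ?thesis
    using a_rcos_sum[of r s]
    by (simp add: quotient_ring_module_def FactRing_def carrier_free_ring)
      (simp add: ring_of_type_algebra_def)
qed

lemma R\<mm>_smult: "r \<odot>\<^bsub>R\<mm>\<^esub> coset s = coset (r * s)"
proof -
  interpret ideal \<mm> poly_ring_R by (rule ideal_\<mm>)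
  show ?thesis
    using rcoset_mult_add[of r s]
    by (simp add: quotient_ring_module_def FactRing_def carrier_free_ring)
      (simp add: ring_of_type_algebra_def)
qed

text \<open>The identification of the residue field with \<open>F\<close>; multiples of
  \<open>X - \<mu>\<close> vanish at \<open>\<mu>\<close>, so every representative gives the same
  value.\<close>

definition coset_value :: "'a poly set \<Rightarrow> 'a" where
  "coset_value C = poly (SOME r. r \<in> C) \<mu>"

lemma coset_value: "coset_value (coset r) = poly r \<mu>"
proof -
  have "r \<in> coset r" unfolding coset_eq by (auto intro!: exI[of _ 0])
  then have "(SOME s. s \<in> coset r) \<in> coset r" by (rule someI)
  then show ?thesis by (auto simp: coset_value_def coset_eq)
qed

sublocale T: tensor_data "A_alg h" poly_ring_R "A_poly h" R\<mm>
proof (intro tensor_data.intro tensor_data_axioms.intro ring_A_alg)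
  show "A_poly h r \<in> carrier (A_alg h)" for r by (simp add: A_poly_def)
next
  fix n n' assume "n \<in> carrier R\<mm>" "n' \<in> carrier R\<mm>"
  then show "n \<oplus>\<^bsub>R\<mm>\<^esub> n' \<in> carrier R\<mm>" by (auto simp: carrier_R\<mm> R\<mm>_add)
next
  fix r n assume "n \<in> carrier R\<mm>"
  then show "r \<odot>\<^bsub>R\<mm>\<^esub> n \<in> carrier R\<mm>" by (auto simp: carrier_R\<mm> R\<mm>_smult)
qed

abbreviation "U \<equiv> U_module h \<mm>"
abbreviation "u \<equiv> u_gen h \<mm>"

lemma U_eq: "U = quotient_module T.tensor_premodule T.K"
  by (simp add: U_module_def T.tensor_module_eq)

sublocale P: module_modulo "A_alg h" T.tensor_premodule T.K
  by (rule T.module_modulo_tensor)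

sublocale U: ore_module h U
  unfolding U_eq by (rule ore_module.intro) (rule P.left_module_quotient)

definition pure :: "'a free_alg \<Rightarrow> 'a poly \<Rightarrow> 'a U_carrier" where
  "pure f r = T.K +>\<^bsub>T.tensor_premodule\<^esub> frag_of (A_class h f, coset r)"

lemma frag_carrier: "frag_of (A_class h f, coset r) \<in> carrier T.tensor_premodule"
  by (simp add: T.carrier_premodule carrier_R\<mm>)

lemma u_eq: "u = pure 1 1"
  by (simp add: u_gen_def T.pure_tensor_eq pure_def A_class_1)

lemma act_pure: "U.act f (pure g r) = pure (f * g) r"
  unfolding U.act_def pure_def
  by (simp add: U_eq P.quotient_smult frag_carrier T.premodule_smult A_class_mult)

lemma act_u: "U.act f u = pure f 1"
  by (simp add: u_eq act_pure)

lemma pure_balanced: "pure f r = pure (f * free_poly r) 1"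
proof -
  have "frag_of (A_class h f \<otimes>\<^bsub>A_alg h\<^esub> A_poly h r, coset 1) - frag_of (A_class h f, r \<odot>\<^bsub>R\<mm>\<^esub> coset 1) \<in> T.K"
  proof (rule T.K_relation, unfold tensor_relations_def, rule UnI2, intro CollectI exI conjI)
    show "A_class h f \<in> carrier (A_alg h)" by simp
    show "r \<in> carrier poly_ring_R" by (simp add: carrier_free_ring)
    show "coset 1 \<in> carrier R\<mm>" by (simp add: carrier_R\<mm>)
  qed simp
  then have "frag_of (A_class h (f * free_poly r), coset 1) - frag_of (A_class h f, coset r) \<in> T.K"
    by (simp add: A_class_mult A_poly_def R\<mm>_smult)
  then show ?thesis
    unfolding pure_def by (intro T.coset_eqI[symmetric]) (simp_all add: carrier_R\<mm>)
qed

lemma u_carrier: "u \<in> carrier U"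
  unfolding U_eq P.quotient_carrier u_eq pure_def using frag_carrier by blast

text \<open>Balancing moves the polynomial of an elementary tensor to the left factor, which makes
  the tensor a multiple of \<open>u\<close>.\<close>

lemma generator_u: "U.generator u"
proof -
  have "carrier U \<subseteq> range (\<lambda>f. U.act f u)"
  proof
    fix c assume "c \<in> carrier U"
    then obtain g where c: "c = T.K +>\<^bsub>T.tensor_premodule\<^esub> g" and "g \<in> carrier T.tensor_premodule"
      by (auto simp: U_eq P.quotient_carrier)
    then have "Poly_Mapping.keys g \<subseteq> carrier (A_alg h) \<times> carrier R\<mm>" by (simp add: T.carrier_premodule)
    \<comment> \<open>Membership in the carrier is part of the claim because the step for
      differences has to add cosets.\<close>
    then have "\<exists>f. T.K +>\<^bsub>T.tensor_premodule\<^esub> g = U.act f u \<and> g \<in> carrier T.tensor_premodule"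
    proof (induction g rule: frag_induction)
      case zero
      have "T.K +>\<^bsub>T.tensor_premodule\<^esub> 0 = U.act 0 u"
        using P.coset_eq_zero_iff[of 0] u_carrier T.K_0
        by (simp add: T.carrier_premodule U_eq[symmetric])
      then show ?case by (auto simp: T.carrier_premodule)
    next
      case (one x)
      then obtain f r where "x = (A_class h f, coset r)"
        by (auto simp: carrier_R\<mm> elim!: A_alg_cases)
      then have "T.K +>\<^bsub>T.tensor_premodule\<^esub> frag_of x = U.act (f * free_poly r) u"
        using pure_balanced[of f r] by (simp add: act_u pure_def)
      then show ?case using frag_carrier \<open>x = _\<close> by blast
    next
      case (diff a b)
      then obtain f g where f: "T.K +>\<^bsub>T.tensor_premodule\<^esub> a = U.act f u" "a \<in> carrier T.tensor_premodule"
        and g: "T.K +>\<^bsub>T.tensor_premodule\<^esub> b = U.act g u" "b \<in> carrier T.tensor_premodule" by blast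
      have ab: "a - b \<in> carrier T.tensor_premodule"
        using f(2) g(2) keys_diff[of a b] by (auto simp: T.carrier_premodule)
      have "U.act f u = (T.K +>\<^bsub>T.tensor_premodule\<^esub> (a - b)) \<oplus>\<^bsub>U\<^esub> U.act g u"
        using P.quotient_add[OF ab g(2)] f(1) g(1) by (simp add: T.premodule_add U_eq)
      moreover have "U.act f u = U.act (f - g) u \<oplus>\<^bsub>U\<^esub> U.act g u"
        using U.act_add[OF u_carrier, of "f - g" g] by simp
      moreover have "T.K +>\<^bsub>T.tensor_premodule\<^esub> (a - b) \<in> carrier U"
        unfolding U_eq P.quotient_carrier using ab by blast
      ultimately have "T.K +>\<^bsub>T.tensor_premodule\<^esub> (a - b) = U.act (f - g) u"
        using u_carrier by (metis U.M.M.add.r_cancel U.act_closed)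
      then show ?case using ab by blast
    qed
    then show "c \<in> range (\<lambda>f. U.act f u)" using c by blast
  qed
  then show ?thesis unfolding U.generator_def using u_carrier by auto
qed

lemma x_ann_u: "fx - free_const \<mu> \<in> U.ann u"
proof -
  have x: "fx = free_poly xpoly" "free_const \<mu> = free_poly [:\<mu>:]" by (simp_all add: free_poly_eq_ev)
  have "pure fx 1 = pure 1 xpoly" by (simp add: pure_balanced[of 1] x(1))
  also have "\<dots> = pure 1 [:\<mu>:]" unfolding pure_def by (subst coset_eqI[of xpoly "[:\<mu>:]"]) simp_all
  also have "\<dots> = pure (free_const \<mu>) 1" by (simp add: pure_balanced[of 1 "[:\<mu>:]"] x(2))
  finally show ?thesis
    using U.act_eq_iff[OF u_carrier] by (simp add: act_u U.ann_def)
qed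

text \<open>The universal property of \<open>U\<close>, tested on its generator: the coset of
  \<open>r\<close> paired with \<open>a\<close> goes to \<open>a r(\<mu>) v\<close>. This is
  balanced because \<open>r(x)\<close> acts on the eigenvector \<open>v\<close> as
  \<open>r(\<mu>)\<close>.\<close>

lemma ann_u_subset:
  fixes V :: "('a ore, 'v, 'm) module_scheme"
  assumes V: "ore_module h V" and v: "v \<in> carrier V" and x: "fx - free_const \<mu> \<in> ore_module.ann h V v"
  shows "U.ann u \<subseteq> ore_module.ann h V v"
proof
  interpret V: ore_module h V by (rule V)
  interpret J: ore_left_ideal h "V.ann v" by (rule V.ore_left_ideal_ann[OF v])
  fix f assume "f \<in> U.ann u"
  then have "pure f 1 = \<zero>\<^bsub>U\<^esub>" by (simp add: U.ann_def act_u)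
  then have K: "frag_of (A_class h f, coset 1) \<in> T.K"
    unfolding pure_def U_eq P.coset_eq_zero_iff[OF frag_carrier] .
  define F where "F a C = a \<odot>\<^bsub>V\<^esub> V.act (free_const (coset_value C)) v" for a C
  have F: "F (A_class h g) (coset r) = V.act (g * free_const (poly r \<mu>)) v" for g r
    by (simp add: F_def coset_value V.act_mult[OF v]) (simp add: V.act_def)
  have "F (A_class h f) (coset 1) = \<zero>\<^bsub>V\<^esub>"
  proof (rule T.pure_tensor_vanishes[OF V.M.M.abelian_group_axioms _ _ _ _ K])
    fix a n assume "a \<in> carrier (A_alg h)" "n \<in> carrier R\<mm>"
    then show "F a n \<in> carrier V" using v by (auto simp: carrier_R\<mm> F elim!: A_alg_cases)
  next
    fix a b n assume "a \<in> carrier (A_alg h)" "b \<in> carrier (A_alg h)" "n \<in> carrier R\<mm>"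
    then show "F (a \<oplus>\<^bsub>A_alg h\<^esub> b) n = F a n \<oplus>\<^bsub>V\<^esub> F b n"
      using v by (auto simp: carrier_R\<mm> F A_class_add[symmetric] distrib_right V.act_add elim!: A_alg_cases)
  next
    fix a n n' assume "a \<in> carrier (A_alg h)" "n \<in> carrier R\<mm>" "n' \<in> carrier R\<mm>"
    then show "F a (n \<oplus>\<^bsub>R\<mm>\<^esub> n') = F a n \<oplus>\<^bsub>V\<^esub> F a n'"
      using v by (auto simp: carrier_R\<mm> R\<mm>_add F free_const_add distrib_left V.act_add elim!: A_alg_cases)
  next
    fix a r n assume "a \<in> carrier (A_alg h)" "n \<in> carrier R\<mm>"
    then obtain g s where g: "a = A_class h g" and s: "n = coset s"
      by (auto simp: carrier_R\<mm> elim!: A_alg_cases)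
    have "g * free_poly r * free_const (poly s \<mu>) = g * free_const (poly s \<mu>) * free_poly r"
      by (simp add: mult.assoc free_const_commute)
    also have "J.eqv (g * free_const (poly s \<mu>) * free_poly r) (g * free_const (poly s \<mu>) * free_const (poly r \<mu>))"
      by (rule J.eqv_mult[OF J.free_poly_eqv_const[OF x]])
    also have "g * free_const (poly s \<mu>) * free_const (poly r \<mu>) = g * free_const (poly (r * s) \<mu>)"
      by (simp add: mult.assoc free_const_mult[symmetric] mult.commute)
    finally have "g * free_poly r * free_const (poly s \<mu>) - g * free_const (poly (r * s) \<mu>) \<in> V.ann v"
      unfolding J.eqv_def .
    then have "V.act (g * free_poly r * free_const (poly s \<mu>)) v = V.act (g * free_const (poly (r * s) \<mu>)) v"
      unfolding V.act_eq_iff[OF v] V.ann_def by simp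
    then show "F (a \<otimes>\<^bsub>A_alg h\<^esub> A_poly h r) n = F a (r \<odot>\<^bsub>R\<mm>\<^esub> n)"
      unfolding g s A_poly_def A_class_mult[symmetric] R\<mm>_smult F .
  qed (simp_all add: carrier_R\<mm>)
  then show "f \<in> V.ann v" by (simp add: F V.ann_def)
qed

end

section \<open>Classification\<close>

context ore_left_ideal
begin

text \<open>In the normal form over \<open>F[z]\<close>, each coefficient splits into its constant
  term and a multiple of \<open>z\<close>; the constant terms form the remainder.\<close>

lemma z_division:
  fixes p \<beta> defines "z \<equiv> z_free h p \<beta>"
  assumes p: "CHAR('a) = p" "p > 0" "h \<noteq> 0" and x: "fx - free_const \<mu> \<in> J"
  shows "\<exists>c g. f - z * g \<doteq> (\<Sum>i<p. free_const (c i) * fy ^ i)"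
proof -
  obtain s where s: "f \<doteq> (\<Sum>i<p. ev z (s i) * fy ^ i)"
    using z_normal_form[OF p x, of f \<beta>] by (auto simp: y_span_def z_def)
  define a r where "a i = coeff (s i) 0" and "r i = (THE r. s i = pCons (a i) r)" for i
  have "s i = pCons (a i) (r i)" for i
    unfolding r_def by (cases "s i") (simp add: a_def)
  then have "ev z (s i) = free_const (a i) + z * ev z (r i)" for i by (metis ev_pCons)
  then have "(\<Sum>i<p. ev z (s i) * fy ^ i)
      = (\<Sum>i<p. free_const (a i) * fy ^ i) + z * (\<Sum>i<p. ev z (r i) * fy ^ i)"
    by (simp add: distrib_right sum.distrib sum_distrib_left mult.assoc)
  then have "f - z * (\<Sum>i<p. ev z (r i) * fy ^ i) \<doteq> (\<Sum>i<p. free_const (a i) * fy ^ i)"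
    using s by (simp add: eqv_def algebra_simps)
  then show ?thesis by blast
qed

lemma free_eval_eqv:
  assumes x: "fx - free_const \<mu> \<in> J" and y: "fy - free_const \<theta> \<in> J"
  shows "f \<doteq> free_const (free_eval \<mu> \<theta> f)"
proof (induction f rule: free_alg_induct)
  case one
  show ?case by (simp add: free_eval_1)
next
  case (add f g)
  then show ?case by (simp add: free_eval_add free_const_add eqv_add)
next
  case (const c f)
  then show ?case by (simp add: free_eval_mult free_eval_const free_const_mult eqv_mult)
next
  case (x f)
  have "fx * f \<doteq> fx * free_const (free_eval \<mu> \<theta> f)" by (rule eqv_mult[OF x])
  also have "\<dots> = free_const (free_eval \<mu> \<theta> f) * fx" by (simp only: free_const_commute)
  also have "\<dots> \<doteq> free_const (free_eval \<mu> \<theta> f) * free_const \<mu>"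
    by (rule eqv_mult) (simp add: eqv_def assms)
  finally show ?case by (simp add: free_eval_mult free_eval_fx free_const_mult[symmetric] mult.commute)
next
  case (y f)
  have "fy * f \<doteq> fy * free_const (free_eval \<mu> \<theta> f)" by (rule eqv_mult[OF y])
  also have "\<dots> = free_const (free_eval \<mu> \<theta> f) * fy" by (simp only: free_const_commute)
  also have "\<dots> \<doteq> free_const (free_eval \<mu> \<theta> f) * free_const \<theta>"
    by (rule eqv_mult) (simp add: eqv_def assms)
  finally show ?case by (simp add: free_eval_mult free_eval_fy free_const_mult[symmetric] mult.commute)
qed

lemma free_const_mem_iff:
  assumes "1 \<notin> J"
  shows "free_const c \<in> J \<longleftrightarrow> c = 0"
proof
  assume c: "free_const c \<in> J"
  show "c = 0"
  proof (rule ccontr)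
    assume "c \<noteq> 0"
    then have "free_const (inverse c) * free_const c = 1"
      by (simp add: free_const_mult[symmetric])
    then show False using J_mult[OF c] assms by metis
  qed
qed (simp add: J_0)

text \<open>A common eigenvector of \<open>x\<close> and \<open>y\<close> spans a line on which
  every \<open>f\<close> acts as \<open>free_eval \<mu> \<theta> f\<close>, so its annihilator
  depends on the eigenvalues alone.\<close>

lemma ideal_eq_free_eval_kernel:
  assumes "fx - free_const \<mu> \<in> J" "fy - free_const \<theta> \<in> J" "1 \<notin> J"
  shows "J = {f. free_eval \<mu> \<theta> f = 0}"
  using eqv_mem[OF free_eval_eqv[OF assms(1,2)]] free_const_mem_iff[OF assms(3)] by auto

text \<open>\<open>y\<close> commutes with \<open>g\<close> already in the free algebra, and
  \<open>x\<close> acts as the scalar \<open>\<mu>\<close>.\<close>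

lemma g_normalizes:
  fixes \<theta>
  assumes x: "fx - free_const \<mu> \<in> J" and \<mu>: "poly h \<mu> = 0"
  defines "g \<equiv> fy - free_const \<theta>"
  shows "\<exists>f'. a * (g * f) - g * f' \<in> J"
proof -
  have "\<exists>f'. a * (g * f) \<doteq> g * f'"
  proof (induction a rule: free_alg_induct)
    case one
    show ?case by (intro exI[of _ f]) simp
  next
    case (add a b)
    then obtain f1 f2 where "a * (g * f) \<doteq> g * f1" "b * (g * f) \<doteq> g * f2" by blast
    then have "(a + b) * (g * f) \<doteq> g * (f1 + f2)" using eqv_add by (simp add: distrib_left distrib_right)
    then show ?case by blast
  next
    case (const c a)
    then obtain f' where "a * (g * f) \<doteq> g * f'" by blast
    then have "free_const c * a * (g * f) \<doteq> free_const c * (g * f')"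
      using eqv_mult by (simp add: mult.assoc)
    also have "\<dots> = g * (free_const c * f')" by (metis free_const_commute mult.assoc)
    finally show ?case by blast
  next
    case (x a)
    then obtain f' where "a * (g * f) \<doteq> g * f'" by blast
    then have "fx * a * (g * f) \<doteq> fx * (g * f')" using eqv_mult by (simp add: mult.assoc)
    also have "\<dots> \<doteq> free_const \<mu> * (g * f')"
      using x_scalar[OF assms(1) \<mu>, of "g * f'"] by (simp add: eqv_def left_diff_distrib)
    also have "\<dots> = g * (free_const \<mu> * f')" by (metis free_const_commute mult.assoc)
    finally show ?case by blast
  next
    case (y a)
    then obtain f' where "a * (g * f) \<doteq> g * f'" by blast
    then have "fy * a * (g * f) \<doteq> fy * (g * f')" using eqv_mult by (simp add: mult.assoc)
    also have "\<dots> = g * (fy * f')"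
      unfolding g_def using free_const_commute[of \<theta> fy]
      by (simp add: left_diff_distrib right_diff_distrib mult.assoc[symmetric])
    finally show ?case by blast
  qed
  then show ?thesis by (simp add: eqv_def)
qed

end

context ore_module
begin

lemma y_power_action:
  assumes "v \<in> carrier M"
  shows "(A_y h [^]\<^bsub>A_alg h\<^esub> n) \<odot>\<^bsub>M\<^esub> v = act (fy ^ n) v"
  by (simp add: act_def A_y_def A_class_power)

lemma field_basis_y_powers:
  assumes p: "CHAR('a) = p" "p > 0" "h \<noteq> 0" and gen: "generator v"
    and x: "fx - free_const \<mu> \<in> ann v" and \<mu>: "poly h \<mu> \<noteq> 0" and one: "1 \<notin> ann v"
    and z: "\<And>g. z_free h p \<beta> * g \<in> ann v"
  shows "field_basis h M p (\<lambda>n. act (fy ^ n) v)"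
proof -
  have v: "v \<in> carrier M" and M: "carrier M = range (\<lambda>f. act f v)"
    using gen by (auto simp: generator_def)
  interpret J: ore_left_ideal h "ann v" by (rule ore_left_ideal_ann[OF v])
  let ?S = "\<lambda>c. \<Sum>i<p. free_const (c i) * fy ^ i"
  have sum: "(\<Oplus>\<^bsub>M\<^esub>i\<in>{..<p}. A_const h (c i) \<odot>\<^bsub>M\<^esub> act (fy ^ i) v) = act (?S c) v" for c
    by (simp add: act_sum[OF v] act_mult[OF v]) (simp add: act_def A_const_def)
  have "bij_betw (\<lambda>c. act (?S c) v) ({..<p} \<rightarrow>\<^sub>E UNIV) (carrier M)"
  proof (rule bij_betw_imageI)
    show "inj_on (\<lambda>c. act (?S c) v) ({..<p} \<rightarrow>\<^sub>E UNIV)"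
    proof (rule inj_onI)
      fix c d assume cd: "c \<in> {..<p} \<rightarrow>\<^sub>E UNIV" "d \<in> {..<p} \<rightarrow>\<^sub>E UNIV"
        and "act (?S c) v = act (?S d) v"
      then have "?S c - ?S d \<in> ann v" using act_eq_iff[OF v] by (simp add: ann_def)
      then have "?S (\<lambda>i. c i - d i) \<in> ann v"
        by (simp add: free_const_diff left_diff_distrib sum_subtractf)
      then have "c i - d i = 0" if "i < p" for i
        using J.y_power_independent[OF p(1) x \<mu> one _ that, of "\<lambda>i. c i - d i"] by simp
      then show "c = d" using cd by (intro PiE_ext[OF cd]) auto
    qed
    show "(\<lambda>c. act (?S c) v) ` ({..<p} \<rightarrow>\<^sub>E UNIV) = carrier M"
    proof (intro equalityI subsetI)
      fix w assume "w \<in> carrier M"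
      then obtain f where w: "w = act f v" using M by blast
      obtain c g where "J.eqv (f - z_free h p \<beta> * g) (?S c)"
        using J.z_division[OF p x, of f \<beta>] by blast
      then have "f - z_free h p \<beta> * g - ?S c + z_free h p \<beta> * g \<in> ann v"
        unfolding J.eqv_def using z by (rule J.J_add)
      then have "act f v = act (?S c) v" using act_eq_iff[OF v] by (simp add: ann_def)
      \<comment> \<open>Coordinate vectors in \<open>\<rightarrow>\<^sub>E\<close> are undefined
        beyond \<open>p\<close>, so \<open>c\<close> is cut down to one.\<close>
      also have "?S c = ?S (restrict c {..<p})" by simp
      finally have "w = act (?S (restrict c {..<p})) v" unfolding w .
      then show "w \<in> (\<lambda>c. act (?S c) v) ` ({..<p} \<rightarrow>\<^sub>E UNIV)"
        using image_eqI[of w "\<lambda>c. act (?S c) v" "restrict c {..<p}" "{..<p} \<rightarrow>\<^sub>E UNIV"] by simp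
    next
      fix w assume "w \<in> (\<lambda>c. act (?S c) v) ` ({..<p} \<rightarrow>\<^sub>E UNIV)"
      then obtain c where "w = act (?S c) v" by blast
      then show "w \<in> carrier M" using v by simp
    qed
  qed
  then show ?thesis unfolding field_basis_def sum using v by simp
qed

lemma y_action:
  assumes p: "p > 1" and v: "v \<in> carrier M"
    and x: "fx - free_const \<mu> \<in> ann v" and z: "\<And>g. z_free h p \<beta> * g \<in> ann v" and "n < p"
  shows "A_y h \<odot>\<^bsub>M\<^esub> act (fy ^ n) v =
    (if n < p - 1 then act (fy ^ (n + 1)) v
     else A_const h (poly (\<delta>quot h p) \<mu>) \<odot>\<^bsub>M\<^esub> act (fy ^ 1) v \<oplus>\<^bsub>M\<^esub> A_const h \<beta> \<odot>\<^bsub>M\<^esub> act (fy ^ 0) v)"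
proof -
  interpret J: ore_left_ideal h "ann v" by (rule ore_left_ideal_ann[OF v])
  have y: "A_y h \<odot>\<^bsub>M\<^esub> act (fy ^ n) v = act (fy ^ Suc n) v"
    by (simp add: act_mult[OF v]) (simp add: act_def A_y_def)
  show ?thesis
  proof (cases "n < p - 1")
    case False
    let ?q = "poly (\<delta>quot h p) \<mu>"
    have n: "Suc n = p" using False \<open>n < p\<close> by simp
    \<comment> \<open>The definition of \<open>z\<close> solved for \<open>y^p\<close>;
      \<open>z\<close> kills \<open>v\<close>, and the polynomial acts on \<open>v\<close> through
      its value at \<open>\<mu>\<close>.\<close>
    have "fy ^ p = z_free h p \<beta> * 1 + (fy * free_poly (\<delta>quot h p) + free_const \<beta>)"
      by (simp add: z_free_def)
    also have "J.eqv \<dots> (0 + (fy * free_const ?q + free_const \<beta>))"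
      using z by (intro J.eqv_add J.eqv_mult J.free_poly_eqv_const[OF x] J.eqv_refl) (simp add: J.eqv_0_iff del: mult_1_right)
    also have "0 + (fy * free_const ?q + free_const \<beta>) = free_const ?q * fy ^ 1 + free_const \<beta> * fy ^ 0"
      by (simp add: free_const_commute)
    finally have "act (fy ^ p) v = act (free_const ?q * fy ^ 1 + free_const \<beta> * fy ^ 0) v"
      using act_eq_iff[OF v] unfolding J.eqv_def by (simp add: ann_def)
    also have "\<dots> = A_const h ?q \<odot>\<^bsub>M\<^esub> act (fy ^ 1) v \<oplus>\<^bsub>M\<^esub> A_const h \<beta> \<odot>\<^bsub>M\<^esub> act (fy ^ 0) v"
      by (simp only: act_add[OF v] act_mult[OF v]) (simp only: act_def A_const_def)
    finally show ?thesis using False unfolding y n by simp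
  qed (simp add: y)
qed

lemma x_action:
  assumes v: "v \<in> carrier M" and x: "fx - free_const \<mu> \<in> ann v"
  shows "A_x h \<odot>\<^bsub>M\<^esub> act (fy ^ n) v =
    (\<Oplus>\<^bsub>M\<^esub>j\<in>{..n}. A_const h ((- 1) ^ j * of_nat (n choose j) * poly ((\<delta> h ^^ j) xpoly) \<mu>)
       \<odot>\<^bsub>M\<^esub> act (fy ^ (n - j)) v)"
proof -
  interpret J: ore_left_ideal h "ann v" by (rule ore_left_ideal_ann[OF v])
  have "A_x h \<odot>\<^bsub>M\<^esub> act (fy ^ n) v = act (fx * fy ^ n) v"
    by (simp add: act_mult[OF v]) (simp add: act_def A_x_def)
  also have "\<dots> = act (\<Sum>j\<le>n. free_const (x_coeff h \<mu> n j) * fy ^ (n - j)) v"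
    using J.x_y_power[OF x, of n] act_eq_iff[OF v] unfolding J.eqv_def by (simp add: ann_def)
  also have "\<dots> = (\<Oplus>\<^bsub>M\<^esub>j\<in>{..n}. A_const h (x_coeff h \<mu> n j) \<odot>\<^bsub>M\<^esub> act (fy ^ (n - j)) v)"
    by (simp add: act_sum[OF v] act_mult[OF v]) (simp add: act_def A_const_def)
  finally show ?thesis by (simp only: x_coeff_def)
qed

end

context U_data
begin

lemma L_module_props:
  assumes norm: "\<And>a f. \<exists>f'. a * (e * f) - e * f' \<in> U.ann u"
  defines "L \<equiv> L_module h \<mm> (A_class h e)"
    and "l \<equiv> mult_image h \<mm> (A_class h e) +>\<^bsub>U\<^esub> u"
  shows "ore_module h L" "ore_module.generator h L l"
    and "ore_module.ann h L l = {f. \<exists>g. f - e * g \<in> U.ann u}"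
proof -
  interpret Q: ore_quotient h U u e
    using generator_u norm by unfold_locales
  have N: "mult_image h \<mm> (A_class h e) = Q.N" by (simp add: mult_image_def Q.N_def)
  have L: "L = Q.Q" "l = Q.q" by (simp_all add: L_def l_def L_module_def N)
  show "ore_module h L" unfolding L by (rule Q.Q.ore_module_axioms)
  show "ore_module.generator h L l" unfolding L by (rule Q.Q_generator)
  show "ore_module.ann h L l = {f. \<exists>g. f - e * g \<in> U.ann u}" unfolding L using Q.Q_ann by blast
qed

text \<open>One inclusion is the universal property of \<open>U\<close> together with
  \<open>e\<close> acting as zero on \<open>V\<close>; \<open>div\<close> is the other, and is
  proved by division with a vanishing remainder.\<close>

lemma L_module_ann:
  fixes V :: "('a ore, 'v, 'm) module_scheme"
  assumes norm: "\<And>a f. \<exists>f'. a * (e * f) - e * f' \<in> U.ann u"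
    and V: "ore_module h V" "v \<in> carrier V" and x: "fx - free_const \<mu> \<in> ore_module.ann h V v"
    and e: "\<And>g. e * g \<in> ore_module.ann h V v"
    and div: "\<And>f. f \<in> ore_module.ann h V v \<Longrightarrow> \<exists>g. f - e * g \<in> U.ann u"
  shows "ore_module.ann h (L_module h \<mm> (A_class h e)) (mult_image h \<mm> (A_class h e) +>\<^bsub>U\<^esub> u)
    = ore_module.ann h V v"
proof -
  interpret V: ore_module h V by (rule V)
  interpret J: ore_left_ideal h "V.ann v" by (rule V.ore_left_ideal_ann[OF V(2)])
  have "f \<in> V.ann v" if "f - e * g \<in> U.ann u" for f g
  proof -
    have "f - e * g + e * g \<in> V.ann v" using ann_u_subset[OF V x] that e J.J_add by blast
    then show ?thesis by simp
  qed
  then show ?thesis unfolding L_module_props(3)[OF norm] using div by blast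
qed

end

text \<open>Each eigenvector becomes the new generator, its annihilator being a colon ideal of the
  previous one. The carrier type is left open because both halves of the theorem use the
  result.\<close>

lemma irreducible_cases:
  fixes h :: "'a::alg_closed_field poly" and V :: "('a ore, 'v, 'm) module_scheme"
  assumes p: "CHAR('a) = p" "p > 0" "h \<noteq> 0" and irr: "irreducible_module (A_alg h) V"
  obtains v \<mu> where "ore_module.generator h V v" "1 \<notin> ore_module.ann h V v"
    "fx - free_const \<mu> \<in> ore_module.ann h V v"
    "(poly h \<mu> = 0 \<and> (\<exists>\<theta>. fy - free_const \<theta> \<in> ore_module.ann h V v)) \<or>
     (poly h \<mu> \<noteq> 0 \<and> (\<exists>\<beta>. \<forall>g. z_free h p \<beta> * g \<in> ore_module.ann h V v))"
proof -
  interpret V: ore_module h V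
    using irr by (intro ore_module.intro) (simp add: irreducible_module_def)
  have max: "ore_maximal_left_ideal h (V.ann v)" if "v \<in> carrier V" "v \<noteq> \<zero>\<^bsub>V\<^esub>" for v
    using V.ore_left_ideal_ann[OF that(1)] V.irreducible_ann[OF irr that]
    by (intro ore_maximal_left_ideal.intro ore_maximal_left_ideal_axioms.intro)
  obtain v0 where v0: "v0 \<in> carrier V" "v0 \<noteq> \<zero>\<^bsub>V\<^esub>"
    using irr V.M.M.zero_closed unfolding irreducible_module_def by blast
  obtain \<mu> f where f: "f \<notin> V.ann v0" "(fx - free_const \<mu>) * f \<in> V.ann v0"
    using ore_maximal_left_ideal.x_eigenvector[OF max[OF v0] p(1,2)] by blast
  define v1 where "v1 = V.act f v0"
  have v1: "v1 \<in> carrier V" "v1 \<noteq> \<zero>\<^bsub>V\<^esub>" using f(1) v0 by (simp_all add: v1_def V.ann_def)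
  have x1: "fx - free_const \<mu> \<in> V.ann v1" using f(2) by (simp add: v1_def V.ann_act[OF v0(1)])
  interpret J1: ore_maximal_left_ideal h "V.ann v1" by (rule max[OF v1])
  show ?thesis
  proof (cases "poly h \<mu> = 0")
    case True
    obtain \<theta> g where g: "g \<notin> V.ann v1" "(fx - free_const \<mu>) * g \<in> V.ann v1" "(fy - free_const \<theta>) * g \<in> V.ann v1"
      using J1.y_eigenvector[OF x1 True] by blast
    define v where "v = V.act g v1"
    have v: "v \<in> carrier V" "v \<noteq> \<zero>\<^bsub>V\<^esub>" using g(1) v1 by (simp_all add: v_def V.ann_def)
    have "fx - free_const \<mu> \<in> V.ann v" "fy - free_const \<theta> \<in> V.ann v"
      using g(2,3) by (simp_all add: v_def V.ann_act[OF v1(1)])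
    then show ?thesis
      using that[of v \<mu>] V.irreducible_generator[OF irr v] V.irreducible_ann(1)[OF irr v] True by blast
  next
    case False
    then show ?thesis
      using that[of v1 \<mu>] V.irreducible_generator[OF irr v1] V.irreducible_ann(1)[OF irr v1] x1
        J1.z_annihilates[OF p x1 False] by blast
  qed
qed

lemma isomorphic_V_module:
  fixes V :: "('a::alg_closed_field ore, 'v, 'm) module_scheme"
  assumes \<mu>: "poly h \<mu> = 0" and V: "ore_module h V" and gen: "ore_module.generator h V v"
    and one: "1 \<notin> ore_module.ann h V v" and x: "fx - free_const \<mu> \<in> ore_module.ann h V v"
    and y: "fy - free_const \<theta> \<in> ore_module.ann h V v"
  shows "module_isomorphic (A_alg h) V (V_module \<mu> \<theta>)"
    and "ore_module h (L_module h (max_ideal \<mu>) (g_elem h \<theta>))"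
    and "module_isomorphic (A_alg h) V (L_module h (max_ideal \<mu>) (g_elem h \<theta>))"
proof -
  interpret V: ore_module h V by (rule V)
  interpret U_data h \<mu> .
  have v: "v \<in> carrier V" using gen unfolding V.generator_def by (rule conjunct1)
  interpret J: ore_left_ideal h "V.ann v" by (rule V.ore_left_ideal_ann[OF v])
  interpret JU: ore_left_ideal h "U.ann u" by (rule U.ore_left_ideal_ann[OF u_carrier])
  have ann: "V.ann v = {f. free_eval \<mu> \<theta> f = 0}" by (rule J.ideal_eq_free_eval_kernel[OF x y one])
  show "module_isomorphic (A_alg h) V (V_module \<mu> \<theta>)"
    by (rule cyclic_modules_isomorphic[OF V ore_module_V_module[OF \<mu>] gen V_module_props(1)[OF \<mu>]])
      (simp add: ann V_module_props(2)[OF \<mu>])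
  let ?g = "fy - free_const \<theta>"
  have norm: "\<exists>f'. a * (?g * f) - ?g * f' \<in> U.ann u" for a f
    by (rule JU.g_normalizes[OF x_ann_u \<mu>])
  have g: "?g * f \<in> V.ann v" for f
    by (simp add: ann free_eval_mult free_eval_diff free_eval_fy free_eval_const)
  \<comment> \<open>The remainder of \<open>f\<close> modulo \<open>y - \<theta>\<close> is a
    constant that kills \<open>v\<close>, hence zero.\<close>
  have "\<exists>k. f - ?g * k \<in> U.ann u" if f: "f \<in> V.ann v" for f
  proof -
    obtain s where s: "f - ev ?g s \<in> U.ann u"
      using JU.ev_g_normal_form[OF x_ann_u \<mu>, of f \<theta>] by (auto simp: JU.eqv_def)
    obtain a r where "s = pCons a r" by (cases s)
    then have ev: "ev ?g s = free_const a + ?g * ev ?g r" by (simp add: ev_pCons)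
    have "f - ev ?g s \<in> V.ann v" using s ann_u_subset[OF V v x] by blast
    then have "f - (f - ev ?g s) - ?g * ev ?g r \<in> V.ann v" by (rule J.J_diff[OF J.J_diff[OF f] g])
    then have "a = 0" using J.free_const_mem_iff[OF one] by (simp add: ev)
    then show ?thesis using s ev by auto
  qed
  then have "ore_module.ann h (L_module h \<mm> (A_class h ?g)) (mult_image h \<mm> (A_class h ?g) +>\<^bsub>U\<^esub> u)
      = V.ann v"
    using L_module_ann[OF norm V v x g] by blast
  then show "module_isomorphic (A_alg h) V (L_module h (max_ideal \<mu>) (g_elem h \<theta>))"
    unfolding g_elem_eq
    by (intro cyclic_modules_isomorphic[OF V L_module_props(1)[OF norm] gen L_module_props(2)[OF norm]]) simp
  show "ore_module h (L_module h (max_ideal \<mu>) (g_elem h \<theta>))"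
    unfolding g_elem_eq by (rule L_module_props(1)[OF norm])
qed

text \<open>Once the generator \<open>l\<close> of \<open>L\<close> has the same annihilator as
  \<open>v\<close>, the facts about \<open>v\<close> apply to \<open>l\<close> and yield the basis
  and both formulas in \<open>L\<close>.\<close>

lemma isomorphic_L_module:
  fixes V :: "('a::alg_closed_field ore, 'v, 'm) module_scheme"
  assumes p: "CHAR('a) = p" "p > 0" "h \<noteq> 0"
    and \<mu>: "poly h \<mu> \<noteq> 0" and V: "ore_module h V" and gen: "ore_module.generator h V v"
    and one: "1 \<notin> ore_module.ann h V v" and x: "fx - free_const \<mu> \<in> ore_module.ann h V v"
    and z: "\<And>g. z_free h p \<beta> * g \<in> ore_module.ann h V v"
  defines "L \<equiv> L_module h (max_ideal \<mu>) (z_elem h p \<beta>)"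
    and "w \<equiv> L_vec h (max_ideal \<mu>) (z_elem h p \<beta>)"
  shows "ore_module h L"
    and "module_isomorphic (A_alg h) V L"
    and "field_basis h L p w"
    and "n < p \<Longrightarrow> A_y h \<odot>\<^bsub>L\<^esub> w n =
          (if n < p - 1 then w (n + 1)
           else A_const h (poly (\<delta>quot h p) \<mu>) \<odot>\<^bsub>L\<^esub> w 1 \<oplus>\<^bsub>L\<^esub> A_const h \<beta> \<odot>\<^bsub>L\<^esub> w 0)"
    and "A_x h \<odot>\<^bsub>L\<^esub> w n =
          (\<Oplus>\<^bsub>L\<^esub>j\<in>{..n}. A_const h ((- 1) ^ j * of_nat (n choose j) * poly ((\<delta> h ^^ j) xpoly) \<mu>)
             \<odot>\<^bsub>L\<^esub> w (n - j))"
proof -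
  interpret V: ore_module h V by (rule V)
  interpret U_data h \<mu> .
  have v: "v \<in> carrier V" using gen unfolding V.generator_def by (rule conjunct1)
  interpret J: ore_left_ideal h "V.ann v" by (rule V.ore_left_ideal_ann[OF v])
  interpret JU: ore_left_ideal h "U.ann u" by (rule U.ore_left_ideal_ann[OF u_carrier])
  let ?z = "z_free h p \<beta>"
  have norm: "\<exists>f'. a * (?z * f) - ?z * f' \<in> U.ann u" for a f
  proof -
    have "?z * a * f - a * ?z * f \<in> U.ann u"
      using JU.eqv_A_ideal[OF z_free_central[OF p, of \<beta> a], of f] by (simp add: JU.eqv_def)
    then have "- (?z * a * f - a * ?z * f) \<in> U.ann u" by (rule JU.J_minus)
    then have "a * (?z * f) - ?z * (a * f) \<in> U.ann u" by (simp add: mult.assoc)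
    then show ?thesis by blast
  qed
  \<comment> \<open>The remainder of \<open>f\<close> after division by \<open>z\<close> kills
    \<open>v\<close>; the powers of \<open>y\<close> below \<open>p\<close> are independent on
    \<open>v\<close>, so it is zero.\<close>
  have "\<exists>k. f - ?z * k \<in> U.ann u" if f: "f \<in> V.ann v" for f
  proof -
    let ?S = "\<lambda>c. \<Sum>i<p. free_const (c i) * fy ^ i"
    obtain c g where cg: "f - ?z * g - ?S c \<in> U.ann u"
      using JU.z_division[OF p x_ann_u, of f \<beta>] by (auto simp: JU.eqv_def)
    then have "f - ?z * g - ?S c \<in> V.ann v" using ann_u_subset[OF V v x] by blast
    then have "f - ?z * g - (f - ?z * g - ?S c) \<in> V.ann v" by (rule J.J_diff[OF J.J_diff[OF f z]])
    then have "c i = 0" if "i < p" for i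
      using J.y_power_independent[OF p(1) x \<mu> one _ that, of c] by simp
    then have "?S c = 0" by simp
    then show ?thesis using cg by auto
  qed
  then have ann: "ore_module.ann h (L_module h \<mm> (A_class h ?z)) (mult_image h \<mm> (A_class h ?z) +>\<^bsub>U\<^esub> u)
      = V.ann v"
    using L_module_ann[OF norm V v x z] by blast
  define l where "l = mult_image h \<mm> (z_elem h p \<beta>) +>\<^bsub>U\<^esub> u"
  have L: "ore_module h L" and genL: "ore_module.generator h L l" and annL: "ore_module.ann h L l = V.ann v"
    unfolding L_def l_def z_elem_eq
    by (rule L_module_props(1)[OF norm] L_module_props(2)[OF norm] ann)+
  interpret L: ore_module h L by (rule L)
  have l: "l \<in> carrier L" using genL unfolding L.generator_def by (rule conjunct1)
  have w: "w n = L.act (fy ^ n) l" for n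
    unfolding w_def L_vec_def l_def[symmetric] L_def[symmetric] by (rule L.y_power_action[OF l])
  have w': "w = (\<lambda>n. L.act (fy ^ n) l)" using w by blast
  have "p \<noteq> 1" using p(1) CHAR_not_1'[where 'a='a] by simp
  then have p1: "p > 1" using p(2) by simp
  show "ore_module h L" by (rule L)
  show "module_isomorphic (A_alg h) V L"
    by (rule cyclic_modules_isomorphic[OF V L gen genL]) (simp add: annL)
  show "field_basis h L p w"
    unfolding w' by (rule L.field_basis_y_powers[OF p genL _ \<mu>]) (use x one z in \<open>simp_all add: annL\<close>)
  show "A_y h \<odot>\<^bsub>L\<^esub> w n =
      (if n < p - 1 then w (n + 1)
       else A_const h (poly (\<delta>quot h p) \<mu>) \<odot>\<^bsub>L\<^esub> w 1 \<oplus>\<^bsub>L\<^esub> A_const h \<beta> \<odot>\<^bsub>L\<^esub> w 0)" if "n < p"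
    unfolding w by (rule L.y_action[OF p1 l _ _ that]) (use x z in \<open>simp_all add: annL\<close>)
  show "A_x h \<odot>\<^bsub>L\<^esub> w n =
      (\<Oplus>\<^bsub>L\<^esub>j\<in>{..n}. A_const h ((- 1) ^ j * of_nat (n choose j) * poly ((\<delta> h ^^ j) xpoly) \<mu>)
         \<odot>\<^bsub>L\<^esub> w (n - j))"
    unfolding w by (rule L.x_action[OF l]) (use x in \<open>simp add: annL\<close>)
qed

theorem corollary7p8:
  fixes h :: "'a::alg_closed_field poly" and p :: nat
  assumes "CHAR('a) = p" and "p > 0" and "h \<noteq> 0"
  shows
    "(\<forall>V :: ('a ore, 'v) module. irreducible_module (A_alg h) V \<longrightarrow>
        (\<exists>\<mu> \<theta>. poly h \<mu> = 0 \<and>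
           module_isomorphic (A_alg h) V (V_module \<mu> \<theta>) \<and>
           field_basis h (V_module \<mu> \<theta>) 1 (\<lambda>_. 1) \<and>
           A_x h \<odot>\<^bsub>V_module \<mu> \<theta>\<^esub> 1 = A_const h \<mu> \<odot>\<^bsub>V_module \<mu> \<theta>\<^esub> 1 \<and>
           A_y h \<odot>\<^bsub>V_module \<mu> \<theta>\<^esub> 1 = A_const h \<theta> \<odot>\<^bsub>V_module \<mu> \<theta>\<^esub> 1) \<or>
        (\<exists>\<mu> \<beta>. poly h \<mu> \<noteq> 0 \<and>
           (let L = L_module h (max_ideal \<mu>) (z_elem h p \<beta>);
                v = L_vec h (max_ideal \<mu>) (z_elem h p \<beta>)
            in module_isomorphic (A_alg h) V L \<and>
               field_basis h L p v \<and>
               (\<forall>n<p. A_y h \<odot>\<^bsub>L\<^esub> v n =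
                  (if n < p - 1 then v (n + 1)
                   else A_const h (poly (\<delta>quot h p) \<mu>) \<odot>\<^bsub>L\<^esub> v 1 \<oplus>\<^bsub>L\<^esub> A_const h \<beta> \<odot>\<^bsub>L\<^esub> v 0)) \<and>
               (\<forall>n<p. A_x h \<odot>\<^bsub>L\<^esub> v n =
                  (\<Oplus>\<^bsub>L\<^esub>j\<in>{..n}.
                     A_const h ((- 1) ^ j * of_nat (n choose j) * poly ((\<delta> h ^^ j) xpoly) \<mu>)
                       \<odot>\<^bsub>L\<^esub> v (n - j)))))) \<and>
     (\<forall>P. primitive_ideal TYPE('w) (A_alg h) P \<longrightarrow>
        (\<exists>\<mu> \<theta>. poly h \<mu> = 0 \<and>
           P = annihilator (A_alg h) (L_module h (max_ideal \<mu>) (g_elem h \<theta>))) \<or>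
        (\<exists>\<mu> \<beta>. poly h \<mu> \<noteq> 0 \<and>
           z_elem h p \<beta> \<in> ring_center (A_alg h) \<and>
           P = annihilator (A_alg h) (L_module h (max_ideal \<mu>) (z_elem h p \<beta>))))"
proof (intro conjI allI impI, goal_cases)
  case (1 V)
  then have irr: "irreducible_module (A_alg h) V" .
  then have V: "ore_module h V" by (intro ore_module.intro) (simp add: irreducible_module_def)
  obtain v \<mu> where gen: "ore_module.generator h V v" and one: "1 \<notin> ore_module.ann h V v"
    and x: "fx - free_const \<mu> \<in> ore_module.ann h V v"
    and cases: "(poly h \<mu> = 0 \<and> (\<exists>\<theta>. fy - free_const \<theta> \<in> ore_module.ann h V v)) \<or>
       (poly h \<mu> \<noteq> 0 \<and> (\<exists>\<beta>. \<forall>g. z_free h p \<beta> * g \<in> ore_module.ann h V v))"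
    by (rule irreducible_cases[OF assms irr])
  from cases show ?case
  proof (elim disjE conjE exE)
    fix \<theta> assume \<mu>: "poly h \<mu> = 0" and y: "fy - free_const \<theta> \<in> ore_module.ann h V v"
    show ?thesis
      using \<mu> isomorphic_V_module(1)[OF \<mu> V gen one x y] V_module_props(3-5)[OF \<mu>]
      by (intro disjI1 exI conjI)
  next
    fix \<beta> assume \<mu>: "poly h \<mu> \<noteq> 0" and z: "\<forall>g. z_free h p \<beta> * g \<in> ore_module.ann h V v"
    note L = isomorphic_L_module[OF assms \<mu> V gen one x spec[OF z]]
    show ?thesis
      unfolding Let_def
      by (intro disjI2 exI[of _ \<mu>] exI[of _ \<beta>] conjI allI impI)
        (rule \<mu> L(2) L(3) L(4) L(5) | assumption)+
  qed
next
  case (2 P)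
  then obtain M :: "('a ore, 'w) module"
    where irr: "irreducible_module (A_alg h) M" and P: "P = annihilator (A_alg h) M"
    by (auto simp: primitive_ideal_def)
  then have lM: "left_module (A_alg h) M" by (simp add: irreducible_module_def)
  then have M: "ore_module h M" by (rule ore_module.intro)
  obtain v \<mu> where gen: "ore_module.generator h M v" and one: "1 \<notin> ore_module.ann h M v"
    and x: "fx - free_const \<mu> \<in> ore_module.ann h M v"
    and cases: "(poly h \<mu> = 0 \<and> (\<exists>\<theta>. fy - free_const \<theta> \<in> ore_module.ann h M v)) \<or>
       (poly h \<mu> \<noteq> 0 \<and> (\<exists>\<beta>. \<forall>g. z_free h p \<beta> * g \<in> ore_module.ann h M v))"
    by (rule irreducible_cases[OF assms irr])
  from cases show ?case
  proof (elim disjE conjE exE)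
    fix \<theta> assume \<mu>: "poly h \<mu> = 0" and y: "fy - free_const \<theta> \<in> ore_module.ann h M v"
    note L = isomorphic_V_module(2,3)[OF \<mu> M gen one x y]
    show ?thesis
      using \<mu> annihilator_isomorphic[OF lM ore_module.axioms[OF L(1)] L(2)] unfolding P by blast
  next
    fix \<beta> assume \<mu>: "poly h \<mu> \<noteq> 0" and z: "\<forall>g. z_free h p \<beta> * g \<in> ore_module.ann h M v"
    note L = isomorphic_L_module(1,2)[OF assms \<mu> M gen one x spec[OF z]]
    show ?thesis
      using \<mu> annihilator_isomorphic[OF lM ore_module.axioms[OF L(1)] L(2)] z_elem_in_center[OF assms]
      unfolding P by blast
  qed
qed

end
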